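(* Fix $x\in H^{n+1}$. Let $\alpha_t$ be the one-parameter group of $*$-automorphisms of $C^*_r(\Gamma,\Lambda)$ given by $(\alpha_t f)_g(\xi)=e^{itD(x,xg^{-1},\xi)}f_g(\xi)$, and let $\tau:C^*_r(\Gamma,\Lambda)\to\mathbb{C}$ be the positive functional $\tau(f)=\int_\Lambda f_e\,d\mu_x$, where $e\in\Gamma$ is the identity and $d\mu_x$ is the Patterson-Sullivan measure. Given $f,f'\in C^*_r(\Gamma,\Lambda)$, put $F(t)=\tau(f\,\alpha_t(f'))$ for $t\in\mathbb{R}$. Then $F$ has a continuous bounded continuation to $\{z\in\mathbb{C}:0\le\operatorname{Im}(z)\le\delta\}$ that is analytic in $\{z\in\mathbb{C}:0<\operatorname{Im}(z)<\delta\}$, with $$F(t+i\delta)=\tau(\alpha_t(f')\,f)\qquad\text{for all } t\in\mathbb{R}.$$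
   Context: $\Gamma$ is a torsion-free nonelementary (not virtually abelian) discrete subgroup of $\mathrm{Isom}^+(H^{n+1})$, acting on the right on $H^{n+1}$ and on the sphere at infinity $S^n$. $\Lambda\subset S^n$ is its limit set. $R_g$ denotes the action of $g\in\Gamma$ on $\Lambda$, and $\Gamma$ acts on $C(\Lambda)$ by $(g\cdot f)(\xi)=f(\xi g)$. For $x,x'\in H^{n+1}$ and $\xi\in\Lambda$, $D(x,x',\xi)=\lim_{x''\to\xi}\bigl(d(x,x'')-d(x',x'')\bigr)$ with $d$ the hyperbolic distance. The algebraic cross-product $C(\Lambda)\rtimes\Gamma$ consists of finite formal sums $f=\sum_g f_g\,g$, $f_g\in C(\Lambda)$, with product $(ff')_\gamma(\xi)=\sum_{gg'=\gamma}f_g(\xi)f'_{g'}(\xi g)$ and involution $(f^* )_g(\xi)=\overline{f_{g^{-1}}(\xi g)}$. For $\xi\in\Lambda$, $(\pi^\xi(f)c)_\gamma=\sum_{\gamma'}f_{\gamma(\gamma')^{-1}}(\xi\gamma^{-1})c_{\gamma'}$ on $l^2(\Gamma)$. $C^*_r(\Gamma,\Lambda)$ is the completion of $C(\Lambda)\rtimes\Gamma$ in the norm $\sup_{\xi\in\Lambda}\|\pi^\xi(f)\|$; its elements are determined by coefficients $f_g\in C(\Lambda)$. Fix a basepoint $x_0\in H^{n+1}$. The critical exponent is $\delta=\delta(\Gamma)=\inf\{s:\sum_{\gamma\in\Gamma}e^{-s\,d(x_0,x_0\gamma)}<\infty\}$. The Patterson-Sullivan measures $d\mu_x$ ($x\in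 H^{n+1}$) are the nonzero finite positive measures on $\Lambda$ constructed, when $\sum_\gamma e^{-\delta d(x_0,x_0\gamma)}=\infty$, as a weak limit $$d\mu_x=\lim_{s\to\delta^+}\frac{\sum_{\gamma}e^{-s\,d(x,x_0\gamma)}\,\delta_{x_0\gamma}}{\sum_{\gamma}e^{-s\,d(x_0,x_0\gamma)}}$$ of measures on $H^{n+1}\cup S^n$ (and by Patterson's standard modification of this when the series converges at $\delta$). They satisfy $d\mu_x=e^{-\delta D(x,x',\cdot)}d\mu_{x'}$ and $(R_g)_*d\mu_x=d\mu_{xg}$. *)

theory Defs
  imports "HOL-Analysis.Analysis" "HOL-Algebra.Coset"
begin

section \<open>Hyperbolic space and its orientation-preserving isometries\<close>

text \<open>
  Poincare ball model: \<open>H\<^bsup>n+1\<^esup>\<close> is the open unit ball of \<open>real ^ 'n\<close> with \<open>CARD('n) = n + 1\<close>,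
  the sphere at infinity is the unit sphere, and the compactification is the closed unit ball
  with its Euclidean topology.
\<close>

abbreviation hyp_space :: "(real ^ 'n) set" where
  "hyp_space \<equiv> ball 0 1"

abbreviation sphere_at_infinity :: "(real ^ 'n) set" where
  "sphere_at_infinity \<equiv> sphere 0 1"

definition hyp_dist :: "real ^ 'n \<Rightarrow> real ^ 'n \<Rightarrow> real" where
  "hyp_dist x y =
     arcosh (1 + 2 * (norm (x - y))\<^sup>2 / ((1 - (norm x)\<^sup>2) * (1 - (norm y)\<^sup>2)))"

text \<open>
  An isometry is stored as a function on the whole vector space that is the identity off the ball,
  so that equality of functions is equality of isometries.  The group acts on the right: the point
  \<open>x g\<close> is \<open>g x\<close>, and \<open>x (g h) = (x g) h\<close> makes the product of \<open>g\<close> and \<open>h\<close> equal to \<open>h \<circ> g\<close>.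
\<close>

definition Isom_plus :: "(real ^ 'n \<Rightarrow> real ^ 'n) monoid" where
  "Isom_plus =
     \<lparr>carrier = {g. g permutes hyp_space
         \<and> (\<forall>x\<in>hyp_space. \<forall>y\<in>hyp_space. hyp_dist (g x) (g y) = hyp_dist x y)
         \<and> (\<forall>x\<in>hyp_space. g differentiable (at x) \<and> det (jacobian g (at x)) > 0)},
      monoid.mult = (\<lambda>g h. h \<circ> g), one = id\<rparr>"

text \<open>
  The action on the sphere at infinity is the continuous extension of the isometry (the stored
  values of \<open>g\<close> on the sphere itself carry no information).
\<close>

definition bdry_act :: "(real ^ 'n \<Rightarrow> real ^ 'n) \<Rightarrow> real ^ 'n \<Rightarrow> real ^ 'n" where
  "bdry_act g \<xi> = Lim (at \<xi> within hyp_space) g"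

definition busemann_diff :: "real ^ 'n \<Rightarrow> real ^ 'n \<Rightarrow> real ^ 'n \<Rightarrow> real" where
  "busemann_diff x x' \<xi> =
     Lim (at \<xi> within hyp_space) (\<lambda>x''. hyp_dist x x'' - hyp_dist x' x'')"


section \<open>Discrete groups\<close>

text \<open>
  Discreteness refers to the library topology on the function type, which is the topology of
  pointwise convergence; on isometries this is the usual (compact-open) topology.
\<close>

definition discrete_isom_group :: "(real ^ 'n \<Rightarrow> real ^ 'n) set \<Rightarrow> bool" where
  "discrete_isom_group \<Gamma> \<longleftrightarrow> subgroup \<Gamma> Isom_plus \<and> discrete \<Gamma>"

definition torsion_free :: "(real ^ 'n \<Rightarrow> real ^ 'n) set \<Rightarrow> bool" where
  "torsion_free \<Gamma> \<longleftrightarrow>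
     (\<forall>g\<in>\<Gamma>. \<forall>k::nat. k > 0 \<longrightarrow> g [^]\<^bsub>Isom_plus\<^esub> k = \<one>\<^bsub>Isom_plus\<^esub> \<longrightarrow> g = \<one>\<^bsub>Isom_plus\<^esub>)"

definition virtually_abelian :: "(real ^ 'n \<Rightarrow> real ^ 'n) set \<Rightarrow> bool" where
  "virtually_abelian \<Gamma> \<longleftrightarrow>
     (\<exists>A. subgroup A (Isom_plus\<lparr>carrier := \<Gamma>\<rparr>)
        \<and> comm_group (Isom_plus\<lparr>carrier := A\<rparr>)
        \<and> finite (rcosets\<^bsub>Isom_plus\<lparr>carrier := \<Gamma>\<rparr>\<^esub> A))"

definition limit_set :: "(real ^ 'n \<Rightarrow> real ^ 'n) set \<Rightarrow> (real ^ 'n) set" where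
  "limit_set \<Gamma> = {\<xi> \<in> sphere_at_infinity. \<exists>x\<in>hyp_space. \<xi> islimpt ((\<lambda>g. g x) ` \<Gamma>)}"

definition critical_exponent :: "(real ^ 'n \<Rightarrow> real ^ 'n) set \<Rightarrow> real ^ 'n \<Rightarrow> real" where
  "critical_exponent \<Gamma> x0 = Inf {s. (\<lambda>\<gamma>. exp (- s * hyp_dist x0 (\<gamma> x0))) summable_on \<Gamma>}"


section \<open>Patterson-Sullivan measures\<close>

text \<open>
  The weight \<open>h\<close> multiplies the term of \<open>\<gamma>\<close> in the Poincare series based at \<open>x\<close> by
  \<open>h (exp (d(x, x0 \<gamma>)))\<close>.  If the series diverges at the critical exponent, there is no weight
  (\<open>h = 1\<close>); otherwise \<open>h\<close> is a function as in Patterson's modification: it makes the series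
  diverge at the critical exponent without changing the exponent, and it grows subpolynomially.
\<close>

definition patterson_weight ::
  "(real ^ 'n \<Rightarrow> real ^ 'n) set \<Rightarrow> real ^ 'n \<Rightarrow> (real \<Rightarrow> real) \<Rightarrow> bool" where
  "patterson_weight \<Gamma> x0 h \<longleftrightarrow>
     (let \<delta> = critical_exponent \<Gamma> x0 in
      if \<not> (\<lambda>\<gamma>. exp (- \<delta> * hyp_dist x0 (\<gamma> x0))) summable_on \<Gamma>
      then h = (\<lambda>_. 1)
      else continuous_on {0<..} h \<and> mono_on {0<..} h \<and> (\<forall>r>0. h r > 0)
         \<and> (\<forall>s. (\<lambda>\<gamma>. exp (- s * hyp_dist x0 (\<gamma> x0)) * h (exp (hyp_dist x0 (\<gamma> x0)))) summable_on \<Gamma>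
               \<longleftrightarrow> s > \<delta>)
         \<and> (\<forall>\<epsilon>>0. \<exists>r0>0. \<forall>r>r0. \<forall>t>1. h (t * r) \<le> t powr \<epsilon> * h r))"

text \<open>
  The integral of \<open>\<phi>\<close> against the \<open>s\<close>-th approximating measure on the closed ball.
\<close>

definition patterson_mean ::
  "(real ^ 'n \<Rightarrow> real ^ 'n) set \<Rightarrow> real ^ 'n \<Rightarrow> (real \<Rightarrow> real) \<Rightarrow> real \<Rightarrow> real ^ 'n
     \<Rightarrow> (real ^ 'n \<Rightarrow> real) \<Rightarrow> real" where
  "patterson_mean \<Gamma> x0 h s x \<phi> =
     (\<Sum>\<^sub>\<infinity>\<gamma>\<in>\<Gamma>. exp (- s * hyp_dist x (\<gamma> x0)) * h (exp (hyp_dist x (\<gamma> x0))) * \<phi> (\<gamma> x0))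
     / (\<Sum>\<^sub>\<infinity>\<gamma>\<in>\<Gamma>. exp (- s * hyp_dist x0 (\<gamma> x0)) * h (exp (hyp_dist x0 (\<gamma> x0))))"

text \<open>
  \<open>\<mu> x\<close> is a finite Borel measure on the limit set.  Weak limits exist by compactness along
  sequences \<open>s\<^sub>k\<close> decreasing to the critical exponent (one sequence for all \<open>x\<close>), so any family
  arising from some such sequence is admitted.
\<close>

definition patterson_sullivan ::
  "(real ^ 'n \<Rightarrow> real ^ 'n) set \<Rightarrow> real ^ 'n \<Rightarrow> (real ^ 'n \<Rightarrow> (real ^ 'n) measure) \<Rightarrow> bool" where
  "patterson_sullivan \<Gamma> x0 \<mu> \<longleftrightarrow>
     (\<forall>x\<in>hyp_space. finite_measure (\<mu> x)
        \<and> sets (\<mu> x) = sets (restrict_space borel (limit_set \<Gamma>)))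
     \<and> (\<exists>h s. patterson_weight \<Gamma> x0 h
        \<and> (\<forall>k::nat. s k > critical_exponent \<Gamma> x0)
        \<and> s \<longlonglongrightarrow> critical_exponent \<Gamma> x0
        \<and> (\<forall>x\<in>hyp_space. \<forall>\<phi>. continuous_on (cball 0 1) \<phi> \<longrightarrow>
             (\<lambda>k. patterson_mean \<Gamma> x0 h (s k) x \<phi>) \<longlonglongrightarrow> (\<integral>\<xi>. \<phi> \<xi> \<partial>\<mu> x)))"


section \<open>The reduced crossed product\<close>

text \<open>
  Elements are coefficient families \<open>f g \<xi>\<close>; only the values with \<open>g \<in> \<Gamma>\<close> and \<open>\<xi>\<close> in the limit
  set matter.
\<close>

type_synonym 'n coeffs = "(real ^ 'n \<Rightarrow> real ^ 'n) \<Rightarrow> real ^ 'n \<Rightarrow> complex"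

definition alg_crossed_product :: "(real ^ 'n \<Rightarrow> real ^ 'n) set \<Rightarrow> 'n coeffs set" where
  "alg_crossed_product \<Gamma> =
     {f. (\<forall>g\<in>\<Gamma>. continuous_on (limit_set \<Gamma>) (f g))
       \<and> finite {g \<in> \<Gamma>. \<exists>\<xi>\<in>limit_set \<Gamma>. f g \<xi> \<noteq> 0}}"

definition ell2 :: "'g set \<Rightarrow> ('g \<Rightarrow> complex) set" where
  "ell2 \<Gamma> = {c. (\<lambda>\<gamma>. (cmod (c \<gamma>))\<^sup>2) summable_on \<Gamma>}"

definition ell2_norm :: "'g set \<Rightarrow> ('g \<Rightarrow> complex) \<Rightarrow> real" where
  "ell2_norm \<Gamma> c = sqrt (\<Sum>\<^sub>\<infinity>\<gamma>\<in>\<Gamma>. (cmod (c \<gamma>))\<^sup>2)"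

definition regular_rep ::
  "(real ^ 'n \<Rightarrow> real ^ 'n) set \<Rightarrow> real ^ 'n \<Rightarrow> 'n coeffs
     \<Rightarrow> ((real ^ 'n \<Rightarrow> real ^ 'n) \<Rightarrow> complex) \<Rightarrow> ((real ^ 'n \<Rightarrow> real ^ 'n) \<Rightarrow> complex)" where
  "regular_rep \<Gamma> \<xi> f c \<gamma> =
     (\<Sum>\<^sub>\<infinity>\<gamma>'\<in>\<Gamma>. f (\<gamma> \<otimes>\<^bsub>Isom_plus\<^esub> inv\<^bsub>Isom_plus\<^esub> \<gamma>') (bdry_act (inv\<^bsub>Isom_plus\<^esub> \<gamma>) \<xi>) * c \<gamma>')"

definition reduced_norm :: "(real ^ 'n \<Rightarrow> real ^ 'n) set \<Rightarrow> 'n coeffs \<Rightarrow> real" where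
  "reduced_norm \<Gamma> f =
     (SUP \<xi>\<in>limit_set \<Gamma>. SUP c\<in>{c \<in> ell2 \<Gamma>. ell2_norm \<Gamma> c \<le> 1}. ell2_norm \<Gamma> (regular_rep \<Gamma> \<xi> f c))"

text \<open>
  The completion: since \<open>\<parallel>f\<^sub>g\<parallel>\<^sub>\<infinity>\<close> is at most the reduced norm and an element of the completion is
  determined by its coefficients, the class of a Cauchy sequence is represented by the family of
  uniform limits of its coefficients.
\<close>

definition reduced_crossed_product :: "(real ^ 'n \<Rightarrow> real ^ 'n) set \<Rightarrow> 'n coeffs set" where
  "reduced_crossed_product \<Gamma> =
     {f. \<exists>a :: nat \<Rightarrow> 'n coeffs. (\<forall>k. a k \<in> alg_crossed_product \<Gamma>)
       \<and> (\<forall>\<epsilon>>0. \<exists>N. \<forall>j\<ge>N. \<forall>k\<ge>N. reduced_norm \<Gamma> (\<lambda>g \<xi>. a j g \<xi> - a k g \<xi>) < \<epsilon>)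
       \<and> (\<forall>g\<in>\<Gamma>. uniform_limit (limit_set \<Gamma>) (\<lambda>k. a k g) (f g) sequentially)}"

text \<open>
  On the completion the coefficient sums of the product are in general infinite; they converge
  absolutely because the rows and columns of the matrices of \<open>\<pi>\<^bsup>\<xi>\<^esup>(f)\<close> and \<open>\<pi>\<^bsup>\<xi>\<^esup>(f')\<close> are square
  summable, and they give the continuous extension of the product.
\<close>

definition cp_mult ::
  "(real ^ 'n \<Rightarrow> real ^ 'n) set \<Rightarrow> 'n coeffs \<Rightarrow> 'n coeffs \<Rightarrow> 'n coeffs" where
  "cp_mult \<Gamma> f f' \<gamma> \<xi> =
     (\<Sum>\<^sub>\<infinity>(g, g')\<in>{(g, g') \<in> \<Gamma> \<times> \<Gamma>. g \<otimes>\<^bsub>Isom_plus\<^esub> g' = \<gamma>}. f g \<xi> * f' g' (bdry_act g \<xi>))"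

definition cp_flow :: "real ^ 'n \<Rightarrow> real \<Rightarrow> 'n coeffs \<Rightarrow> 'n coeffs" where
  "cp_flow x t f g \<xi> =
     exp (\<i> * complex_of_real (t * busemann_diff x ((inv\<^bsub>Isom_plus\<^esub> g) x) \<xi>)) * f g \<xi>"

definition ps_functional :: "(real ^ 'n) measure \<Rightarrow> 'n coeffs \<Rightarrow> complex" where
  "ps_functional m f = (\<integral>\<xi>. f \<one>\<^bsub>Isom_plus\<^esub> \<xi> \<partial>m)"

end

theory Submission
  imports Defs "HOL-Complex_Analysis.Cauchy_Integral_Formula"
begin

text \<open>
  With \<open>D\<^sub>g(\<xi>) = D(x, x g\<^sup>-\<^sup>1, \<xi>)\<close>, the continuation is
  \<open>F(z) = \<Sum>\<^sub>g \<integral> f\<^sub>g(\<xi>) f'\<^bsub>g\<^sup>-\<^sup>1\<^esub>(\<xi> g) exp(-i z D\<^sub>g(\<xi>)) d\<mu>\<^sub>x\<close>, a sum of entire functions.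
  On the strip \<open>\<bar>exp(-i z D\<^sub>g)\<bar> \<le> 1 + exp(\<delta> D\<^sub>g)\<close>.  Conformality and equivariance of the
  Patterson-Sullivan measures turn the weight \<open>exp(\<delta> D\<^sub>g)\<close> into the substitution \<open>\<xi> = \<eta> g\<^sup>-\<^sup>1\<close>:
  this gives the value of \<open>F\<close> on the line \<open>Im z = \<delta>\<close>, and it bounds the \<open>g\<close>-th term by
  \<open>\<integral> \<bar>f\<^sub>g(\<xi>) f'\<^bsub>g\<^sup>-\<^sup>1\<^esub>(\<xi> g)\<bar> d\<mu>\<^sub>x + \<integral> \<bar>f\<^sub>g(\<xi> g\<^sup>-\<^sup>1) f'\<^bsub>g\<^sup>-\<^sup>1\<^esub>(\<xi>)\<bar> d\<mu>\<^sub>x\<close>.  These bounds are summable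
  by the Cauchy-Schwarz inequality, because rows and columns of the matrices \<open>\<pi>\<^sup>\<xi>(f)\<close> are square
  summable uniformly in \<open>\<xi>\<close>.

  In the ball model an isometry \<open>g\<close> scales \<open>\<bar>y - z\<bar>\<^sup>2\<close> by the product of
  \<open>(1 - \<bar>g y\<bar>\<^sup>2) / (1 - \<bar>y\<bar>\<^sup>2)\<close> and \<open>(1 - \<bar>g z\<bar>\<^sup>2) / (1 - \<bar>z\<bar>\<^sup>2)\<close>.  Hence it is Lipschitz for the
  Euclidean metric and extends continuously to the sphere.
\<close>

section \<open>Distances and Busemann functions in the ball model\<close>

text \<open>\<open>patterson_sullivan\<close> only states weak convergence of weighted orbit sums,
  so conformality and equivariance must be extracted from it. Equivariance is exact for every
  approximating mean, by reindexing the series. Conformality appears only in the limit: off a finite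
  part of the orbit, the weights seen from two basepoints have a quotient uniformly close to
  exp(\<delta> D), because the exponents tend to \<delta> and \<open>h\<close> grows
  subpolynomially; the finite part becomes negligible because divergence at \<delta> drives the
  normalizing series to infinity. Weak convergence tests functions on the closed ball, whereas the
  crossed product lives on the limit set. Hence Busemann functions and isometries are extended
  continuously to the whole closed ball, where identities spread from the interior by density.
  Boundary action and Busemann functions are defined by \<open>Lim\<close>, which carries
  information only once convergence is established. Discreteness is a topological condition, so
  finiteness of displacement sets, and with it countability of \<Gamma>, takes a compactness
  argument.\<close>

lemma one_minus_norm_sq_pos:
  fixes x :: "'a :: real_normed_vector"
  shows "x \<in> ball 0 1 \<Longrightarrow> 0 < 1 - (norm x)\<^sup>2"
  by (simp add: power_less_one_iff abs_square_less_1)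

lemma one_minus_norm_sq_nonneg:
  fixes x :: "'a :: real_normed_vector"
  shows "x \<in> cball 0 1 \<Longrightarrow> 0 \<le> 1 - (norm x)\<^sup>2"
  by (simp add: power_le_one)

lemma hyp_dist_arg_ge_1:
  assumes "x \<in> hyp_space" "y \<in> hyp_space"
  shows "1 \<le> 1 + 2 * (norm (x - y))\<^sup>2 / ((1 - (norm x)\<^sup>2) * (1 - (norm y)\<^sup>2))"
  using one_minus_norm_sq_pos[OF assms(1)] one_minus_norm_sq_pos[OF assms(2)] by simp

lemma cosh_hyp_dist:
  assumes "x \<in> hyp_space" "y \<in> hyp_space"
  shows "cosh (hyp_dist x y)
           = 1 + 2 * (norm (x - y))\<^sup>2 / ((1 - (norm x)\<^sup>2) * (1 - (norm y)\<^sup>2))"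
  unfolding hyp_dist_def by (rule cosh_arcosh_real[OF hyp_dist_arg_ge_1[OF assms]])

lemma hyp_dist_nonneg:
  assumes "x \<in> hyp_space" "y \<in> hyp_space"
  shows "0 \<le> hyp_dist x y"
  unfolding hyp_dist_def using hyp_dist_arg_ge_1[OF assms] by (simp add: arcosh_real_def add_increasing2)

lemma hyp_dist_commute: "hyp_dist x y = hyp_dist y x"
  by (simp add: hyp_dist_def norm_minus_commute mult.commute)

text \<open>
  \<open>horo x y = (1 - \<bar>y\<bar>\<^sup>2) exp (d(x, y))\<close> inside the ball; this form extends continuously, without
  zeros, to the closed ball.
\<close>

definition horo :: "real ^ 'n \<Rightarrow> real ^ 'n \<Rightarrow> real" where
  "horo x y =
     (1 - (norm y)\<^sup>2) + 2 * (norm (x - y))\<^sup>2 / (1 - (norm x)\<^sup>2)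
     + sqrt (((1 - (norm y)\<^sup>2) + 2 * (norm (x - y))\<^sup>2 / (1 - (norm x)\<^sup>2))\<^sup>2 - (1 - (norm y)\<^sup>2)\<^sup>2)"

lemma continuous_on_horo: "continuous_on A (horo x)"
  \<comment> \<open>Written as a product with a constant inverse, the division imposes no condition
    on \<open>x\<close>.\<close>
  unfolding horo_def divide_inverse by (intro continuous_intros)

text \<open>The defect of \<open>y\<close> vanishes only on the sphere and the distance term only at
  \<open>y = x\<close>; since \<open>x\<close> lies inside, they never vanish together. Hence
  \<open>ln (horo x y)\<close> is continuous up to the sphere.\<close>

lemma horo_pos:
  assumes x: "x \<in> hyp_space" and y: "y \<in> cball 0 1"
  shows "0 < horo x y"
proof -
  let ?v = "1 - (norm y)\<^sup>2" and ?b = "2 * (norm (x - y))\<^sup>2 / (1 - (norm x)\<^sup>2)"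
  have v: "0 \<le> ?v" and b: "0 \<le> ?b"
    using one_minus_norm_sq_nonneg[OF y] one_minus_norm_sq_pos[OF x] by auto
  have "0 < ?v + ?b"
  proof (cases "y \<in> ball 0 1")
    case True
    then show ?thesis using one_minus_norm_sq_pos[of y] b by simp
  next
    case False
    then have "x \<noteq> y" using x by auto
    then have "0 < ?b" using one_minus_norm_sq_pos[OF x] by simp
    then show ?thesis using v by linarith
  qed
  moreover have "?v\<^sup>2 \<le> (?v + ?b)\<^sup>2" using v b by (intro power_mono) auto
  then have "0 \<le> sqrt ((?v + ?b)\<^sup>2 - ?v\<^sup>2)" by simp
  ultimately show ?thesis unfolding horo_def by linarith
qed

text \<open>The exponential of arcosh u is u + sqrt(u^2 - 1); multiplying by the defect of
  \<open>y\<close> and moving that factor under the root gives \<open>horo\<close>.\<close>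

lemma exp_hyp_dist:
  assumes x: "x \<in> hyp_space" and y: "y \<in> hyp_space"
  shows "exp (hyp_dist x y) = horo x y / (1 - (norm y)\<^sup>2)"
proof -
  let ?v = "1 - (norm y)\<^sup>2" and ?b = "2 * (norm (x - y))\<^sup>2 / (1 - (norm x)\<^sup>2)"
  define u where "u = 1 + 2 * (norm (x - y))\<^sup>2 / ((1 - (norm x)\<^sup>2) * (1 - (norm y)\<^sup>2))"
  have v: "0 < ?v" using one_minus_norm_sq_pos[OF y] .
  have u1: "1 \<le> u" using hyp_dist_arg_ge_1[OF x y] by (simp add: u_def)
  then have "1 \<le> u\<^sup>2" by (simp add: one_le_power)
  then have sq: "0 \<le> sqrt (u\<^sup>2 - 1)" by simp
  have uv: "?v * u = ?v + ?b"
  proof -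
    have "?v * (b / (c * ?v)) = b / c" for b c :: real using v by simp
    then show ?thesis by (simp only: u_def distrib_left mult_1_right)
  qed
  have "exp (hyp_dist x y) = u + sqrt (u\<^sup>2 - 1)"
    unfolding hyp_dist_def u_def[symmetric] using u1 sq by (simp add: arcosh_real_def add_pos_nonneg)
  moreover have "?v * sqrt (u\<^sup>2 - 1) = sqrt ((?v + ?b)\<^sup>2 - ?v\<^sup>2)"
  proof -
    have "?v * sqrt (u\<^sup>2 - 1) = sqrt (?v\<^sup>2 * (u\<^sup>2 - 1))"
      using v by (simp add: real_sqrt_mult)
    also have "?v\<^sup>2 * (u\<^sup>2 - 1) = (?v * u)\<^sup>2 - ?v\<^sup>2" by (simp only: power_mult_distrib right_diff_distrib mult_1_right)
    finally show ?thesis by (simp only: uv)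
  qed
  ultimately have "?v * exp (hyp_dist x y) = horo x y"
    unfolding horo_def by (simp add: distrib_left uv)
  then show ?thesis using v by (simp add: field_simps)
qed

text \<open>The factor of \<open>exp_hyp_dist\<close> that blows up at the sphere does not depend on
  the first point, so it cancels. What remains is continuous on the closed ball, which is why
  Busemann functions exist.\<close>

lemma hyp_dist_diff:
  assumes x: "x \<in> hyp_space" and x': "x' \<in> hyp_space" and y: "y \<in> hyp_space"
  shows "hyp_dist x y - hyp_dist x' y = ln (horo x y) - ln (horo x' y)"
proof -
  have "ln (exp (hyp_dist z y)) = ln (horo z y) - ln (1 - (norm y)\<^sup>2)" if "z \<in> hyp_space" for z
    unfolding exp_hyp_dist[OF that y]
    using horo_pos[OF that, of y] one_minus_norm_sq_pos[OF y] y by (simp add: ln_div)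
  from this[OF x] this[OF x'] show ?thesis by simp
qed

lemma sphere_islimpt_ball:
  fixes \<xi> :: "'a :: {real_normed_vector, perfect_space}"
  assumes "\<xi> \<in> sphere 0 1"
  shows "\<xi> islimpt ball 0 1"
  using assms by (simp add: islimpt_ball)

lemma at_within_ball_neq_bot:
  fixes \<xi> :: "real ^ 'n"
  assumes "\<xi> \<in> sphere_at_infinity"
  shows "at \<xi> within hyp_space \<noteq> bot"
  using sphere_islimpt_ball[OF assms] by (simp add: trivial_limit_within)

lemma tendsto_at_sphere:
  fixes h :: "real ^ 'n \<Rightarrow> 'b :: topological_space"
  assumes "continuous_on (cball 0 1) h" "\<xi> \<in> sphere_at_infinity"
  shows "(h \<longlongrightarrow> h \<xi>) (at \<xi> within hyp_space)"
proof -
  have "(h \<longlongrightarrow> h \<xi>) (at \<xi> within cball 0 1)"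
    using assms by (auto simp: continuous_on_def)
  then show ?thesis by (rule tendsto_within_subset) auto
qed

lemma continuous_on_ln_horo:
  assumes "x \<in> hyp_space"
  shows "continuous_on (cball 0 1) (\<lambda>y. ln (horo x y))"
  using horo_pos[OF assms] by (intro continuous_on_ln continuous_on_horo) force

text \<open>Replaces the \<open>Lim\<close> of the definition by a formula: the limit exists by
  continuity of \<open>ln (horo x y)\<close> in \<open>y\<close>, and it is unique because sphere
  points are limit points of the ball.\<close>

lemma busemann_diff_eq:
  assumes x: "x \<in> hyp_space" and x': "x' \<in> hyp_space" and \<xi>: "\<xi> \<in> sphere_at_infinity"
  shows "busemann_diff x x' \<xi> = ln (horo x \<xi>) - ln (horo x' \<xi>)"
proof -
  have "((\<lambda>y. ln (horo x y) - ln (horo x' y)) \<longlongrightarrow> ln (horo x \<xi>) - ln (horo x' \<xi>))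
          (at \<xi> within hyp_space)"
    by (rule tendsto_at_sphere[OF _ \<xi>]) (intro continuous_intros continuous_on_ln_horo x x')
  then have "((\<lambda>y. hyp_dist x y - hyp_dist x' y) \<longlongrightarrow> ln (horo x \<xi>) - ln (horo x' \<xi>))
          (at \<xi> within hyp_space)"
    by (rule Lim_transform_eventually)
       (auto simp: eventually_at_filter hyp_dist_diff[OF x x'] intro!: always_eventually)
  then show ?thesis
    unfolding busemann_diff_def by (rule tendsto_Lim[OF at_within_ball_neq_bot[OF \<xi>]])
qed

text \<open>Compactness of the closed ball bounds the continuous extension; no triangle inequality
  for \<open>hyp_dist\<close> is invoked.\<close>

lemma hyp_dist_diff_bounded:
  assumes x: "x \<in> hyp_space" and x': "x' \<in> hyp_space"
  obtains C where "0 \<le> C" "\<And>y. y \<in> hyp_space \<Longrightarrow> \<bar>hyp_dist x y - hyp_dist x' y\<bar> \<le> C"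
proof -
  have "compact ((\<lambda>y. ln (horo x y) - ln (horo x' y)) ` cball 0 1)"
    by (intro compact_continuous_image continuous_intros continuous_on_ln_horo x x' compact_cball)
  from compact_imp_bounded[OF this]
  obtain C where C: "\<forall>y\<in>cball 0 1. \<bar>ln (horo x y) - ln (horo x' y)\<bar> \<le> C"
    unfolding bounded_iff by auto
  show ?thesis
  proof
    show "0 \<le> C" using C[rule_format, of 0] by simp
    show "\<bar>hyp_dist x y - hyp_dist x' y\<bar> \<le> C" if "y \<in> hyp_space" for y
      using C that hyp_dist_diff[OF x x' that] by auto
  qed
qed

section \<open>Isometries of the ball\<close>

text \<open>Isometries are stored as permutations of the whole vector space, so their group inverse
  is this total inverse function, as \<open>inv_Isom_plus\<close> confirms.\<close>

abbreviation inv_fun :: "('a \<Rightarrow> 'b) \<Rightarrow> 'b \<Rightarrow> 'a" where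
  "inv_fun \<equiv> inv_into UNIV"

lemma Isom_plus_mult [simp]: "g \<otimes>\<^bsub>Isom_plus\<^esub> h = h \<circ> g"
  and Isom_plus_one [simp]: "\<one>\<^bsub>Isom_plus\<^esub> = id"
  by (simp_all add: Isom_plus_def)

text \<open>The metric half of membership in \<open>Isom_plus\<close>, split off so that the
  boundary behaviour can be studied apart from the derivative condition.\<close>

definition hyp_isometry :: "(real ^ 'n \<Rightarrow> real ^ 'n) \<Rightarrow> bool" where
  "hyp_isometry g \<longleftrightarrow> g permutes hyp_space
     \<and> (\<forall>x\<in>hyp_space. \<forall>y\<in>hyp_space. hyp_dist (g x) (g y) = hyp_dist x y)"

lemma hyp_isometryD:
  assumes "hyp_isometry g"
  shows "g permutes hyp_space"
    and "x \<in> hyp_space \<Longrightarrow> g x \<in> hyp_space"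
    and "x \<in> hyp_space \<Longrightarrow> y \<in> hyp_space \<Longrightarrow> hyp_dist (g x) (g y) = hyp_dist x y"
  using assms permutes_in_image[of g hyp_space] by (auto simp: hyp_isometry_def)

lemma hyp_isometry_comp:
  assumes "hyp_isometry g" "hyp_isometry h"
  shows "hyp_isometry (h \<circ> g)"
  using hyp_isometryD[OF assms(1)] hyp_isometryD[OF assms(2)]
  by (auto simp: hyp_isometry_def intro: permutes_compose)

lemma hyp_isometry_id: "hyp_isometry id"
  by (simp add: hyp_isometry_def)

lemma hyp_isometry_inv:
  assumes g: "hyp_isometry g"
  shows "hyp_isometry (inv_fun g)"
proof -
  have p: "inv_fun g permutes hyp_space" using hyp_isometryD(1)[OF g] by (rule permutes_inv)
  have in_ball: "inv_fun g x \<in> hyp_space" if "x \<in> hyp_space" for x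
    using permutes_in_image[OF p, of x] that by blast
  have "hyp_dist (inv_fun g x) (inv_fun g y) = hyp_dist x y" if "x \<in> hyp_space" "y \<in> hyp_space" for x y
    using hyp_isometryD(3)[OF g in_ball[OF that(1)] in_ball[OF that(2)]]
    by (simp add: permutes_inverses(1)[OF hyp_isometryD(1)[OF g]])
  with p show ?thesis by (simp add: hyp_isometry_def)
qed

lemma hyp_isometry_inv_apply:
  assumes "hyp_isometry g"
  shows "g (inv_fun g x) = x" "inv_fun g (g x) = x"
  using permutes_inverses[OF hyp_isometryD(1)[OF assms]] by simp_all

lemma hyp_isometry_norm_diff:
  assumes g: "hyp_isometry g" and y: "y \<in> hyp_space" and z: "z \<in> hyp_space"
  shows "(norm (g y - g z))\<^sup>2 * ((1 - (norm y)\<^sup>2) * (1 - (norm z)\<^sup>2))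
           = (norm (y - z))\<^sup>2 * ((1 - (norm (g y))\<^sup>2) * (1 - (norm (g z))\<^sup>2))"
proof -
  note gy = hyp_isometryD(2)[OF g y] and gz = hyp_isometryD(2)[OF g z]
  have "cosh (hyp_dist (g y) (g z)) = cosh (hyp_dist y z)"
    by (simp add: hyp_isometryD(3)[OF g y z])
  then show ?thesis
    unfolding cosh_hyp_dist[OF y z] cosh_hyp_dist[OF gy gz]
    using one_minus_norm_sq_pos[OF y] one_minus_norm_sq_pos[OF z]
      one_minus_norm_sq_pos[OF gy] one_minus_norm_sq_pos[OF gz]
    by (simp add: frac_eq_eq)
qed

text \<open>
  With \<open>a = g\<^sup>-\<^sup>1 0\<close>, the quotient \<open>(1 - \<bar>g y\<bar>\<^sup>2) / (1 - \<bar>y\<bar>\<^sup>2)\<close> equals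
  \<open>(1 - \<bar>a\<bar>\<^sup>2) / (1 - 2 a \<bullet> y + \<bar>a\<bar>\<^sup>2 \<bar>y\<bar>\<^sup>2)\<close>, whose denominator is at least \<open>(1 - \<bar>a\<bar>)\<^sup>2\<close>.
\<close>

lemma hyp_isometry_defect_bound:
  fixes g :: "real ^ 'n \<Rightarrow> real ^ 'n"
  assumes g: "hyp_isometry g"
  obtains K where "0 < K"
    "\<And>y. y \<in> hyp_space \<Longrightarrow> 1 - (norm (g y))\<^sup>2 \<le> K * (1 - (norm y)\<^sup>2)"
proof -
  define a where "a = inv_fun g 0"
  have a: "a \<in> hyp_space" unfolding a_def
    by (rule hyp_isometryD(2)[OF hyp_isometry_inv[OF g]]) simp
  have ga: "g a = 0" by (simp add: a_def hyp_isometry_inv_apply[OF g])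
  let ?A = "1 - (norm a)\<^sup>2"
  have A: "0 < ?A" using one_minus_norm_sq_pos[OF a] .
  have na: "norm a < 1" using a by simp
  show ?thesis
  proof
    show "0 < ?A / (1 - norm a)\<^sup>2" using A na by simp
    fix y :: "real ^ 'n" assume y: "y \<in> hyp_space"
    let ?v = "1 - (norm y)\<^sup>2" and ?w = "1 - (norm (g y))\<^sup>2"
    have v: "0 < ?v" and w: "0 < ?w"
      using one_minus_norm_sq_pos[OF y] one_minus_norm_sq_pos[OF hyp_isometryD(2)[OF g y]] .
    \<comment> \<open>\<open>hyp_isometry_norm_diff\<close> at \<open>z = a\<close>, where
      \<open>g a = 0\<close> and the squared norm of \<open>g y\<close> is \<open>1 - ?w\<close>;
      the identity is linear in \<open>?w\<close>.\<close>
    have "(1 - ?w) * (?v * ?A) = (norm (y - a))\<^sup>2 * ?w"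
      using hyp_isometry_norm_diff[OF g y a] by (simp add: ga)
    then have eq: "?w * ((norm (y - a))\<^sup>2 + ?v * ?A) = ?v * ?A" by (simp add: algebra_simps)
    have "(norm (y - a))\<^sup>2 + ?v * ?A = 1 - 2 * (y \<bullet> a) + (norm y)\<^sup>2 * (norm a)\<^sup>2"
      by (simp add: power2_norm_eq_inner inner_diff_left inner_diff_right inner_commute algebra_simps)
    also have "\<dots> \<ge> 1 - 2 * (norm y * norm a) + (norm y)\<^sup>2 * (norm a)\<^sup>2"
      using norm_cauchy_schwarz[of y a] by simp
    also have "1 - 2 * (norm y * norm a) + (norm y)\<^sup>2 * (norm a)\<^sup>2 = (1 - norm y * norm a)\<^sup>2"
      by (simp add: power2_eq_square algebra_simps)
    finally have "(1 - norm y * norm a)\<^sup>2 \<le> (norm (y - a))\<^sup>2 + ?v * ?A" .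
    moreover have "(1 - norm a)\<^sup>2 \<le> (1 - norm y * norm a)\<^sup>2"
      using y na by (intro power_mono) (auto simp: mult_left_le_one_le)
    ultimately have "?w * (1 - norm a)\<^sup>2 \<le> ?w * ((norm (y - a))\<^sup>2 + ?v * ?A)"
      using w by (intro mult_left_mono) auto
    then show "?w \<le> ?A / (1 - norm a)\<^sup>2 * ?v"
      using eq na by (simp add: field_simps)
  qed
qed

text \<open>Each of the two defect quotients is at most the constant of
  \<open>hyp_isometry_defect_bound\<close>, so the squared distance grows by at most its
  square.\<close>

lemma hyp_isometry_lipschitz:
  assumes g: "hyp_isometry g"
  obtains K where "K-lipschitz_on hyp_space g"
proof -
  obtain K where K: "0 < K"
    "\<And>y. y \<in> hyp_space \<Longrightarrow> 1 - (norm (g y))\<^sup>2 \<le> K * (1 - (norm y)\<^sup>2)"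
    using hyp_isometry_defect_bound[OF g] by blast
  have "dist (g y) (g z) \<le> K * dist y z" if y: "y \<in> hyp_space" and z: "z \<in> hyp_space" for y z
  proof -
    let ?vy = "1 - (norm y)\<^sup>2" and ?vz = "1 - (norm z)\<^sup>2"
    let ?wy = "1 - (norm (g y))\<^sup>2" and ?wz = "1 - (norm (g z))\<^sup>2"
    have pos: "0 < ?vy" "0 < ?vz" "0 < ?wy" "0 < ?wz"
      using one_minus_norm_sq_pos y z hyp_isometryD(2)[OF g] by blast+
    have "?wy * ?wz \<le> (K * ?vy) * (K * ?vz)"
      using K pos y z by (intro mult_mono) auto
    then have "(norm (y - z))\<^sup>2 * (?wy * ?wz) \<le> (norm (y - z))\<^sup>2 * ((K * ?vy) * (K * ?vz))"
      by (rule mult_left_mono) simp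
    then have "(norm (g y - g z))\<^sup>2 * (?vy * ?vz) \<le> (K * norm (y - z))\<^sup>2 * (?vy * ?vz)"
      unfolding hyp_isometry_norm_diff[OF g y z] by (simp add: power_mult_distrib power2_eq_square ac_simps)
    then have "(norm (g y - g z))\<^sup>2 \<le> (K * norm (y - z))\<^sup>2"
      using pos by (simp add: mult_le_cancel_right)
    then show ?thesis
      using K(1) by (simp add: dist_norm power2_le_iff_abs_le)
  qed
  then show ?thesis using K(1) by (intro that[of K] lipschitz_onI) auto
qed

text \<open>The stored map is the identity off the ball, so the boundary values have to come from
  \<open>bdry_act\<close>. Joining both into one map on the closed ball makes density arguments
  possible.\<close>

definition ball_ext :: "(real ^ 'n \<Rightarrow> real ^ 'n) \<Rightarrow> real ^ 'n \<Rightarrow> real ^ 'n" where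
  "ball_ext g y = (if y \<in> hyp_space then g y else bdry_act g y)"

lemma ball_ext_hyp_space [simp]: "y \<in> hyp_space \<Longrightarrow> ball_ext g y = g y"
  and ball_ext_sphere: "\<xi> \<in> sphere_at_infinity \<Longrightarrow> ball_ext g \<xi> = bdry_act g \<xi>"
  by (auto simp: ball_ext_def)

lemma cball_eq_ball_Un_sphere: "cball (0::real ^ 'n) 1 = hyp_space \<union> sphere_at_infinity"
  by auto

text \<open>A Lipschitz map extends continuously to the closure. The extension gives a limit at each
  sphere point, so the \<open>Lim\<close> in \<open>bdry_act\<close> must agree with it.\<close>

lemma continuous_on_ball_ext:
  assumes g: "hyp_isometry g"
  shows "continuous_on (cball 0 1) (ball_ext g)"
proof -
  obtain K where "K-lipschitz_on hyp_space g" using hyp_isometry_lipschitz[OF g] by blast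
  then obtain h where h: "uniformly_continuous_on (closure hyp_space) h"
    "\<And>y. y \<in> hyp_space \<Longrightarrow> g y = h y"
    using uniformly_continuous_on_extension_on_closure[OF lipschitz_on_uniformly_continuous]
    by metis
  have conth: "continuous_on (cball 0 1) h"
    using uniformly_continuous_imp_continuous[OF h(1)] by simp
  have "bdry_act g \<xi> = h \<xi>" if \<xi>: "\<xi> \<in> sphere_at_infinity" for \<xi>
  proof -
    have "(g \<longlongrightarrow> h \<xi>) (at \<xi> within hyp_space)"
      using tendsto_at_sphere[OF conth \<xi>]
      by (rule Lim_transform_eventually) (auto simp: eventually_at_filter h(2))
    then show ?thesis
      unfolding bdry_act_def by (rule tendsto_Lim[OF at_within_ball_neq_bot[OF \<xi>]])
  qed
  then have "ball_ext g y = h y" if "y \<in> cball 0 1" for y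
    using that h(2) unfolding cball_eq_ball_Un_sphere by (auto simp: ball_ext_def)
  then show ?thesis using conth continuous_on_cong[OF refl, of "cball 0 1" "ball_ext g" h] by blast
qed

text \<open>Density of the ball in its closure. Composition, inversion and equivariance of Busemann
  functions are carried to the sphere by this principle.\<close>

lemma eq_on_cball:
  fixes p q :: "real ^ 'n \<Rightarrow> 'b :: t2_space"
  assumes "continuous_on (cball 0 1) p" "continuous_on (cball 0 1) q"
    and "\<And>y. y \<in> hyp_space \<Longrightarrow> p y = q y" and "y \<in> cball 0 1"
  shows "p y = q y"
proof (cases "y \<in> hyp_space")
  case False
  then have y: "y \<in> sphere_at_infinity" using assms(4) by auto
  have "(q \<longlongrightarrow> p y) (at y within hyp_space)"
    using tendsto_at_sphere[OF assms(1) y]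
    by (rule Lim_transform_eventually) (auto simp: eventually_at_filter assms(3))
  then show ?thesis
    using tendsto_at_sphere[OF assms(2) y] tendsto_unique[OF at_within_ball_neq_bot[OF y]] by blast
qed (use assms in auto)

text \<open>By \<open>hyp_isometry_defect_bound\<close>, the defect of the image tends to zero as
  the argument approaches the sphere; the opposite inequality holds because images of ball points
  stay in the ball.\<close>

lemma ball_ext_sphere_in_sphere:
  assumes g: "hyp_isometry g" and \<xi>: "\<xi> \<in> sphere_at_infinity"
  shows "ball_ext g \<xi> \<in> sphere_at_infinity"
proof -
  obtain K where K: "0 < K"
    "\<And>y. y \<in> hyp_space \<Longrightarrow> 1 - (norm (g y))\<^sup>2 \<le> K * (1 - (norm y)\<^sup>2)"
    using hyp_isometry_defect_bound[OF g] by blast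
  have lim: "(ball_ext g \<longlongrightarrow> ball_ext g \<xi>) (at \<xi> within hyp_space)"
    by (rule tendsto_at_sphere[OF continuous_on_ball_ext[OF g] \<xi>])
  have "((\<lambda>y. K * (1 - (norm y)\<^sup>2) - (1 - (norm (ball_ext g y))\<^sup>2))
      \<longlongrightarrow> K * (1 - (norm \<xi>)\<^sup>2) - (1 - (norm (ball_ext g \<xi>))\<^sup>2)) (at \<xi> within hyp_space)"
    by (intro tendsto_intros lim)
  then have "0 \<le> K * (1 - (norm \<xi>)\<^sup>2) - (1 - (norm (ball_ext g \<xi>))\<^sup>2)"
    by (rule tendsto_lowerbound)
       (auto simp: eventually_at_filter at_within_ball_neq_bot[OF \<xi>] K(2) intro!: always_eventually)
  then have "1 \<le> norm (ball_ext g \<xi>)"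
    using \<xi> power2_le_imp_le[of 1 "norm (ball_ext g \<xi>)"] by simp
  moreover have "((\<lambda>y. norm (ball_ext g y)) \<longlongrightarrow> norm (ball_ext g \<xi>)) (at \<xi> within hyp_space)"
    by (intro tendsto_intros lim)
  then have "norm (ball_ext g \<xi>) \<le> 1"
    using hyp_isometryD(2)[OF g]
    by (rule_tac tendsto_upperbound)
       (auto simp: eventually_at_filter at_within_ball_neq_bot[OF \<xi>] less_imp_le)
  ultimately show ?thesis by simp
qed

lemma ball_ext_cball:
  assumes "hyp_isometry g" "y \<in> cball 0 1"
  shows "ball_ext g y \<in> cball 0 1"
  using assms ball_ext_sphere_in_sphere[of g y] hyp_isometryD(2)[of g y]
  unfolding cball_eq_ball_Un_sphere by auto

lemma ball_ext_comp:
  assumes g: "hyp_isometry g" and h: "hyp_isometry h" and y: "y \<in> cball 0 1"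
  shows "ball_ext (h \<circ> g) y = ball_ext h (ball_ext g y)"
proof (rule eq_on_cball[OF _ _ _ y])
  show "continuous_on (cball 0 1) (ball_ext (h \<circ> g))"
    by (rule continuous_on_ball_ext[OF hyp_isometry_comp[OF g h]])
  show "continuous_on (cball 0 1) (\<lambda>y. ball_ext h (ball_ext g y))"
    by (rule continuous_on_compose2[OF continuous_on_ball_ext[OF h] continuous_on_ball_ext[OF g]])
       (use ball_ext_cball[OF g] in blast)
qed (simp add: hyp_isometryD(2)[OF g, simplified])

lemma ball_ext_id: "y \<in> cball 0 1 \<Longrightarrow> ball_ext id y = y"
  by (rule eq_on_cball[where q = "\<lambda>y. y", OF continuous_on_ball_ext[OF hyp_isometry_id] continuous_on_id])
     auto

lemma ball_ext_inv:
  assumes g: "hyp_isometry g" and y: "y \<in> cball 0 1"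
  shows "ball_ext g (ball_ext (inv_fun g) y) = y" "ball_ext (inv_fun g) (ball_ext g y) = y"
proof -
  have "g \<circ> inv_fun g = id" "inv_fun g \<circ> g = id"
    by (auto simp: fun_eq_iff hyp_isometry_inv_apply[OF g])
  with ball_ext_comp[OF hyp_isometry_inv[OF g] g y] ball_ext_comp[OF g hyp_isometry_inv[OF g] y]
  show "ball_ext g (ball_ext (inv_fun g) y) = y" "ball_ext (inv_fun g) (ball_ext g y) = y"
    by (simp_all add: ball_ext_id[OF y])
qed

text \<open>In the ball both sides are differences of hyperbolic distances, which \<open>g\<close>
  preserves; density does the rest.\<close>

lemma ln_horo_equivariant:
  fixes g :: "real ^ 'n \<Rightarrow> real ^ 'n"
  assumes g: "hyp_isometry g" and x: "x \<in> hyp_space" and x': "x' \<in> hyp_space"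
    and y: "y \<in> cball 0 1"
  shows "ln (horo (g x) (ball_ext g y)) - ln (horo (g x') (ball_ext g y))
           = ln (horo x y) - ln (horo x' y)"
proof (rule eq_on_cball[OF _ _ _ y])
  have "continuous_on (cball 0 1) (\<lambda>y. ln (horo (g z) (ball_ext g y)))" if "z \<in> hyp_space" for z
    by (rule continuous_on_compose2[OF continuous_on_ln_horo continuous_on_ball_ext[OF g]])
       (use that ball_ext_cball[OF g] hyp_isometryD(2)[OF g] in blast)+
  then show "continuous_on (cball 0 1)
      (\<lambda>y. ln (horo (g x) (ball_ext g y)) - ln (horo (g x') (ball_ext g y)))"
    using x x' by (intro continuous_on_diff) auto
  show "continuous_on (cball 0 1) (\<lambda>y. ln (horo x y) - ln (horo x' y))"
    by (intro continuous_intros continuous_on_ln_horo x x')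
  fix y :: "real ^ 'n" assume y: "y \<in> hyp_space"
  show "ln (horo (g x) (ball_ext g y)) - ln (horo (g x') (ball_ext g y))
      = ln (horo x y) - ln (horo x' y)"
    using hyp_dist_diff[OF x x' y]
      hyp_dist_diff[OF hyp_isometryD(2)[OF g x] hyp_isometryD(2)[OF g x'] hyp_isometryD(2)[OF g y]] y
    by (simp add: hyp_isometryD(3)[OF g] x[simplified] x'[simplified] y[simplified])
qed

section \<open>The group of isometries\<close>

lemma jacobian_eq:
  fixes f :: "real ^ 'n \<Rightarrow> real ^ 'm"
  assumes "(f has_derivative f') (at x)"
  shows "jacobian f (at x) = matrix f'"
  unfolding jacobian_def using frechet_derivative_at[OF assms] by simp

text \<open>Trades \<open>jacobian\<close> for an explicit derivative, the form that the chain rule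
  and the derivative of an inverse require.\<close>

lemma in_carrier_Isom_plus:
  "g \<in> carrier Isom_plus \<longleftrightarrow> hyp_isometry g
     \<and> (\<forall>x\<in>hyp_space. \<exists>D. (g has_derivative D) (at x) \<and> det (matrix D) > 0)"
proof -
  have "(g differentiable at x \<and> det (jacobian g (at x)) > 0)
      \<longleftrightarrow> (\<exists>D. (g has_derivative D) (at x) \<and> det (matrix D) > 0)" for x
    using jacobian_eq[of g _ x] unfolding differentiable_def by auto
  then show ?thesis by (simp add: Isom_plus_def hyp_isometry_def conj_assoc)
qed

lemma carrier_Isom_plusD:
  assumes "g \<in> carrier Isom_plus"
  shows "hyp_isometry g"
    and "x \<in> hyp_space \<Longrightarrow> \<exists>D. (g has_derivative D) (at x) \<and> det (matrix D) > 0"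
  using assms unfolding in_carrier_Isom_plus by blast+

lemma continuous_hyp_isometry:
  assumes "hyp_isometry g" "x \<in> hyp_space"
  shows "isCont g x"
proof -
  have "continuous_on hyp_space g"
    using hyp_isometry_lipschitz[OF assms(1)] lipschitz_on_continuous_on by blast
  then show ?thesis using assms(2) by (simp add: continuous_on_eq_continuous_at)
qed

text \<open>A positive determinant makes the derivative of \<open>g\<close> invertible, so the
  inverse map is differentiable; the two determinants multiply to 1 and therefore have the same
  sign.\<close>

lemma inv_in_carrier_Isom_plus:
  fixes g :: "real ^ 'n \<Rightarrow> real ^ 'n"
  assumes g: "g \<in> carrier Isom_plus"
  shows "inv_fun g \<in> carrier Isom_plus"
  unfolding in_carrier_Isom_plus
proof (intro conjI ballI)
  have ig: "hyp_isometry g" using carrier_Isom_plusD(1)[OF g] .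
  then show iig: "hyp_isometry (inv_fun g)" by (rule hyp_isometry_inv)
  fix y :: "real ^ 'n" assume y: "y \<in> hyp_space"
  obtain D where D: "(g has_derivative D) (at (inv_fun g y))" and det: "det (matrix D) > 0"
    using carrier_Isom_plusD(2)[OF g hyp_isometryD(2)[OF iig y]] by blast
  from det obtain D' where D': "linear D'" "D \<circ> D' = id" "D' \<circ> D = id"
    using matrix_invertible[OF has_derivative_linear[OF D]] by (auto simp: invertible_det_nz)
  have der: "(inv_fun g has_derivative D') (at y)"
    by (rule has_derivative_inverse_basic[where f = g and f' = D and T = hyp_space])
       (use D y D' continuous_hyp_isometry[OF iig y] hyp_isometry_inv_apply[OF ig]
         in \<open>auto simp: linear_conv_bounded_linear\<close>)
  have "det (matrix D') * det (matrix D) = det (matrix (D' \<circ> D))"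
    using matrix_compose[OF has_derivative_linear[OF D] D'(1)] by (simp add: det_mul)
  then have "det (matrix D') * det (matrix D) = 1" using D'(3) by (simp add: matrix_id_mat_1)
  then have "0 < det (matrix D')" using det by (metis zero_less_mult_pos2 zero_less_one)
  with der show "\<exists>D. (inv_fun g has_derivative D) (at y) \<and> 0 < det (matrix D)" by blast
qed

lemma comp_in_carrier_Isom_plus:
  fixes g h :: "real ^ 'n \<Rightarrow> real ^ 'n"
  assumes g: "g \<in> carrier Isom_plus" and h: "h \<in> carrier Isom_plus"
  shows "h \<circ> g \<in> carrier Isom_plus"
  unfolding in_carrier_Isom_plus
proof (intro conjI ballI)
  show "hyp_isometry (h \<circ> g)"
    by (rule hyp_isometry_comp[OF carrier_Isom_plusD(1)[OF g] carrier_Isom_plusD(1)[OF h]])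
  fix x :: "real ^ 'n" assume x: "x \<in> hyp_space"
  obtain D where D: "(g has_derivative D) (at x)" "det (matrix D) > 0"
    using carrier_Isom_plusD(2)[OF g x] by blast
  obtain E where E: "(h has_derivative E) (at (g x))" "det (matrix E) > 0"
    using carrier_Isom_plusD(2)[OF h hyp_isometryD(2)[OF carrier_Isom_plusD(1)[OF g] x]] by blast
  have "(h \<circ> g has_derivative E \<circ> D) (at x)"
    by (rule diff_chain_at[OF D(1) E(1)])
  moreover have "0 < det (matrix (E \<circ> D))"
    unfolding matrix_compose[OF has_derivative_linear[OF D(1)] has_derivative_linear[OF E(1)]]
    using D(2) E(2) by (simp add: det_mul)
  ultimately show "\<exists>D. (h \<circ> g has_derivative D) (at x) \<and> 0 < det (matrix D)" by blast
qed

lemma group_Isom_plus: "group (Isom_plus :: (real ^ 'n \<Rightarrow> real ^ 'n) monoid)"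
proof (rule groupI)
  have id: "(id has_derivative id) (at x)" for x :: "real ^ 'n"
    by (simp add: id_def)
  then show "\<one>\<^bsub>Isom_plus\<^esub> \<in> carrier (Isom_plus :: (real ^ 'n \<Rightarrow> real ^ 'n) monoid)"
    unfolding in_carrier_Isom_plus Isom_plus_one
    by (intro conjI ballI exI[of _ id]) (simp_all add: hyp_isometry_id matrix_id_mat_1)
next
  fix g :: "real ^ 'n \<Rightarrow> real ^ 'n" assume g: "g \<in> carrier Isom_plus"
  then have "g \<circ> inv_fun g = id"
    by (auto simp: fun_eq_iff hyp_isometry_inv_apply in_carrier_Isom_plus)
  with inv_in_carrier_Isom_plus[OF g]
  show "\<exists>h\<in>carrier Isom_plus. h \<otimes>\<^bsub>Isom_plus\<^esub> g = \<one>\<^bsub>Isom_plus\<^esub>" by auto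
qed (auto simp: comp_in_carrier_Isom_plus comp_assoc)

lemma inv_Isom_plus:
  assumes "g \<in> carrier Isom_plus"
  shows "inv\<^bsub>Isom_plus\<^esub> g = inv_fun g"
proof (rule group.inv_equality[OF group_Isom_plus])
  show "inv_fun g \<otimes>\<^bsub>Isom_plus\<^esub> g = \<one>\<^bsub>Isom_plus\<^esub>"
    using assms by (auto simp: fun_eq_iff hyp_isometry_inv_apply in_carrier_Isom_plus)
qed (use assms inv_in_carrier_Isom_plus in auto)

section \<open>Discrete groups of isometries\<close>

locale discrete_hyp_group =
  fixes \<Gamma> :: "(real ^ 'n \<Rightarrow> real ^ 'n) set"
  assumes discrete_isom_group: "discrete_isom_group \<Gamma>"
begin

lemma subgroup_Isom_plus: "subgroup \<Gamma> Isom_plus"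
  using discrete_isom_group by (simp add: discrete_isom_group_def)

lemma in_carrier: "g \<in> \<Gamma> \<Longrightarrow> g \<in> carrier Isom_plus"
  using subgroup.mem_carrier[OF subgroup_Isom_plus] .

lemma hyp_isometry: "g \<in> \<Gamma> \<Longrightarrow> hyp_isometry g"
  using carrier_Isom_plusD(1)[OF in_carrier] .

lemma hyp_space_image: "g \<in> \<Gamma> \<Longrightarrow> x \<in> hyp_space \<Longrightarrow> g x \<in> hyp_space"
  using hyp_isometryD(2)[OF hyp_isometry] .

lemma m_inv_eq: "g \<in> \<Gamma> \<Longrightarrow> inv\<^bsub>Isom_plus\<^esub> g = inv_fun g"
  using inv_Isom_plus[OF in_carrier] .

lemma inv_closed: "g \<in> \<Gamma> \<Longrightarrow> inv_fun g \<in> \<Gamma>"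
  using subgroup.m_inv_closed[OF subgroup_Isom_plus] m_inv_eq by fastforce

lemma comp_closed: "g \<in> \<Gamma> \<Longrightarrow> h \<in> \<Gamma> \<Longrightarrow> h \<circ> g \<in> \<Gamma>"
  using subgroup.m_closed[OF subgroup_Isom_plus, of g h] by simp

lemma id_in: "id \<in> \<Gamma>"
  using subgroup.one_closed[OF subgroup_Isom_plus] by simp

lemma comp_inv:
  assumes "g \<in> \<Gamma>"
  shows "g \<circ> inv_fun g = id" "inv_fun g \<circ> g = id"
  using hyp_isometry_inv_apply[OF hyp_isometry[OF assms]] by (auto simp: fun_eq_iff)

lemma inv_inv: "g \<in> \<Gamma> \<Longrightarrow> inv_fun (inv_fun g) = g"
  using hyp_isometryD(1)[OF hyp_isometry] permutes_inv_inv by blast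

lemma bij_betw_inv: "bij_betw inv_fun \<Gamma> \<Gamma>"
  by (rule bij_betw_byWitness[where f' = inv_fun]) (auto simp: inv_inv inv_closed)

lemma bij_betw_comp:
  assumes "g \<in> \<Gamma>"
  shows "bij_betw ((\<circ>) g) \<Gamma> \<Gamma>"
proof (rule bij_betw_byWitness[where f' = "(\<circ>) (inv_fun g)"])
  show "\<forall>h\<in>\<Gamma>. inv_fun g \<circ> (g \<circ> h) = h" "\<forall>h\<in>\<Gamma>. g \<circ> (inv_fun g \<circ> h) = h"
    using comp_inv[OF assms] by (simp_all add: comp_assoc[symmetric])
qed (use assms comp_closed inv_closed in auto)

text \<open>Multiplied out, the distance condition becomes a closed condition on the closed ball. It
  excludes the sphere by itself, because \<open>horo\<close> is positive there while the defect is
  zero.\<close>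

lemma hyp_dist_bound_compact:
  fixes x :: "real ^ 'n"
  assumes x: "x \<in> hyp_space"
  shows "compact {w \<in> hyp_space. hyp_dist x w \<le> R}" (is "compact ?K")
proof -
  have "?K = {w \<in> cball 0 1. horo x w \<le> exp R * (1 - (norm w)\<^sup>2)}" (is "_ = ?L")
  proof (intro Set.set_eqI iffI)
    fix w :: "real ^ 'n" assume "w \<in> ?K"
    then have w: "w \<in> hyp_space" and "exp (hyp_dist x w) \<le> exp R" by auto
    then have "horo x w \<le> exp R * (1 - (norm w)\<^sup>2)"
      using one_minus_norm_sq_pos[OF w] unfolding exp_hyp_dist[OF x w] by (simp add: field_simps)
    then show "w \<in> ?L" using w by auto
  next
    fix w :: "real ^ 'n" assume "w \<in> ?L"
    then have w: "w \<in> cball 0 1" and le: "horo x w \<le> exp R * (1 - (norm w)\<^sup>2)" by auto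
    have "0 < exp R * (1 - (norm w)\<^sup>2)" using horo_pos[OF x w] le by linarith
    then have pos: "0 < 1 - (norm w)\<^sup>2" by (simp add: zero_less_mult_iff)
    then have wb: "w \<in> hyp_space" by (simp add: power_less_one_iff abs_square_less_1)
    have "exp (hyp_dist x w) \<le> exp R"
      unfolding exp_hyp_dist[OF x wb] using le pos by (simp add: field_simps)
    then show "w \<in> ?K" using wb by simp
  qed
  moreover have "closed ?L"
    unfolding Collect_conj_eq Collect_mem_eq
    by (intro closed_Int closed_cball closed_Collect_le continuous_on_horo continuous_intros)
  then have "compact ?L"
    by (auto simp: compact_eq_bounded_closed intro: bounded_subset[OF bounded_cball[of 0 1]])
  ultimately show ?thesis by simp
qed

text \<open>
  Infinitely many such \<open>g\<close> would accumulate, by Tychonoff's theorem, at a map that is not required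
  to be an isometry; two of them close enough to it differ by a nontrivial element of \<open>\<Gamma>\<close> close to
  the identity.
\<close>

lemma finite_displacement:
  assumes x: "x \<in> hyp_space"
  shows "finite {g \<in> \<Gamma>. hyp_dist x (g x) \<le> R}" (is "finite ?A")
proof (rule ccontr)
  assume inf: "infinite ?A"
  have "\<exists>C. \<forall>z\<in>hyp_space. \<bar>hyp_dist y z - hyp_dist x z\<bar> \<le> C" if "y \<in> hyp_space" for y
    using hyp_dist_diff_bounded[OF that x] by metis
  then obtain C where C: "\<And>y z. y \<in> hyp_space \<Longrightarrow> z \<in> hyp_space
      \<Longrightarrow> \<bar>hyp_dist y z - hyp_dist x z\<bar> \<le> C y"
    by metis
  \<comment> \<open>Hyperbolic balls confine the images of ball points. Elsewhere every isometry is
    the identity, so a singleton suffices, and the product over the whole vector space is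
    compact.\<close>
  define B where "B y = (if y \<in> hyp_space
    then {w \<in> hyp_space. hyp_dist x w \<le> R + C y} else {y})" for y
  have "compact (B y)" for y
    unfolding B_def using hyp_dist_bound_compact[OF x] by auto
  then have compact: "compact (Pi\<^sub>E UNIV B)"
    using compactin_PiE[of "\<lambda>_. euclidean" UNIV B] by (simp add: euclidean_product_topology)
  have "g y \<in> B y" if g: "g \<in> ?A" for g y
  proof (cases "y \<in> hyp_space")
    case True
    have gi: "hyp_isometry g" using g hyp_isometry by blast
    note igx = hyp_isometryD(2)[OF hyp_isometry_inv[OF gi] x]
    \<comment> \<open>Moving \<open>g\<close> to the other argument turns the comparison of
      \<open>g y\<close> with \<open>g x\<close> into a comparison of \<open>y\<close> with
      \<open>x\<close> as seen from \<open>inv_fun g x\<close>, which is what \<open>C y\<close>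
      bounds.\<close>
    have swap: "hyp_dist x (g z) = hyp_dist z (inv_fun g x)" if "z \<in> hyp_space" for z
      using hyp_isometryD(3)[OF gi that igx] hyp_dist_commute[of x]
      by (simp add: hyp_isometry_inv_apply[OF gi])
    have "hyp_dist x (g y) \<le> hyp_dist x (g x) + C y"
      using C[OF True igx] swap[OF True] swap[OF x] by linarith
    then show ?thesis using True g hyp_isometryD(2)[OF gi True] by (simp add: B_def)
  next
    case False
    then show ?thesis
      using g hyp_isometryD(1)[OF hyp_isometry] permutes_not_in by (fastforce simp: B_def)
  qed
  then have "?A \<subseteq> Pi\<^sub>E UNIV B" by auto
  from Heine_Borel_imp_Bolzano_Weierstrass[OF compact inf this]
  obtain p where p: "p \<in> Pi\<^sub>E UNIV B" and lim: "p islimpt ?A" by blast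
  have "id isolated_in \<Gamma>"
    using discrete_isom_group id_in by (simp add: discrete_isom_group_def discrete_def)
  then obtain U where U: "open U" "U \<inter> \<Gamma> = {id}" by (auto simp: isolated_in_def)
  then have "openin (product_topology (\<lambda>_. euclidean) UNIV) U" "id \<in> U"
    by (auto simp: open_fun_def)
  from product_topology_open_contains_basis[OF this]
  obtain X where X: "id \<in> Pi\<^sub>E UNIV X" "\<And>i. open (X i)" "finite {i. X i \<noteq> UNIV}" "Pi\<^sub>E UNIV X \<subseteq> U"
    by auto
  \<comment> \<open>Only finitely many coordinates are constrained, and among them only those in the
    ball matter, since \<Gamma> fixes every other point.\<close>
  define J where "J = {i. X i \<noteq> UNIV} \<inter> hyp_space"
  have "\<exists>e>0. ball y e \<subseteq> X y" for y
    using X(1,2) by (auto simp: open_contains_ball PiE_iff)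
  then obtain e where e: "\<And>y. 0 < e y" "\<And>y. ball y (e y) \<subseteq> X y" by metis
  \<comment> \<open>\<open>d y\<close> is half the defect of the limit point \<open>p y\<close>,
    hence a lower bound for the defect of nearby points. Two points within
    \<open>e y * d y / 2\<close> of \<open>p y\<close> are less than \<open>e y * d y\<close> apart,
    and \<open>hyp_isometry_norm_diff\<close> pulls this back to a displacement below
    \<open>e y\<close>.\<close>
  define d where "d y = (1 - (norm (p y))\<^sup>2) / 2" for y
  define W where "W y = ball (p y) (e y * d y / 2) \<inter> {u. d y < 1 - (norm u)\<^sup>2}" for y
  define V where "V = {f. \<forall>y\<in>J. f y \<in> W y}"
  have dpos: "0 < d y" if "y \<in> J" for y
    using p that one_minus_norm_sq_pos[of "p y"] by (auto simp: PiE_iff B_def J_def d_def dest!: spec[of _ y])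
  have openW: "open (W y)" for y
    unfolding W_def by (intro open_Int open_ball open_Collect_less continuous_intros)
  have finJ: "finite J" unfolding J_def using X(3) by blast
  have openV: "open V"
    unfolding V_def using product_topology_basis'[OF finJ, of W "\<lambda>y. y"] openW by simp
  have pV: "p \<in> V" using dpos e(1) by (auto simp: V_def W_def d_def)
  obtain \<gamma> where \<gamma>: "\<gamma> \<in> ?A" "\<gamma> \<in> V" "\<gamma> \<noteq> p"
    by (rule islimptE[OF lim pV openV])
  then obtain z where z: "\<gamma> z \<noteq> p z" by (auto simp: fun_eq_iff)
  \<comment> \<open>A limit point supplies elements different from \<open>p\<close>, not from each
    other. Excluding the value of \<gamma> at a coordinate where it differs from \<open>p\<close>
    leaves a neighbourhood of \<open>p\<close> and forces a second element.\<close>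
  define V' where "V' = V \<inter> {f. \<forall>y\<in>{z}. f y \<in> - {\<gamma> z}}"
  have "open (- {\<gamma> z})" by (rule open_Compl[OF closed_singleton])
  then have "open {f. \<forall>y\<in>{z}. f y \<in> - {\<gamma> z}}"
    by (intro product_topology_basis'[where x = "\<lambda>y. y"]) auto
  then have openV': "open V'" unfolding V'_def by (intro open_Int openV)
  have pV': "p \<in> V'" using pV z by (auto simp: V'_def)
  obtain \<gamma>' where "\<gamma>' \<in> ?A" "\<gamma>' \<in> V'" "\<gamma>' \<noteq> p"
    by (rule islimptE[OF lim pV' openV'])
  then have \<gamma>': "\<gamma>' \<in> ?A" "\<gamma>' \<in> V" "\<gamma>' z \<noteq> \<gamma> z" by (auto simp: V'_def)
  have \<gamma>i: "hyp_isometry \<gamma>" and \<gamma>'i: "hyp_isometry \<gamma>'" using \<gamma>(1) \<gamma>'(1) hyp_isometry by auto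
  let ?h = "inv_fun \<gamma> \<circ> \<gamma>'"
  have h\<Gamma>: "?h \<in> \<Gamma>" using \<gamma>(1) \<gamma>'(1) comp_closed inv_closed by blast
  have "?h \<in> Pi\<^sub>E UNIV X"
  proof (intro PiE_I)
    fix y
    show "?h y \<in> X y"
    proof (cases "y \<in> J")
      case True
      then have y: "y \<in> hyp_space" by (simp add: J_def)
      note hy = hyp_isometryD(2)[OF hyp_isometry[OF h\<Gamma>] y]
      let ?u = "\<gamma> y" and ?v = "\<gamma>' y"
      have vpos: "d y < 1 - (norm ?u)\<^sup>2" "d y < 1 - (norm ?v)\<^sup>2"
        and dist: "dist (p y) ?u < e y * d y / 2" "dist (p y) ?v < e y * d y / 2"
        using \<gamma>(2) \<gamma>'(2) True by (auto simp: V_def W_def)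
      note d0 = dpos[OF True]
      have ghy: "\<gamma> (?h y) = ?v" by (simp add: hyp_isometry_inv_apply[OF \<gamma>i])
      have "(norm (y - ?h y))\<^sup>2 * ((1 - (norm ?u)\<^sup>2) * (1 - (norm ?v)\<^sup>2))
          = (norm (?u - ?v))\<^sup>2 * ((1 - (norm y)\<^sup>2) * (1 - (norm (?h y))\<^sup>2))"
        using hyp_isometry_norm_diff[OF \<gamma>i y hy] unfolding ghy by simp
      also have "\<dots> \<le> (norm (?u - ?v))\<^sup>2 * (1 * 1)"
        using one_minus_norm_sq_pos[OF y] one_minus_norm_sq_pos[OF hy]
        by (intro mult_left_mono mult_mono) auto
      finally have 1: "(norm (y - ?h y))\<^sup>2 * ((1 - (norm ?u)\<^sup>2) * (1 - (norm ?v)\<^sup>2)) \<le> (norm (?u - ?v))\<^sup>2"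
        by simp
      have "(norm (y - ?h y))\<^sup>2 * (d y * d y)
          \<le> (norm (y - ?h y))\<^sup>2 * ((1 - (norm ?u)\<^sup>2) * (1 - (norm ?v)\<^sup>2))"
        using vpos d0 by (intro mult_left_mono mult_mono) auto
      with 1 have "(norm (y - ?h y) * d y)\<^sup>2 \<le> (norm (?u - ?v))\<^sup>2"
        by (simp add: power2_eq_square ac_simps)
      then have "norm (y - ?h y) * d y \<le> norm (?u - ?v)"
        by (rule power2_le_imp_le) simp
      also have "\<dots> < e y * d y"
        using dist dist_triangle3[of ?u ?v "p y"] by (simp add: dist_norm)
      finally have "norm (y - ?h y) < e y" using d0 by simp
      then have "?h y \<in> ball y (e y)" by (simp add: dist_norm)
      then show ?thesis using e(2) by blast
    next
      case False
      show ?thesis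
      proof (cases "y \<in> hyp_space")
        case True
        then show ?thesis using False by (auto simp: J_def)
      next
        case False
        then have "?h y = y"
          using hyp_isometryD(1)[OF hyp_isometry[OF h\<Gamma>]] permutes_not_in by metis
        then show ?thesis using X(1) by (auto simp: PiE_iff)
      qed
    qed
  qed simp
  then have "?h = id" using X(4) U(2) h\<Gamma> by blast
  then have "\<gamma>' = \<gamma>"
    using comp_inv(1)[of \<gamma>] \<gamma>(1) by (metis (no_types, lifting) comp_assoc comp_id id_comp mem_Collect_eq)
  then show False using \<gamma>'(3) by simp
qed

lemma countable: "countable \<Gamma>"
proof -
  have "g \<in> (\<Union>n::nat. {g \<in> \<Gamma>. hyp_dist 0 (g 0) \<le> real n})" if "g \<in> \<Gamma>" for g
    using that real_arch_simple[of "hyp_dist 0 (g 0)"] by auto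
  then have "\<Gamma> \<subseteq> (\<Union>n::nat. {g \<in> \<Gamma>. hyp_dist 0 (g 0) \<le> real n})" by blast
  moreover have "countable (\<Union>n::nat. {g \<in> \<Gamma>. hyp_dist 0 (g 0) \<le> real n})"
    by (rule countable_UN[OF _ countable_finite[OF finite_displacement]]) auto
  ultimately show ?thesis by (rule countable_subset)
qed

text \<open>
  The limit set does not depend on the orbit because \<open>\<bar>g y - g x\<bar>\<^sup>2 \<le> c (1 - \<bar>g x\<bar>\<^sup>2)\<close> with \<open>c\<close>
  depending only on \<open>x\<close> and \<open>y\<close>.
\<close>

lemma limit_set_eq:
  assumes y: "y \<in> hyp_space"
  shows "limit_set \<Gamma> = sphere_at_infinity \<inter> closure ((\<lambda>g. g y) ` \<Gamma>)"
proof (intro Set.set_eqI iffI)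
  fix \<xi> assume "\<xi> \<in> limit_set \<Gamma>"
  then obtain x where \<xi>: "\<xi> \<in> sphere_at_infinity" and x: "x \<in> hyp_space"
    and lim: "\<xi> islimpt ((\<lambda>g. g x) ` \<Gamma>)" by (auto simp: limit_set_def)
  from lim obtain f where f: "\<And>n. f n \<in> (\<lambda>g. g x) ` \<Gamma>" "f \<longlonglongrightarrow> \<xi>"
    unfolding islimpt_sequential by blast
  from f(1) have "\<exists>g. \<forall>n. g n \<in> \<Gamma> \<and> f n = g n x" by (intro choice) auto
  then obtain g where g: "\<And>n. g n \<in> \<Gamma>" "\<And>n. f n = g n x" by blast
  let ?c = "(1 - (norm y)\<^sup>2) * (1 - (norm x)\<^sup>2)"
  have c: "0 < ?c" using one_minus_norm_sq_pos[OF y] one_minus_norm_sq_pos[OF x] by simp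
  have "(norm (g n y - f n))\<^sup>2 \<le> (norm (y - x))\<^sup>2 / ?c * (1 - (norm (f n))\<^sup>2)" for n
  proof -
    note gi = hyp_isometry[OF g(1)[of n]]
    have "(norm (g n y - f n))\<^sup>2 * ?c
        = (norm (y - x))\<^sup>2 * ((1 - (norm (g n y))\<^sup>2) * (1 - (norm (f n))\<^sup>2))"
      using hyp_isometry_norm_diff[OF gi y x] by (simp add: g(2))
    also have "\<dots> \<le> (norm (y - x))\<^sup>2 * (1 * (1 - (norm (f n))\<^sup>2))"
      using one_minus_norm_sq_pos[OF hyp_isometryD(2)[OF gi x]]
      by (intro mult_left_mono mult_right_mono) (auto simp: g(2))
    finally show ?thesis using c by (simp add: field_simps)
  qed
  then have ub: "\<forall>\<^sub>F n in sequentially.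
      (norm (g n y - f n))\<^sup>2 \<le> (norm (y - x))\<^sup>2 / ?c * (1 - (norm (f n))\<^sup>2)"
    by (rule always_eventually[OF allI])
  have "(\<lambda>n. (norm (y - x))\<^sup>2 / ?c * (1 - (norm (f n))\<^sup>2)) \<longlonglongrightarrow> (norm (y - x))\<^sup>2 / ?c * (1 - (norm \<xi>)\<^sup>2)"
    by (intro tendsto_intros f(2))
  then have lim0: "(\<lambda>n. (norm (y - x))\<^sup>2 / ?c * (1 - (norm (f n))\<^sup>2)) \<longlonglongrightarrow> 0" using \<xi> by simp
  have "(\<lambda>n. (norm (g n y - f n))\<^sup>2) \<longlonglongrightarrow> 0"
    by (rule tendsto_sandwich[OF _ ub tendsto_const lim0]) simp
  then have "(\<lambda>n. sqrt ((norm (g n y - f n))\<^sup>2)) \<longlonglongrightarrow> sqrt 0" by (rule tendsto_real_sqrt)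
  then have "(\<lambda>n. g n y - f n) \<longlonglongrightarrow> 0" by (simp add: tendsto_norm_zero_iff)
  from tendsto_add[OF this f(2)] have "(\<lambda>n. g n y) \<longlonglongrightarrow> \<xi>" by simp
  then have "\<xi> \<in> closure ((\<lambda>g. g y) ` \<Gamma>)"
    unfolding closure_sequential using g(1) by (intro exI[of _ "\<lambda>n. g n y"]) auto
  then show "\<xi> \<in> sphere_at_infinity \<inter> closure ((\<lambda>g. g y) ` \<Gamma>)" using \<xi> by simp
next
  fix \<xi> assume \<xi>: "\<xi> \<in> sphere_at_infinity \<inter> closure ((\<lambda>g. g y) ` \<Gamma>)"
  then have "\<xi> \<notin> (\<lambda>g. g y) ` \<Gamma>" using hyp_space_image y by fastforce
  then have "\<xi> islimpt ((\<lambda>g. g y) ` \<Gamma>)" using \<xi> by (auto simp: closure_def)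
  then show "\<xi> \<in> limit_set \<Gamma>" using \<xi> y unfolding limit_set_def by blast
qed

section \<open>The action of the group on its limit set\<close>

lemma limit_set_subset_sphere: "limit_set \<Gamma> \<subseteq> sphere_at_infinity"
  by (auto simp: limit_set_def)

lemma compact_limit_set: "compact (limit_set \<Gamma>)"
  using limit_set_eq[of 0] by (simp add: compact_Int_closed)

text \<open>Applied contrapositively: a nonzero measure on the limit set forces \<Gamma> to be
  infinite.\<close>

lemma limit_set_empty_if_finite:
  assumes "finite \<Gamma>"
  shows "limit_set \<Gamma> = {}"
  using assms by (auto simp: limit_set_def islimpt_finite)

lemma bdry_act_limit_set:
  assumes g: "g \<in> \<Gamma>" and \<xi>: "\<xi> \<in> limit_set \<Gamma>"
  shows "bdry_act g \<xi> \<in> limit_set \<Gamma>"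
proof -
  have sph: "\<xi> \<in> sphere_at_infinity" using \<xi> limit_set_subset_sphere by blast
  obtain f where f: "\<And>n. f n \<in> (\<lambda>g. g 0) ` \<Gamma>" "f \<longlonglongrightarrow> \<xi>"
    using \<xi> limit_set_eq[of 0] by (auto simp: closure_sequential)
  have fb: "f n \<in> hyp_space" for n using f(1)[of n] hyp_space_image by fastforce
  have "(\<lambda>n. ball_ext g (f n)) \<longlonglongrightarrow> ball_ext g \<xi>"
    using continuous_on_ball_ext[OF hyp_isometry[OF g]] f(2) sph fb
    by (intro continuous_on_tendsto_compose[of "cball 0 1" "ball_ext g" f]) (auto simp: less_imp_le)
  moreover have "ball_ext g (f n) \<in> (\<lambda>g. g 0) ` \<Gamma>" for n
  proof -
    obtain h where h: "h \<in> \<Gamma>" "f n = h 0" using f(1)[of n] by blast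
    have "ball_ext g (f n) = (g \<circ> h) 0" using fb[of n] h by simp
    then show ?thesis using comp_closed[OF h(1) g] by blast
  qed
  ultimately have "ball_ext g \<xi> \<in> closure ((\<lambda>g. g 0) ` \<Gamma>)"
    unfolding closure_sequential by (intro exI[of _ "\<lambda>n. ball_ext g (f n)"] conjI allI)
  then show ?thesis
    using ball_ext_sphere_in_sphere[OF hyp_isometry[OF g] sph] limit_set_eq[of 0]
    by (simp add: ball_ext_sphere[OF sph])
qed

lemma bdry_act_inv:
  assumes g: "g \<in> \<Gamma>" and \<xi>: "\<xi> \<in> limit_set \<Gamma>"
  shows "bdry_act g (bdry_act (inv_fun g) \<xi>) = \<xi>" "bdry_act (inv_fun g) (bdry_act g \<xi>) = \<xi>"
proof -
  have sph: "\<xi> \<in> sphere_at_infinity" "bdry_act g \<xi> \<in> sphere_at_infinity"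
      "bdry_act (inv_fun g) \<xi> \<in> sphere_at_infinity"
    using limit_set_subset_sphere \<xi> bdry_act_limit_set[OF g \<xi>]
      bdry_act_limit_set[OF inv_closed[OF g] \<xi>] by blast+
  then show "bdry_act g (bdry_act (inv_fun g) \<xi>) = \<xi>" "bdry_act (inv_fun g) (bdry_act g \<xi>) = \<xi>"
    using ball_ext_inv[OF hyp_isometry[OF g], of \<xi>] by (simp_all add: ball_ext_sphere)
qed

lemma bdry_act_id: "\<xi> \<in> limit_set \<Gamma> \<Longrightarrow> bdry_act id \<xi> = \<xi>"
  using ball_ext_id[of \<xi>] limit_set_subset_sphere ball_ext_sphere[of \<xi> id] by fastforce

lemma continuous_on_bdry_act:
  assumes "g \<in> \<Gamma>"
  shows "continuous_on (limit_set \<Gamma>) (bdry_act g)"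
proof -
  have "continuous_on (limit_set \<Gamma>) (ball_ext g)"
    by (rule continuous_on_subset[OF continuous_on_ball_ext[OF hyp_isometry[OF assms]]])
       (use limit_set_subset_sphere in auto)
  then show ?thesis
    using continuous_on_cong[OF refl, of "limit_set \<Gamma>" "ball_ext g" "bdry_act g"]
      ball_ext_sphere limit_set_subset_sphere by blast
qed

lemma busemann_diff_equivariant:
  assumes g: "g \<in> \<Gamma>" and x: "x \<in> hyp_space" and x': "x' \<in> hyp_space" and \<xi>: "\<xi> \<in> limit_set \<Gamma>"
  shows "busemann_diff (g x) (g x') (bdry_act g \<xi>) = busemann_diff x x' \<xi>"
proof -
  have sph: "\<xi> \<in> sphere_at_infinity" "bdry_act g \<xi> \<in> sphere_at_infinity"
    using limit_set_subset_sphere \<xi> bdry_act_limit_set[OF g \<xi>] by blast+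
  then show ?thesis
    using ln_horo_equivariant[OF hyp_isometry[OF g] x x', of \<xi>]
    by (simp add: busemann_diff_eq hyp_space_image[OF g, simplified] x[simplified] x'[simplified] ball_ext_sphere)
qed

lemma continuous_on_busemann_diff:
  assumes x: "x \<in> hyp_space" and x': "x' \<in> hyp_space"
  shows "continuous_on (limit_set \<Gamma>) (busemann_diff x x')"
proof -
  have "continuous_on (limit_set \<Gamma>) (\<lambda>\<xi>. ln (horo x \<xi>) - ln (horo x' \<xi>))"
    by (rule continuous_on_subset[OF continuous_on_diff[OF
          continuous_on_ln_horo[OF x] continuous_on_ln_horo[OF x']]])
       (use limit_set_subset_sphere in auto)
  moreover have "busemann_diff x x' \<xi> = ln (horo x \<xi>) - ln (horo x' \<xi>)" if "\<xi> \<in> limit_set \<Gamma>" for \<xi>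
    using busemann_diff_eq[OF x x'] limit_set_subset_sphere that by blast
  ultimately show ?thesis by (simp cong: continuous_on_cong_simp)
qed

end

section \<open>Patterson-Sullivan measures\<close>

definition orbit_weight ::
  "(real \<Rightarrow> real) \<Rightarrow> real ^ 'n \<Rightarrow> real \<Rightarrow> real ^ 'n \<Rightarrow> (real ^ 'n \<Rightarrow> real ^ 'n) \<Rightarrow> real" where
  "orbit_weight h x0 s y \<gamma> = exp (- s * hyp_dist y (\<gamma> x0)) * h (exp (hyp_dist y (\<gamma> x0)))"

lemma patterson_mean_eq:
  "patterson_mean \<Gamma> x0 h s y \<phi> =
     (\<Sum>\<^sub>\<infinity>\<gamma>\<in>\<Gamma>. orbit_weight h x0 s y \<gamma> * \<phi> (\<gamma> x0)) / (\<Sum>\<^sub>\<infinity>\<gamma>\<in>\<Gamma>. orbit_weight h x0 s x0 \<gamma>)"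
  by (simp add: patterson_mean_def orbit_weight_def)

lemma abs_exp_minus_1_le:
  fixes v :: real
  shows "\<bar>exp v - 1\<bar> \<le> exp \<bar>v\<bar> - 1"
proof (cases "0 \<le> v")
  case False
  then have "1 - exp v \<le> exp (- v) - 1"
    using exp_ge_add_one_self[of v] exp_ge_add_one_self[of "- v"] by linarith
  then show ?thesis using False by (simp add: abs_if)
qed (simp add: abs_if)

text \<open>Subpolynomial growth on a logarithmic scale: shifting the logarithm of the argument by
  at most \<open>C\<close> shifts the logarithm of \<open>h\<close> by at most
  \<open>\<eta> * C\<close>. Monotonicity makes the logarithm of the ratio nonnegative when
  \<open>b \<le> a\<close>; the other order follows by exchanging the two.\<close>

lemma ln_ratio_le_slow_growth:
  fixes h :: "real \<Rightarrow> real"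
  assumes pos: "\<And>r. 0 < r \<Longrightarrow> 0 < h r" and mono: "mono_on {0<..} h"
    and slow: "\<And>r t. r0 < r \<Longrightarrow> 1 < t \<Longrightarrow> h (t * r) \<le> t powr \<eta> * h r"
    and r0: "0 \<le> r0" and \<eta>: "0 \<le> \<eta>" and r: "r0 < exp a" "r0 < exp b"
    and C: "\<bar>a - b\<bar> \<le> C"
  shows "\<bar>ln (h (exp a) / h (exp b))\<bar> \<le> \<eta> * C"
proof -
  have *: "\<bar>ln (h (exp a) / h (exp b))\<bar> \<le> \<eta> * C"
    if r: "r0 < exp b" and ab: "b \<le> a" "a - b \<le> C" for a b
  proof -
    have ha: "0 < h (exp a)" and hb: "0 < h (exp b)" by (auto intro: pos)
    have "h (exp b) \<le> h (exp a)" using mono ab by (auto simp: mono_on_def)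
    then have "1 \<le> h (exp a) / h (exp b)" using hb by simp
    moreover have "h (exp a) / h (exp b) \<le> exp (\<eta> * C)"
    proof (cases "a = b")
      case True
      then show ?thesis using hb \<eta> ab by simp
    next
      case False
      have "h (exp a) = h (exp (a - b) * exp b)" by (simp flip: exp_add)
      also have "\<dots> \<le> exp (a - b) powr \<eta> * h (exp b)"
        using False ab by (intro slow r) auto
      also have "exp (a - b) powr \<eta> = exp (\<eta> * (a - b))" by (simp add: powr_def)
      also have "exp (\<eta> * (a - b)) * h (exp b) \<le> exp (\<eta> * C) * h (exp b)"
        using \<eta> ab hb by (intro mult_right_mono) (auto intro: mult_left_mono)
      finally show ?thesis using hb by (simp add: field_simps)
    qed
    moreover from this have "ln (h (exp a) / h (exp b)) \<le> ln (exp (\<eta> * C))"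
      using ha hb by (subst ln_le_cancel_iff) auto
    ultimately show ?thesis by simp
  qed
  have "ln (h (exp b) / h (exp a)) = - ln (h (exp a) / h (exp b))"
    by (simp add: ln_div pos)
  then show ?thesis using *[of b a] *[of a b] r C by (cases "b \<le> a") auto
qed

lemma summable_on_bounded_mult:
  fixes f g :: "'a \<Rightarrow> real"
  assumes "f summable_on A" "\<And>x. x \<in> A \<Longrightarrow> \<bar>g x\<bar> \<le> M" "\<And>x. x \<in> A \<Longrightarrow> 0 \<le> f x"
  shows "(\<lambda>x. f x * g x) summable_on A"
proof (rule abs_summable_summable)
  have "norm (f x * g x) \<le> f x * M" if "x \<in> A" for x
    using assms(2,3)[OF that] by (simp add: abs_mult mult_left_mono)
  then show "(\<lambda>x. norm (f x * g x)) summable_on A"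
    by (intro Infinite_Sum.abs_summable_on_comparison_test'[OF summable_on_cmult_left[OF assms(1)]])
qed

context discrete_hyp_group
begin

lemma finite_orbit_near:
  assumes x: "x \<in> hyp_space" and y: "y \<in> hyp_space"
  shows "finite {g \<in> \<Gamma>. hyp_dist x (g y) \<le> R}"
proof -
  obtain C where C: "\<And>z. z \<in> hyp_space \<Longrightarrow> \<bar>hyp_dist x z - hyp_dist y z\<bar> \<le> C"
    using hyp_dist_diff_bounded[OF x y] by blast
  have "{g \<in> \<Gamma>. hyp_dist x (g y) \<le> R} \<subseteq> {g \<in> \<Gamma>. hyp_dist y (g y) \<le> R + C}"
    using C hyp_space_image[OF _ y] by force
  then show ?thesis using finite_displacement[OF y] finite_subset by blast
qed

text \<open>Left composition with \<open>g\<close> permutes \<Gamma> and preserves the distances in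
  the numerator; the normalizer is based at \<open>x0\<close> on both sides. Equivariance thus holds
  before any limit is taken.\<close>

lemma patterson_mean_equivariant:
  assumes g: "g \<in> \<Gamma>" and y: "y \<in> hyp_space" and x0: "x0 \<in> hyp_space"
  shows "patterson_mean \<Gamma> x0 h s (g y) \<phi> = patterson_mean \<Gamma> x0 h s y (\<lambda>z. \<phi> (ball_ext g z))"
proof -
  have "(\<Sum>\<^sub>\<infinity>\<gamma>\<in>\<Gamma>. orbit_weight h x0 s (g y) (g \<circ> \<gamma>) * \<phi> ((g \<circ> \<gamma>) x0))
      = (\<Sum>\<^sub>\<infinity>\<gamma>\<in>\<Gamma>. orbit_weight h x0 s y \<gamma> * \<phi> (ball_ext g (\<gamma> x0)))"
  proof (rule infsum_cong)
    fix \<gamma> assume "\<gamma> \<in> \<Gamma>"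
    note \<gamma> = hyp_space_image[OF this x0]
    show "orbit_weight h x0 s (g y) (g \<circ> \<gamma>) * \<phi> ((g \<circ> \<gamma>) x0)
        = orbit_weight h x0 s y \<gamma> * \<phi> (ball_ext g (\<gamma> x0))"
      using hyp_isometryD(3)[OF hyp_isometry[OF g] y \<gamma>] ball_ext_hyp_space[OF \<gamma>, of g]
      by (simp add: orbit_weight_def)
  qed
  then show ?thesis
    unfolding patterson_mean_eq
    using infsum_reindex_bij_betw[OF bij_betw_comp[OF g],
        of "\<lambda>\<gamma>. orbit_weight h x0 s (g y) \<gamma> * \<phi> (\<gamma> x0)"] by simp
qed

end

text \<open>Collects what both branches of \<open>patterson_weight\<close> provide, so that the
  plain and the modified Poincare series are treated at once.\<close>

locale patterson_series = discrete_hyp_group \<Gamma>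
  for \<Gamma> :: "(real ^ 'n \<Rightarrow> real ^ 'n) set" +
  fixes x0 :: "real ^ 'n" and h :: "real \<Rightarrow> real" and \<delta> :: real and s :: "nat \<Rightarrow> real"
  assumes x0: "x0 \<in> hyp_space"
    and h_pos: "\<And>r. 0 < r \<Longrightarrow> 0 < h r"
    and h_mono: "mono_on {0<..} h"
    and h_slow: "\<And>\<epsilon>. 0 < \<epsilon> \<Longrightarrow> \<exists>r0>0. \<forall>r>r0. \<forall>t>1. h (t * r) \<le> t powr \<epsilon> * h r"
    and s_lim: "s \<longlonglongrightarrow> \<delta>"
    and summable_s: "\<And>k. orbit_weight h x0 (s k) x0 summable_on \<Gamma>"
    and not_summable_\<delta>: "\<not> orbit_weight h x0 \<delta> x0 summable_on \<Gamma>"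
begin

abbreviation "w \<equiv> orbit_weight h x0"

lemma w_pos: "0 < w t y \<gamma>"
  by (simp add: orbit_weight_def h_pos)

lemma w_nonneg: "0 \<le> w t y \<gamma>"
  using w_pos by (rule less_imp_le)

text \<open>The conformal density of the measure at \<open>y'\<close> with respect to the one at
  \<open>y\<close>, extended from the sphere to the closed ball so that it may be part of a test
  function for weak convergence.\<close>

definition conf :: "real ^ 'n \<Rightarrow> real ^ 'n \<Rightarrow> real ^ 'n \<Rightarrow> real" where
  "conf y y' z = exp (\<delta> * (ln (horo y z) - ln (horo y' z)))"

lemma continuous_on_conf:
  assumes "y \<in> hyp_space" "y' \<in> hyp_space"
  shows "continuous_on (cball 0 1) (conf y y')"
  unfolding conf_def by (intro continuous_intros continuous_on_ln_horo assms)

text \<open>At an orbit point the quotient of the two weights is exp(s D + u), where D is the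
  bounded difference of distances and u comes from \<open>h\<close>. Far out u is small, and s tends
  to \<delta>. The exceptional set is chosen independently of \<open>k\<close>; this is what makes
  it negligible in the limit.\<close>

lemma weight_ratio:
  assumes y: "y \<in> hyp_space" and y': "y' \<in> hyp_space" and \<epsilon>: "0 < \<epsilon>"
  obtains A where "finite A" "A \<subseteq> \<Gamma>"
    "\<forall>\<^sub>F k in sequentially. \<forall>\<gamma>\<in>\<Gamma> - A.
       \<bar>w (s k) y' \<gamma> - conf y y' (\<gamma> x0) * w (s k) y \<gamma>\<bar> \<le> \<epsilon> * w (s k) y \<gamma>"
proof -
  obtain C where C: "0 \<le> C" "\<And>z. z \<in> hyp_space \<Longrightarrow> \<bar>hyp_dist y z - hyp_dist y' z\<bar> \<le> C"
    using hyp_dist_diff_bounded[OF y y'] by blast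
  \<comment> \<open>The exponent is off by at most \<open>2 * \<eta> * C\<close>: one
    \<open>\<eta> * C\<close> comes from \<open>s k - \<delta>\<close>, the other from
    \<open>h\<close>. The factor \<open>exp (\<bar>\<delta>\<bar> * C)\<close> bounds the limiting
    quotient itself.\<close>
  have "((\<lambda>\<eta>. exp (\<bar>\<delta>\<bar> * C) * (exp (2 * \<eta> * C) - 1)) \<longlongrightarrow> exp (\<bar>\<delta>\<bar> * C) * (exp (2 * 0 * C) - 1))
      (at_right 0)"
    by (intro tendsto_intros)
  then have "\<forall>\<^sub>F \<eta> in at_right 0. exp (\<bar>\<delta>\<bar> * C) * (exp (2 * \<eta> * C) - 1) < \<epsilon>"
    using \<epsilon> by (intro order_tendstoD(2)) auto
  then have "\<forall>\<^sub>F \<eta> in at_right 0. 0 < \<eta> \<and> exp (\<bar>\<delta>\<bar> * C) * (exp (2 * \<eta> * C) - 1) < \<epsilon>"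
    by (intro eventually_conj eventually_at_right_less)
  then obtain \<eta> where \<eta>: "0 < \<eta>" "exp (\<bar>\<delta>\<bar> * C) * (exp (2 * \<eta> * C) - 1) < \<epsilon>"
    using eventually_happens'[OF trivial_limit_at_right_real] by blast
  obtain r0 where r0: "0 < r0" "\<And>r t. r0 < r \<Longrightarrow> 1 < t \<Longrightarrow> h (t * r) \<le> t powr \<eta> * h r"
    using h_slow[OF \<eta>(1)] by blast
  \<comment> \<open>The margin \<open>C\<close> ensures that outside \<open>A\<close> the distances
    from both \<open>y\<close> and \<open>y'\<close> exceed \<open>ln r0\<close>.\<close>
  define A where "A = {\<gamma> \<in> \<Gamma>. hyp_dist y (\<gamma> x0) \<le> ln r0 + C}"
  show ?thesis
  proof
    show "finite A" unfolding A_def by (rule finite_orbit_near[OF y x0])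
    show "A \<subseteq> \<Gamma>" by (auto simp: A_def)
    have "\<forall>\<^sub>F k in sequentially. dist (s k) \<delta> < \<eta>" using s_lim \<eta>(1) by (rule tendstoD)
    then show "\<forall>\<^sub>F k in sequentially. \<forall>\<gamma>\<in>\<Gamma> - A.
       \<bar>w (s k) y' \<gamma> - conf y y' (\<gamma> x0) * w (s k) y \<gamma>\<bar> \<le> \<epsilon> * w (s k) y \<gamma>"
    proof (eventually_elim, intro ballI)
      fix k \<gamma> assume k: "dist (s k) \<delta> < \<eta>" and \<gamma>: "\<gamma> \<in> \<Gamma> - A"
      then have z: "\<gamma> x0 \<in> hyp_space" using hyp_space_image x0 by blast
      let ?d = "hyp_dist y (\<gamma> x0)" and ?d' = "hyp_dist y' (\<gamma> x0)"
      let ?D = "?d - ?d'"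
      define u where "u = ln (h (exp ?d') / h (exp ?d))"
      have d: "ln r0 + C < ?d" using \<gamma> by (auto simp: A_def)
      have "ln r0 < ?d" "ln r0 < ?d'" using d C(1) C(2)[OF z] by linarith+
      then have "exp (ln r0) < exp ?d" "exp (ln r0) < exp ?d'" by (simp_all only: exp_less_mono)
      then have u: "\<bar>u\<bar> \<le> \<eta> * C"
        unfolding u_def using r0 \<eta>(1) C(2)[OF z] h_pos
        by (intro ln_ratio_le_slow_growth[where ?r0.0 = r0] h_mono) (auto simp: abs_minus_commute)
      have hu: "h (exp ?d') = exp u * h (exp ?d)"
        using h_pos[of "exp ?d"] h_pos[of "exp ?d'"] by (simp add: u_def)
      have w': "w (s k) y' \<gamma> = exp (s k * ?D + u) * w (s k) y \<gamma>"
      proof -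
        have "exp (s k * ?D + u) * exp (- s k * ?d) = exp (- s k * ?d') * exp u"
          by (simp add: algebra_simps flip: exp_add)
        then show ?thesis unfolding orbit_weight_def hu by (simp only: mult.assoc[symmetric])
      qed
      have c: "conf y y' (\<gamma> x0) = exp (\<delta> * ?D)"
        using hyp_dist_diff[OF y y' z] by (simp add: conf_def)
      have "\<bar>exp (s k * ?D + u) - exp (\<delta> * ?D)\<bar> = exp (\<delta> * ?D) * \<bar>exp ((s k - \<delta>) * ?D + u) - 1\<bar>"
      proof -
        have "exp (s k * ?D + u) - exp (\<delta> * ?D) = exp (\<delta> * ?D) * (exp ((s k - \<delta>) * ?D + u) - 1)"
          by (simp add: right_diff_distrib algebra_simps flip: exp_add)
        then show ?thesis by (simp add: abs_mult)
      qed
      also have "\<dots> \<le> exp (\<bar>\<delta>\<bar> * C) * (exp (2 * \<eta> * C) - 1)"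
      proof (rule mult_mono)
        have "\<delta> * ?D \<le> \<bar>\<delta>\<bar> * \<bar>?D\<bar>" by (metis abs_ge_self abs_mult)
        also have "\<dots> \<le> \<bar>\<delta>\<bar> * C" using C(2)[OF z] by (intro mult_left_mono) auto
        finally show "exp (\<delta> * ?D) \<le> exp (\<bar>\<delta>\<bar> * C)" by simp
        have "\<bar>(s k - \<delta>) * ?D + u\<bar> \<le> \<bar>s k - \<delta>\<bar> * \<bar>?D\<bar> + \<bar>u\<bar>"
          using abs_triangle_ineq[of "(s k - \<delta>) * ?D" u] by (simp add: abs_mult)
        also have "\<dots> \<le> \<eta> * C + \<eta> * C"
          using k C(2)[OF z] u \<eta>(1) by (intro add_mono mult_mono) (auto simp: dist_real_def)
        also have "\<dots> = 2 * \<eta> * C" by simp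
        finally have "exp \<bar>(s k - \<delta>) * ?D + u\<bar> \<le> exp (2 * \<eta> * C)" by (simp only: exp_le_cancel_iff)
        then show "\<bar>exp ((s k - \<delta>) * ?D + u) - 1\<bar> \<le> exp (2 * \<eta> * C) - 1"
          using abs_exp_minus_1_le[of "(s k - \<delta>) * ?D + u"] by linarith
      qed auto
      also have "\<dots> \<le> \<epsilon>" using \<eta>(2) by simp
      finally have le: "\<bar>exp (s k * ?D + u) - exp (\<delta> * ?D)\<bar> \<le> \<epsilon>" .
      have "\<bar>w (s k) y' \<gamma> - conf y y' (\<gamma> x0) * w (s k) y \<gamma>\<bar>
          = \<bar>exp (s k * ?D + u) - exp (\<delta> * ?D)\<bar> * w (s k) y \<gamma>"
        unfolding w' c using w_pos[of "s k" y \<gamma>] by (simp add: abs_mult flip: left_diff_distrib)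
      also have "\<dots> \<le> \<epsilon> * w (s k) y \<gamma>"
        using le w_pos[of "s k" y \<gamma>] by (intro mult_right_mono) auto
      finally show "\<bar>w (s k) y' \<gamma> - conf y y' (\<gamma> x0) * w (s k) y \<gamma>\<bar> \<le> \<epsilon> * w (s k) y \<gamma>" .
    qed
  qed
qed

lemma conf_bounded:
  assumes "y \<in> hyp_space" "y' \<in> hyp_space"
  obtains M where "0 < M" "\<And>z. z \<in> cball 0 1 \<Longrightarrow> \<bar>conf y y' z\<bar> \<le> M"
proof -
  have "bounded (conf y y' ` cball 0 1)"
    by (intro compact_imp_bounded compact_continuous_image continuous_on_conf assms compact_cball)
  then show ?thesis using that unfolding bounded_pos by auto
qed

text \<open>Summability is assumed at the basepoint \<open>x0\<close> only.
  \<open>weight_ratio\<close> transfers it to \<open>y\<close> with relative error 1, and therefore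
  only for large \<open>k\<close>.\<close>

lemma summable_weight:
  assumes y: "y \<in> hyp_space"
  shows "\<forall>\<^sub>F k in sequentially. w (s k) y summable_on \<Gamma>"
proof -
  obtain A where A: "finite A" "A \<subseteq> \<Gamma>" and ev: "\<forall>\<^sub>F k in sequentially. \<forall>\<gamma>\<in>\<Gamma> - A.
       \<bar>w (s k) y \<gamma> - conf x0 y (\<gamma> x0) * w (s k) x0 \<gamma>\<bar> \<le> 1 * w (s k) x0 \<gamma>"
    using weight_ratio[OF x0 y, of 1] by auto
  obtain M where M: "0 < M" "\<And>z. z \<in> cball 0 1 \<Longrightarrow> \<bar>conf x0 y z\<bar> \<le> M"
    using conf_bounded[OF x0 y] by blast
  show ?thesis
    using ev
  proof eventually_elim
    case (elim k)
    have "w (s k) y summable_on (\<Gamma> - A)"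
    proof (rule summable_on_comparison_test)
      show "(\<lambda>\<gamma>. (M + 1) * w (s k) x0 \<gamma>) summable_on (\<Gamma> - A)"
        by (intro summable_on_cmult_right summable_on_cofin_subset summable_s A)
      fix \<gamma> assume \<gamma>: "\<gamma> \<in> \<Gamma> - A"
      then have "\<gamma> x0 \<in> cball 0 1" using hyp_space_image[OF _ x0] ball_subset_cball by blast
      then have "conf x0 y (\<gamma> x0) * w (s k) x0 \<gamma> \<le> M * w (s k) x0 \<gamma>"
        using M(2) w_pos[of "s k" x0 \<gamma>] by (intro mult_right_mono) (auto dest: abs_le_D1)
      then show "w (s k) y \<gamma> \<le> (M + 1) * w (s k) x0 \<gamma>"
        using elim[rule_format, OF \<gamma>] by (simp add: distrib_right abs_le_iff)
      show "0 \<le> w (s k) y \<gamma>" using w_nonneg by blast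
    qed
    then have "w (s k) y summable_on (\<Gamma> - A) \<union> A"
      using A(1) by (intro summable_on_union) auto
    then show ?case using A(2) by (simp add: Un_absorb2)
  qed
qed

text \<open>Divergence at \<delta> gives finite sums above any bound, and a finite sum is continuous
  in the exponent.\<close>

lemma normalizer_at_top: "filterlim (\<lambda>k. \<Sum>\<^sub>\<infinity>\<gamma>\<in>\<Gamma>. w (s k) x0 \<gamma>) at_top sequentially"
  unfolding filterlim_at_top
proof
  fix L :: real
  have "\<not> bdd_above (sum (w \<delta> x0) ` {F. F \<subseteq> \<Gamma> \<and> finite F})"
    using not_summable_\<delta> nonneg_bdd_above_summable_on[of \<Gamma> "w \<delta> x0"] w_nonneg by blast
  then obtain T where T: "T \<subseteq> \<Gamma>" "finite T" "L < sum (w \<delta> x0) T"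
    unfolding bdd_above_def by (auto simp: not_le)
  have "(\<lambda>k. sum (w (s k) x0) T) \<longlonglongrightarrow> sum (w \<delta> x0) T"
    unfolding orbit_weight_def by (intro tendsto_intros s_lim)
  from order_tendstoD(1)[OF this T(3)]
  show "\<forall>\<^sub>F k in sequentially. L \<le> (\<Sum>\<^sub>\<infinity>\<gamma>\<in>\<Gamma>. w (s k) x0 \<gamma>)"
  proof eventually_elim
    case (elim k)
    have "sum (w (s k) x0) T \<le> (\<Sum>\<^sub>\<infinity>\<gamma>\<in>\<Gamma>. w (s k) x0 \<gamma>)"
      by (rule finite_sum_le_infsum[OF summable_s T(2,1)]) (use w_nonneg in blast)
    then show ?case using elim by linarith
  qed
qed

text \<open>On the finite exceptional set the numerators stay bounded while the normalizer tends to
  infinity. Off it the error is relative to the weights at \<open>y\<close>, whose normalized total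
  is bounded by \<open>conv\<close>.\<close>

lemma patterson_mean_conformal:
  assumes y: "y \<in> hyp_space" and y': "y' \<in> hyp_space"
    and \<phi>: "continuous_on (cball 0 1) \<phi>"
    and conv: "convergent (\<lambda>k. patterson_mean \<Gamma> x0 h (s k) y (\<lambda>_. 1))"
  shows "(\<lambda>k. patterson_mean \<Gamma> x0 h (s k) y' \<phi>
           - patterson_mean \<Gamma> x0 h (s k) y (\<lambda>z. \<phi> z * conf y y' z)) \<longlonglongrightarrow> 0"
proof (rule LIMSEQ_I)
  fix e :: real assume e: "0 < e"
  define Z where "Z k = (\<Sum>\<^sub>\<infinity>\<gamma>\<in>\<Gamma>. w (s k) x0 \<gamma>)" for k
  have "bounded (\<phi> ` cball 0 1)"
    by (intro compact_imp_bounded compact_continuous_image \<phi> compact_cball)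
  then obtain M where M: "0 < M" "\<And>z. z \<in> cball 0 1 \<Longrightarrow> \<bar>\<phi> z\<bar> \<le> M"
    unfolding bounded_pos by auto
  obtain B where B: "0 < B" "\<And>k. \<bar>patterson_mean \<Gamma> x0 h (s k) y (\<lambda>_. 1)\<bar> \<le> B"
    using convergent_imp_Bseq[OF conv] by (auto simp: Bseq_def)
  obtain M' where M': "0 < M'" "\<And>z. z \<in> cball 0 1 \<Longrightarrow> \<bar>conf y y' z\<bar> \<le> M'"
    using conf_bounded[OF y y'] by blast
  \<comment> \<open>Chosen so that the error off the exceptional set, at most
    \<open>M * \<epsilon> * B\<close>, equals half of \<open>e\<close>.\<close>
  define \<epsilon> where "\<epsilon> = e / (2 * M * B)"
  have \<epsilon>: "0 < \<epsilon>" using e M(1) B(1) by (simp add: \<epsilon>_def)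
  obtain A where A: "finite A" "A \<subseteq> \<Gamma>" and ratio: "\<forall>\<^sub>F k in sequentially. \<forall>\<gamma>\<in>\<Gamma> - A.
       \<bar>w (s k) y' \<gamma> - conf y y' (\<gamma> x0) * w (s k) y \<gamma>\<bar> \<le> \<epsilon> * w (s k) y \<gamma>"
    using weight_ratio[OF y y' \<epsilon>] by blast
  define d where "d k \<gamma> = w (s k) y' \<gamma> - conf y y' (\<gamma> x0) * w (s k) y \<gamma>" for k \<gamma>
  have "(\<lambda>k. \<Sum>\<gamma>\<in>A. \<bar>d k \<gamma>\<bar>) \<longlonglongrightarrow> (\<Sum>\<gamma>\<in>A. \<bar>w \<delta> y' \<gamma> - conf y y' (\<gamma> x0) * w \<delta> y \<gamma>\<bar>)"
    unfolding d_def orbit_weight_def by (intro tendsto_intros s_lim)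
  then have "(\<lambda>k. M * (\<Sum>\<gamma>\<in>A. \<bar>d k \<gamma>\<bar>) / Z k) \<longlonglongrightarrow> 0"
    unfolding Z_def by (intro real_tendsto_divide_at_top[OF tendsto_mult_left normalizer_at_top])
  from order_tendstoD(2)[OF this, of "e / 2"] e
  have small: "\<forall>\<^sub>F k in sequentially. M * (\<Sum>\<gamma>\<in>A. \<bar>d k \<gamma>\<bar>) / Z k < e / 2" by simp
  have Zpos: "\<forall>\<^sub>F k in sequentially. 0 < Z k"
    using normalizer_at_top unfolding Z_def filterlim_at_top_dense by blast
  have "\<forall>\<^sub>F k in sequentially. norm (patterson_mean \<Gamma> x0 h (s k) y' \<phi>
           - patterson_mean \<Gamma> x0 h (s k) y (\<lambda>z. \<phi> z * conf y y' z) - 0) < e"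
    using ratio small Zpos summable_weight[OF y] summable_weight[OF y']
  proof eventually_elim
    case (elim k)
    have in_cball: "\<gamma> x0 \<in> cball 0 1" if "\<gamma> \<in> \<Gamma>" for \<gamma>
      using hyp_space_image[OF that x0] ball_subset_cball by blast
    have sm': "(\<lambda>\<gamma>. w (s k) y' \<gamma> * \<phi> (\<gamma> x0)) summable_on \<Gamma>"
    proof (rule summable_on_bounded_mult[where M = M])
      show "w (s k) y' summable_on \<Gamma>" by fact
    qed (use M in_cball w_nonneg in auto)
    have sm: "(\<lambda>\<gamma>. w (s k) y \<gamma> * (\<phi> (\<gamma> x0) * conf y y' (\<gamma> x0))) summable_on \<Gamma>"
    proof (rule summable_on_bounded_mult[where M = "M * M'"])
      show "w (s k) y summable_on \<Gamma>" by fact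
      fix \<gamma> assume "\<gamma> \<in> \<Gamma>"
      then show "\<bar>\<phi> (\<gamma> x0) * conf y y' (\<gamma> x0)\<bar> \<le> M * M'"
        unfolding abs_mult using M M' in_cball by (intro mult_mono) auto
    qed (use w_nonneg in auto)
    have smd: "(\<lambda>\<gamma>. \<phi> (\<gamma> x0) * d k \<gamma>) summable_on \<Gamma>"
      using summable_on_add[OF sm' summable_on_uminus[THEN iffD2, OF sm]]
      by (simp add: d_def algebra_simps)
    have smA: "(\<lambda>\<gamma>. \<epsilon> * w (s k) y \<gamma>) summable_on (\<Gamma> - A)"
      by (intro summable_on_cmult_right summable_on_cofin_subset A) fact
    have "\<bar>\<Sum>\<^sub>\<infinity>\<gamma>\<in>\<Gamma>. \<phi> (\<gamma> x0) * d k \<gamma>\<bar>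
        = \<bar>(\<Sum>\<gamma>\<in>A. \<phi> (\<gamma> x0) * d k \<gamma>) + (\<Sum>\<^sub>\<infinity>\<gamma>\<in>\<Gamma> - A. \<phi> (\<gamma> x0) * d k \<gamma>)\<bar>"
      using infsum_Diff[OF smd summable_on_finite[OF A(1)] A(2)] A(1) by simp
    also have "\<dots> \<le> M * (\<Sum>\<gamma>\<in>A. \<bar>d k \<gamma>\<bar>) + M * (\<epsilon> * (\<Sum>\<^sub>\<infinity>\<gamma>\<in>\<Gamma>. w (s k) y \<gamma>))"
    proof (rule order_trans[OF abs_triangle_ineq add_mono])
      have "\<bar>\<Sum>\<gamma>\<in>A. \<phi> (\<gamma> x0) * d k \<gamma>\<bar> \<le> (\<Sum>\<gamma>\<in>A. M * \<bar>d k \<gamma>\<bar>)"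
        using A(2) M in_cball
        by (intro order_trans[OF sum_abs sum_mono]) (auto simp: abs_mult intro!: mult_right_mono)
      then show "\<bar>\<Sum>\<gamma>\<in>A. \<phi> (\<gamma> x0) * d k \<gamma>\<bar> \<le> M * (\<Sum>\<gamma>\<in>A. \<bar>d k \<gamma>\<bar>)"
        by (simp add: sum_distrib_left)
      have le: "\<bar>\<phi> (\<gamma> x0) * d k \<gamma>\<bar> \<le> M * (\<epsilon> * w (s k) y \<gamma>)" if "\<gamma> \<in> \<Gamma> - A" for \<gamma>
        unfolding abs_mult using elim(1) that M in_cball[of \<gamma>]
        by (intro mult_mono) (auto simp: d_def)
      have smM: "(\<lambda>\<gamma>. M * (\<epsilon> * w (s k) y \<gamma>)) summable_on (\<Gamma> - A)"
        by (intro summable_on_cmult_right smA)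
      have "(\<lambda>\<gamma>. norm (\<phi> (\<gamma> x0) * d k \<gamma>)) summable_on (\<Gamma> - A)"
        by (rule Infinite_Sum.abs_summable_on_comparison_test'[OF smM]) (use le in simp)
      from norm_infsum_bound[OF this] infsum_mono[OF this smM]
      have "\<bar>\<Sum>\<^sub>\<infinity>\<gamma>\<in>\<Gamma> - A. \<phi> (\<gamma> x0) * d k \<gamma>\<bar> \<le> (\<Sum>\<^sub>\<infinity>\<gamma>\<in>\<Gamma> - A. M * (\<epsilon> * w (s k) y \<gamma>))"
        using le by fastforce
      also have "\<dots> \<le> (\<Sum>\<^sub>\<infinity>\<gamma>\<in>\<Gamma>. M * (\<epsilon> * w (s k) y \<gamma>))"
      proof (rule infsum_mono2[OF smM])
        show "(\<lambda>\<gamma>. M * (\<epsilon> * w (s k) y \<gamma>)) summable_on \<Gamma>"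
          by (intro summable_on_cmult_right) fact
      qed (use M(1) \<epsilon> w_nonneg in \<open>auto intro!: mult_nonneg_nonneg\<close>)
      also have "\<dots> = M * (\<epsilon> * (\<Sum>\<^sub>\<infinity>\<gamma>\<in>\<Gamma>. w (s k) y \<gamma>))"
        by (simp add: infsum_cmult_right')
      finally show "\<bar>\<Sum>\<^sub>\<infinity>\<gamma>\<in>\<Gamma> - A. \<phi> (\<gamma> x0) * d k \<gamma>\<bar> \<le> M * (\<epsilon> * (\<Sum>\<^sub>\<infinity>\<gamma>\<in>\<Gamma>. w (s k) y \<gamma>))" .
    qed
    finally have bound: "\<bar>\<Sum>\<^sub>\<infinity>\<gamma>\<in>\<Gamma>. \<phi> (\<gamma> x0) * d k \<gamma>\<bar>
        \<le> M * (\<Sum>\<gamma>\<in>A. \<bar>d k \<gamma>\<bar>) + M * (\<epsilon> * (\<Sum>\<^sub>\<infinity>\<gamma>\<in>\<Gamma>. w (s k) y \<gamma>))" .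
    have "patterson_mean \<Gamma> x0 h (s k) y' \<phi>
           - patterson_mean \<Gamma> x0 h (s k) y (\<lambda>z. \<phi> z * conf y y' z)
        = (\<Sum>\<^sub>\<infinity>\<gamma>\<in>\<Gamma>. \<phi> (\<gamma> x0) * d k \<gamma>) / Z k"
    proof -
      have "(\<Sum>\<^sub>\<infinity>\<gamma>\<in>\<Gamma>. \<phi> (\<gamma> x0) * d k \<gamma>) = (\<Sum>\<^sub>\<infinity>\<gamma>\<in>\<Gamma>. w (s k) y' \<gamma> * \<phi> (\<gamma> x0)
          + - (w (s k) y \<gamma> * (\<phi> (\<gamma> x0) * conf y y' (\<gamma> x0))))"
        by (intro infsum_cong) (simp add: d_def algebra_simps)
      also have "\<dots> = (\<Sum>\<^sub>\<infinity>\<gamma>\<in>\<Gamma>. w (s k) y' \<gamma> * \<phi> (\<gamma> x0))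
          - (\<Sum>\<^sub>\<infinity>\<gamma>\<in>\<Gamma>. w (s k) y \<gamma> * (\<phi> (\<gamma> x0) * conf y y' (\<gamma> x0)))"
        unfolding infsum_add[OF sm' summable_on_uminus[THEN iffD2, OF sm]] infsum_uminus by simp
      finally show ?thesis by (simp add: patterson_mean_eq Z_def diff_divide_distrib)
    qed
    also have "\<bar>\<dots>\<bar> \<le> (M * (\<Sum>\<gamma>\<in>A. \<bar>d k \<gamma>\<bar>) + M * (\<epsilon> * (\<Sum>\<^sub>\<infinity>\<gamma>\<in>\<Gamma>. w (s k) y \<gamma>))) / Z k"
      using bound elim(3) by (simp add: abs_divide divide_right_mono)
    also have "\<dots> = M * (\<Sum>\<gamma>\<in>A. \<bar>d k \<gamma>\<bar>) / Z k + M * \<epsilon> * patterson_mean \<Gamma> x0 h (s k) y (\<lambda>_. 1)"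
      by (simp add: patterson_mean_eq Z_def add_divide_distrib)
    also have "\<dots> < e / 2 + M * \<epsilon> * B"
      using elim(2) B(2)[of k] M(1) \<epsilon> by (intro add_less_le_mono mult_left_mono) auto
    also have "M * \<epsilon> * B = e / 2" using M(1) B(1) by (simp add: \<epsilon>_def)
    finally show ?case by simp
  qed
  then show "\<exists>no. \<forall>k\<ge>no. norm (patterson_mean \<Gamma> x0 h (s k) y' \<phi>
           - patterson_mean \<Gamma> x0 h (s k) y (\<lambda>z. \<phi> z * conf y y' z) - 0) < e"
    by (simp add: eventually_sequentially)
qed

end

section \<open>Poincare series and the sign of the critical exponent\<close>

context discrete_hyp_group
begin

text \<open>For a nonpositive exponent every term is at least 1, and there are infinitely many
  terms.\<close>

lemma poincare_exponent_pos:
  assumes inf: "infinite \<Gamma>" and x0: "x0 \<in> hyp_space"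
    and sm: "(\<lambda>\<gamma>. exp (- s * hyp_dist x0 (\<gamma> x0))) summable_on \<Gamma>"
  shows "0 < s"
proof (rule ccontr)
  assume "\<not> 0 < s"
  then have ge: "1 \<le> exp (- s * hyp_dist x0 (\<gamma> x0))" if "\<gamma> \<in> \<Gamma>" for \<gamma>
    using hyp_dist_nonneg[OF x0 hyp_space_image[OF that x0]] by (simp add: mult_nonpos_nonneg)
  obtain n :: nat where n: "(\<Sum>\<^sub>\<infinity>\<gamma>\<in>\<Gamma>. exp (- s * hyp_dist x0 (\<gamma> x0))) < real n"
    using reals_Archimedean2 by blast
  obtain T where T: "finite T" "card T = n" "T \<subseteq> \<Gamma>"
    using infinite_arbitrarily_large[OF inf] by blast
  have "real n = (\<Sum>\<gamma>\<in>T. 1)" using T by simp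
  also have "\<dots> \<le> (\<Sum>\<gamma>\<in>T. exp (- s * hyp_dist x0 (\<gamma> x0)))" using ge T(3) by (intro sum_mono) auto
  also have "\<dots> \<le> (\<Sum>\<^sub>\<infinity>\<gamma>\<in>\<Gamma>. exp (- s * hyp_dist x0 (\<gamma> x0)))"
    by (rule finite_sum_le_infsum[OF sm T(1,3)]) simp
  finally show False using n by simp
qed

text \<open>One convergent series makes the set of exponents nonempty, and
  \<open>poincare_exponent_pos\<close> bounds it below by 0. Its infimum is then a genuine one,
  nonnegative and with convergence above it.\<close>

lemma patterson_series_if_summable:
  assumes inf: "infinite \<Gamma>" and x0: "x0 \<in> hyp_space" and h: "patterson_weight \<Gamma> x0 h"
    and ne: "(\<lambda>\<gamma>. exp (- s0 * hyp_dist x0 (\<gamma> x0))) summable_on \<Gamma>"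
    and s: "\<And>k. critical_exponent \<Gamma> x0 < s k" "s \<longlonglongrightarrow> critical_exponent \<Gamma> x0"
  shows "patterson_series \<Gamma> x0 h (critical_exponent \<Gamma> x0) s" and "0 \<le> critical_exponent \<Gamma> x0"
proof -
  define S where "S = {s. (\<lambda>\<gamma>. exp (- s * hyp_dist x0 (\<gamma> x0))) summable_on \<Gamma>}"
  have neS: "S \<noteq> {}" using ne by (auto simp: S_def)
  have pos: "0 < t" if "t \<in> S" for t
    using poincare_exponent_pos[OF inf x0] that by (simp add: S_def)
  have \<delta>: "critical_exponent \<Gamma> x0 = Inf S" by (simp add: critical_exponent_def S_def)
  show "0 \<le> critical_exponent \<Gamma> x0"
    unfolding \<delta> using neS pos by (intro cInf_greatest) (auto intro: less_imp_le)
  have upward: "(\<lambda>\<gamma>. exp (- t * hyp_dist x0 (\<gamma> x0))) summable_on \<Gamma>" if t: "critical_exponent \<Gamma> x0 < t" for t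
  proof -
    obtain t' where t': "t' \<in> S" "t' < t" using cInf_lessD[OF neS] t \<delta> by auto
    show ?thesis
    proof (rule summable_on_comparison_test)
      show "(\<lambda>\<gamma>. exp (- t' * hyp_dist x0 (\<gamma> x0))) summable_on \<Gamma>" using t' by (simp add: S_def)
      fix \<gamma> assume "\<gamma> \<in> \<Gamma>"
      then show "exp (- t * hyp_dist x0 (\<gamma> x0)) \<le> exp (- t' * hyp_dist x0 (\<gamma> x0))"
        using hyp_dist_nonneg[OF x0 hyp_space_image[OF _ x0]] t' by (auto intro!: mult_right_mono)
    qed simp
  qed
  have weight_eq: "orbit_weight h x0 t x0
      = (\<lambda>\<gamma>. exp (- t * hyp_dist x0 (\<gamma> x0)) * h (exp (hyp_dist x0 (\<gamma> x0))))" for h t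
    by (simp add: fun_eq_iff orbit_weight_def)
  show "patterson_series \<Gamma> x0 h (critical_exponent \<Gamma> x0) s"
  proof (cases "(\<lambda>\<gamma>. exp (- critical_exponent \<Gamma> x0 * hyp_dist x0 (\<gamma> x0))) summable_on \<Gamma>")
    case False
    then have h1: "h = (\<lambda>_. 1)" using h by (simp add: patterson_weight_def)
    show ?thesis
    proof unfold_locales
      show "\<exists>r0>0. \<forall>r>r0. \<forall>t>1. h (t * r) \<le> t powr \<epsilon> * h r" if "0 < \<epsilon>" for \<epsilon>
        using that by (intro exI[of _ 1]) (auto simp: h1 ge_one_powr_ge_zero)
      show "orbit_weight h x0 (s k) x0 summable_on \<Gamma>" for k
        using upward[OF s(1)] unfolding weight_eq h1 by simp
      show "\<not> orbit_weight h x0 (critical_exponent \<Gamma> x0) x0 summable_on \<Gamma>"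
        using False unfolding weight_eq h1 by simp
    qed (use x0 s in \<open>auto simp: h1 mono_on_def\<close>)
  next
    case True
    then have "\<not> \<not> (\<lambda>\<gamma>. exp (- critical_exponent \<Gamma> x0 * hyp_dist x0 (\<gamma> x0))) summable_on \<Gamma>"
      by blast
    note h[unfolded patterson_weight_def Let_def if_not_P[OF this], folded weight_eq]
    then have hh: "mono_on {0<..} h" "\<And>r. 0 < r \<Longrightarrow> 0 < h r"
      "\<And>s. orbit_weight h x0 s x0 summable_on \<Gamma> \<longleftrightarrow> critical_exponent \<Gamma> x0 < s"
      "\<And>\<epsilon>. 0 < \<epsilon> \<Longrightarrow> \<exists>r0>0. \<forall>r>r0. \<forall>t>1. h (t * r) \<le> t powr \<epsilon> * h r"
      by blast+
    show ?thesis
      by unfold_locales (use x0 s hh in auto)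
  qed
qed

text \<open>
  If no Poincare series converged, the critical exponent would be the infimum of the empty set, of
  unknown sign, and all means would be zero as quotients by a divergent \<open>infsum\<close>.  Then \<open>\<mu>\<close> vanishes
  and the zero function is a continuation, so this case needs no exclusion.
\<close>

lemma patterson_mean_degenerate:
  assumes h: "patterson_weight \<Gamma> x0 h"
    and "\<And>s. \<not> (\<lambda>\<gamma>. exp (- s * hyp_dist x0 (\<gamma> x0))) summable_on \<Gamma>"
  shows "patterson_mean \<Gamma> x0 h s y \<phi> = 0"
proof -
  have "h = (\<lambda>_. 1)" using assms by (simp add: patterson_weight_def)
  then show ?thesis using assms(2)[of s] by (simp add: patterson_mean_def infsum_not_exists)
qed

end

text \<open>That \<Gamma> is infinite serves two ends: the sign of the exponent and an enumeration
  by natural numbers. The final proof obtains it from a nonzero total mass.\<close>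

locale patterson_sullivan_measures = discrete_hyp_group \<Gamma>
  for \<Gamma> :: "(real ^ 'n \<Rightarrow> real ^ 'n) set" +
  fixes x0 :: "real ^ 'n" and \<mu> :: "real ^ 'n \<Rightarrow> (real ^ 'n) measure" and \<delta> :: real
  assumes infinite: "infinite \<Gamma>" and x0: "x0 \<in> hyp_space"
    and PS: "patterson_sullivan \<Gamma> x0 \<mu>"
  defines "\<delta> \<equiv> critical_exponent \<Gamma> x0"
begin

lemma finite_measure: "y \<in> hyp_space \<Longrightarrow> finite_measure (\<mu> y)"
  and sets_eq: "y \<in> hyp_space \<Longrightarrow> sets (\<mu> y) = sets (restrict_space borel (limit_set \<Gamma>))"
  using PS by (simp_all add: patterson_sullivan_def)

lemma space_eq: "y \<in> hyp_space \<Longrightarrow> space (\<mu> y) = limit_set \<Gamma>"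
  using sets_eq_imp_space_eq[OF sets_eq] by (simp add: space_restrict_space)

text \<open>The limit of \<open>patterson_mean_conformal\<close>. The density is written with
  \<open>horo\<close> rather than \<open>busemann_diff\<close> because the test function must be
  continuous on the closed ball. With no convergent series both integrals are limits of
  zeros.\<close>

lemma conformal_cball:
  assumes y: "y \<in> hyp_space" and y': "y' \<in> hyp_space" and \<phi>: "continuous_on (cball 0 1) \<phi>"
  shows "(\<integral>z. \<phi> z \<partial>\<mu> y')
    = (\<integral>z. \<phi> z * exp (\<delta> * (ln (horo y z) - ln (horo y' z))) \<partial>\<mu> y)"
proof -
  obtain h s where h: "patterson_weight \<Gamma> x0 h"
    and s: "\<And>k::nat. s k > critical_exponent \<Gamma> x0" "s \<longlonglongrightarrow> critical_exponent \<Gamma> x0"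
    and lim: "\<And>x \<phi>. x \<in> hyp_space \<Longrightarrow> continuous_on (cball 0 1) \<phi> \<Longrightarrow>
           (\<lambda>k. patterson_mean \<Gamma> x0 h (s k) x \<phi>) \<longlonglongrightarrow> (\<integral>\<xi>. \<phi> \<xi> \<partial>\<mu> x)"
    using PS unfolding patterson_sullivan_def by blast
  let ?c = "\<lambda>z. exp (\<delta> * (ln (horo y z) - ln (horo y' z)))"
  have lim': "(\<lambda>k. patterson_mean \<Gamma> x0 h (s k) y (\<lambda>z. \<phi> z * ?c z)) \<longlonglongrightarrow> (\<integral>z. \<phi> z * ?c z \<partial>\<mu> y)"
    by (intro lim y continuous_intros \<phi> continuous_on_ln_horo y')
  show ?thesis
  proof (cases "\<exists>s. (\<lambda>\<gamma>. exp (- s * hyp_dist x0 (\<gamma> x0))) summable_on \<Gamma>")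
    case True
    then interpret patterson_series \<Gamma> x0 h \<delta> s
      unfolding \<delta>_def using patterson_series_if_summable(1)[OF infinite x0 h _ s] by blast
    have "convergent (\<lambda>k. patterson_mean \<Gamma> x0 h (s k) y (\<lambda>_. 1))"
      using lim[OF y, of "\<lambda>_. 1"] by (auto intro: convergentI)
    from patterson_mean_conformal[OF y y' \<phi> this]
    have "(\<lambda>k. patterson_mean \<Gamma> x0 h (s k) y' \<phi> - patterson_mean \<Gamma> x0 h (s k) y (\<lambda>z. \<phi> z * ?c z))
        \<longlonglongrightarrow> 0" by (simp add: conf_def)
    from LIMSEQ_unique[OF this tendsto_diff[OF lim[OF y' \<phi>] lim']] show ?thesis by simp
  next
    case False
    then have zero: "patterson_mean \<Gamma> x0 h t z \<psi> = 0" for t z \<psi>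
      using patterson_mean_degenerate[OF h] by blast
    show ?thesis
      using lim[OF y' \<phi>] lim' unfolding zero by (simp add: LIMSEQ_const_iff)
  qed
qed

lemma equivariant_cball:
  fixes \<phi> :: "real ^ 'n \<Rightarrow> real"
  assumes g: "g \<in> \<Gamma>" and y: "y \<in> hyp_space" and \<phi>: "continuous_on (cball 0 1) \<phi>"
  shows "(\<integral>z. \<phi> z \<partial>\<mu> (g y)) = (\<integral>z. \<phi> (ball_ext g z) \<partial>\<mu> y)"
proof -
  obtain h s where
    lim: "\<And>x \<phi>. x \<in> hyp_space \<Longrightarrow> continuous_on (cball 0 1) \<phi> \<Longrightarrow>
           (\<lambda>k::nat. patterson_mean \<Gamma> x0 h (s k) x \<phi>) \<longlonglongrightarrow> (\<integral>\<xi>. \<phi> \<xi> \<partial>\<mu> x)"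
    using PS unfolding patterson_sullivan_def by blast
  have "continuous_on (cball 0 1) (\<lambda>z. \<phi> (ball_ext g z))"
    by (rule continuous_on_compose2[OF \<phi> continuous_on_ball_ext[OF hyp_isometry[OF g]]])
       (use ball_ext_cball[OF hyp_isometry[OF g]] in blast)
  from lim[OF y this] lim[OF hyp_space_image[OF g y] \<phi>] show ?thesis
    unfolding patterson_mean_equivariant[OF g y x0] by (rule LIMSEQ_unique[symmetric])
qed

text \<open>A nonzero mass excludes the degenerate case, in which the means of the constant 1, and
  hence its integral, vanish.\<close>

lemma exponent_nonneg:
  assumes y: "y \<in> hyp_space" and nonzero: "measure (\<mu> y) (space (\<mu> y)) \<noteq> 0"
  shows "0 \<le> \<delta>"
proof -
  obtain h s where h: "patterson_weight \<Gamma> x0 h"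
    and s: "\<And>k::nat. s k > critical_exponent \<Gamma> x0" "s \<longlonglongrightarrow> critical_exponent \<Gamma> x0"
    and lim: "\<And>x \<phi>. x \<in> hyp_space \<Longrightarrow> continuous_on (cball 0 1) \<phi> \<Longrightarrow>
           (\<lambda>k. patterson_mean \<Gamma> x0 h (s k) x \<phi>) \<longlonglongrightarrow> (\<integral>\<xi>. \<phi> \<xi> \<partial>\<mu> x)"
    using PS unfolding patterson_sullivan_def by blast
  show ?thesis
  proof (cases "\<exists>s. (\<lambda>\<gamma>. exp (- s * hyp_dist x0 (\<gamma> x0))) summable_on \<Gamma>")
    case True
    then show ?thesis
      unfolding \<delta>_def using patterson_series_if_summable(2)[OF infinite x0 h _ s] by blast
  next
    case False
    then have zero: "patterson_mean \<Gamma> x0 h t y \<psi> = 0" for t \<psi>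
      using patterson_mean_degenerate[OF h] by blast
    have "(\<integral>\<xi>. 1 \<partial>\<mu> y) = (0::real)"
      using lim[OF y, of "\<lambda>_. 1"] unfolding zero by (simp add: LIMSEQ_const_iff)
    then show ?thesis using nonzero by simp
  qed
qed

section \<open>Integration of continuous functions on the limit set\<close>

lemma borel_measurable_if_continuous_on:
  fixes f :: "real ^ 'n \<Rightarrow> 'b :: topological_space"
  assumes "y \<in> hyp_space" "continuous_on (limit_set \<Gamma>) f"
  shows "f \<in> borel_measurable (\<mu> y)"
  using borel_measurable_continuous_on_restrict[OF assms(2)]
  by (simp cong: measurable_cong_sets add: sets_eq[OF assms(1)])

lemma integrable_if_continuous_on:
  fixes f :: "real ^ 'n \<Rightarrow> 'b :: {banach, second_countable_topology}"
  assumes y: "y \<in> hyp_space" and f: "continuous_on (limit_set \<Gamma>) f"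
  shows "integrable (\<mu> y) f"
proof -
  interpret finite_measure "\<mu> y" by (rule finite_measure[OF y])
  have "bounded (f ` limit_set \<Gamma>)"
    by (intro compact_imp_bounded compact_continuous_image f compact_limit_set)
  then obtain B where "\<forall>\<xi>\<in>limit_set \<Gamma>. norm (f \<xi>) \<le> B" by (auto simp: bounded_iff)
  then show ?thesis
    by (intro integrable_const_bound[of _ B] borel_measurable_if_continuous_on y f AE_I2)
       (simp add: space_eq[OF y])
qed

text \<open>Since \<open>y\<close> is the image of \<open>inv_fun g y\<close> under
  \<open>g\<close>, equivariance leads from the measure at \<open>y\<close> to the one at
  \<open>inv_fun g y\<close>, and conformality leads back at the price of the exponential
  factor.\<close>

lemma conformal_transformation_real:
  fixes \<phi> :: "real ^ 'n \<Rightarrow> real"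
  assumes g: "g \<in> \<Gamma>" and y: "y \<in> hyp_space" and \<phi>: "continuous_on (limit_set \<Gamma>) \<phi>"
  shows "(\<integral>\<xi>. \<phi> \<xi> \<partial>\<mu> y)
    = (\<integral>\<xi>. exp (\<delta> * busemann_diff y (inv_fun g y) \<xi>) * \<phi> (bdry_act g \<xi>) \<partial>\<mu> y)"
proof -
  have "closedin (top_of_set UNIV) (limit_set \<Gamma>)"
    using compact_imp_closed[OF compact_limit_set] by simp
  \<comment> \<open>\<phi> lives on the limit set only, whereas the two transformation rules concern
    functions on the closed ball.\<close>
  from Tietze_unbounded[OF \<phi> this]
  obtain \<psi> where \<psi>: "continuous_on UNIV \<psi>" "\<And>\<xi>. \<xi> \<in> limit_set \<Gamma> \<Longrightarrow> \<psi> \<xi> = \<phi> \<xi>" by blast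
  have \<psi>c: "continuous_on (cball 0 1) \<psi>" using \<psi>(1) by (rule continuous_on_subset) simp
  let ?y = "inv_fun g y"
  have y': "?y \<in> hyp_space" using hyp_space_image[OF inv_closed[OF g] y] .
  have gy: "g ?y = y" by (rule hyp_isometry_inv_apply(1)[OF hyp_isometry[OF g]])
  have cont: "continuous_on (cball 0 1) (\<lambda>z. \<psi> (ball_ext g z))"
    by (rule continuous_on_compose2[OF \<psi>(1) continuous_on_ball_ext[OF hyp_isometry[OF g]]]) simp
  have "(\<integral>\<xi>. \<phi> \<xi> \<partial>\<mu> y) = (\<integral>\<xi>. \<psi> \<xi> \<partial>\<mu> (g ?y))"
    unfolding gy using \<psi>(2) by (intro Bochner_Integration.integral_cong) (auto simp: space_eq[OF y])
  also have "\<dots> = (\<integral>z. \<psi> (ball_ext g z) \<partial>\<mu> ?y)" by (rule equivariant_cball[OF g y' \<psi>c])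
  also have "\<dots> = (\<integral>z. \<psi> (ball_ext g z) * exp (\<delta> * (ln (horo y z) - ln (horo ?y z))) \<partial>\<mu> y)"
    by (rule conformal_cball[OF y y' cont])
  also have "\<dots> = (\<integral>\<xi>. exp (\<delta> * busemann_diff y ?y \<xi>) * \<phi> (bdry_act g \<xi>) \<partial>\<mu> y)"
  proof (intro Bochner_Integration.integral_cong refl)
    fix \<xi> assume "\<xi> \<in> space (\<mu> y)"
    then have \<xi>: "\<xi> \<in> limit_set \<Gamma>" by (simp add: space_eq[OF y])
    then have sph: "\<xi> \<in> sphere_at_infinity" using limit_set_subset_sphere by blast
    show "\<psi> (ball_ext g \<xi>) * exp (\<delta> * (ln (horo y \<xi>) - ln (horo ?y \<xi>)))
        = exp (\<delta> * busemann_diff y ?y \<xi>) * \<phi> (bdry_act g \<xi>)"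
      using \<psi>(2)[OF bdry_act_limit_set[OF g \<xi>]]
      by (simp add: ball_ext_sphere[OF sph] busemann_diff_eq[OF y y' sph])
  qed
  finally show ?thesis .
qed

lemma conformal_transformation:
  fixes \<phi> :: "real ^ 'n \<Rightarrow> complex"
  assumes g: "g \<in> \<Gamma>" and y: "y \<in> hyp_space" and \<phi>: "continuous_on (limit_set \<Gamma>) \<phi>"
  shows "(\<integral>\<xi>. \<phi> \<xi> \<partial>\<mu> y)
    = (\<integral>\<xi>. complex_of_real (exp (\<delta> * busemann_diff y (inv_fun g y) \<xi>)) * \<phi> (bdry_act g \<xi>) \<partial>\<mu> y)"
proof -
  let ?e = "\<lambda>\<xi>. exp (\<delta> * busemann_diff y (inv_fun g y) \<xi>)"
  have y': "inv_fun g y \<in> hyp_space" using hyp_space_image[OF inv_closed[OF g] y] .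
  have "continuous_on (limit_set \<Gamma>) (\<lambda>\<xi>. \<phi> (bdry_act g \<xi>))"
    by (rule continuous_on_compose2[OF \<phi> continuous_on_bdry_act[OF g]])
       (use bdry_act_limit_set[OF g] in blast)
  then have int: "integrable (\<mu> y) (\<lambda>\<xi>. complex_of_real (?e \<xi>) * \<phi> (bdry_act g \<xi>))"
    by (intro integrable_if_continuous_on y continuous_intros continuous_on_busemann_diff y')
  note int\<phi> = integrable_if_continuous_on[OF y \<phi>]
  show ?thesis
  proof (rule complex_eqI)
    have "continuous_on (limit_set \<Gamma>) (\<lambda>\<xi>. Re (\<phi> \<xi>))" by (intro continuous_intros \<phi>)
    from conformal_transformation_real[OF g y this]
    show "Re (\<integral>\<xi>. \<phi> \<xi> \<partial>\<mu> y) = Re (\<integral>\<xi>. complex_of_real (?e \<xi>) * \<phi> (bdry_act g \<xi>) \<partial>\<mu> y)"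
      unfolding integral_Re[OF int\<phi>, symmetric] integral_Re[OF int, symmetric] by simp
    have "continuous_on (limit_set \<Gamma>) (\<lambda>\<xi>. Im (\<phi> \<xi>))" by (intro continuous_intros \<phi>)
    from conformal_transformation_real[OF g y this]
    show "Im (\<integral>\<xi>. \<phi> \<xi> \<partial>\<mu> y) = Im (\<integral>\<xi>. complex_of_real (?e \<xi>) * \<phi> (bdry_act g \<xi>) \<partial>\<mu> y)"
      unfolding integral_Im[OF int\<phi>, symmetric] integral_Im[OF int, symmetric] by simp
  qed
qed

end

section \<open>The reduced crossed product\<close>

lemma ell2_norm_nonneg: "0 \<le> ell2_norm A c"
  by (simp add: ell2_norm_def infsum_nonneg)

lemma ell2_norm_sq: "(ell2_norm A c)\<^sup>2 = (\<Sum>\<^sub>\<infinity>\<gamma>\<in>A. (cmod (c \<gamma>))\<^sup>2)"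
  by (simp add: ell2_norm_def infsum_nonneg)

lemma finite_sum_le_ell2_norm_sq:
  assumes "c \<in> ell2 A" "finite T" "T \<subseteq> A"
  shows "(\<Sum>\<gamma>\<in>T. (cmod (c \<gamma>))\<^sup>2) \<le> (ell2_norm A c)\<^sup>2"
  unfolding ell2_norm_sq using assms by (intro finite_sum_le_infsum) (auto simp: ell2_def)

lemma zero_in_ell2_ball: "(\<lambda>_. 0) \<in> {c \<in> ell2 A. ell2_norm A c \<le> 1}"
  by (simp add: ell2_def ell2_norm_def)

lemma norm_sum_mult_sq_le:
  fixes a b :: "'a \<Rightarrow> complex"
  shows "(norm (\<Sum>i\<in>S. a i * b i))\<^sup>2 \<le> (\<Sum>i\<in>S. (norm (a i))\<^sup>2) * (\<Sum>i\<in>S. (norm (b i))\<^sup>2)"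
proof -
  have "norm (\<Sum>i\<in>S. a i * b i) \<le> (\<Sum>i\<in>S. norm (a i) * norm (b i))"
    by (rule order_trans[OF norm_sum]) (simp add: norm_mult)
  then have "(norm (\<Sum>i\<in>S. a i * b i))\<^sup>2 \<le> (\<Sum>i\<in>S. norm (a i) * norm (b i))\<^sup>2"
    by (intro power_mono) auto
  also have "\<dots> \<le> (\<Sum>i\<in>S. (norm (a i))\<^sup>2) * (\<Sum>i\<in>S. (norm (b i))\<^sup>2)"
    by (rule Cauchy_Schwarz_ineq_sum)
  finally show ?thesis .
qed

section \<open>Algebraic elements in the regular representations\<close>

context discrete_hyp_group
begin

definition supp :: "'n coeffs \<Rightarrow> (real ^ 'n \<Rightarrow> real ^ 'n) set" where
  "supp f = {g \<in> \<Gamma>. \<exists>\<xi>\<in>limit_set \<Gamma>. f g \<xi> \<noteq> 0}"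

lemma alg_crossed_productD:
  assumes "f \<in> alg_crossed_product \<Gamma>"
  shows "g \<in> \<Gamma> \<Longrightarrow> continuous_on (limit_set \<Gamma>) (f g)" and "finite (supp f)"
  using assms by (auto simp: alg_crossed_product_def supp_def)

lemma supp_subset: "supp f \<subseteq> \<Gamma>"
  by (auto simp: supp_def)

lemma zero_outside_supp: "g \<in> \<Gamma> - supp f \<Longrightarrow> \<xi> \<in> limit_set \<Gamma> \<Longrightarrow> f g \<xi> = 0"
  by (auto simp: supp_def)

lemma alg_crossed_product_diff:
  assumes "f \<in> alg_crossed_product \<Gamma>" "f' \<in> alg_crossed_product \<Gamma>"
  shows "(\<lambda>g \<xi>. f g \<xi> - f' g \<xi>) \<in> alg_crossed_product \<Gamma>"
proof -
  have "supp (\<lambda>g \<xi>. f g \<xi> - f' g \<xi>) \<subseteq> supp f \<union> supp f'" by (auto simp: supp_def)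
  then have "finite (supp (\<lambda>g \<xi>. f g \<xi> - f' g \<xi>))"
    using alg_crossed_productD(2)[OF assms(1)] alg_crossed_productD(2)[OF assms(2)]
    by (meson finite_UnI finite_subset)
  then show ?thesis
    using alg_crossed_productD(1)[OF assms(1)] alg_crossed_productD(1)[OF assms(2)]
    by (auto simp: alg_crossed_product_def supp_def intro!: continuous_on_diff)
qed

lemma comp_inv_cancel:
  assumes "g \<in> \<Gamma>" "h \<in> \<Gamma>"
  shows "inv_fun (h \<circ> inv_fun g) \<circ> h = g" "h \<circ> inv_fun (inv_fun g \<circ> h) = g"
proof -
  have "bij g" "bij h"
    using permutes_bij hyp_isometryD(1)[OF hyp_isometry] assms by blast+
  then have "inv_fun (h \<circ> inv_fun g) = g \<circ> inv_fun h" "inv_fun (inv_fun g \<circ> h) = inv_fun h \<circ> g"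
    using o_inv_distrib[of h "inv_fun g"] o_inv_distrib[of "inv_fun g" h]
    by (simp_all add: bij_imp_bij_inv inv_inv_eq)
  then show "inv_fun (h \<circ> inv_fun g) \<circ> h = g" "h \<circ> inv_fun (inv_fun g \<circ> h) = g"
    using comp_inv[OF assms(2)] by (simp_all add: comp_assoc flip: comp_assoc[of h])
qed

text \<open>Substituting \<open>\<gamma> \<circ> inv_fun g\<close> for the summation variable turns
  the coefficient index into \<open>g\<close>, so finite support leaves a finite sum of translates
  of \<open>c\<close>.\<close>

lemma regular_rep_eq:
  assumes f: "f \<in> alg_crossed_product \<Gamma>" and \<gamma>: "\<gamma> \<in> \<Gamma>" and \<xi>: "\<xi> \<in> limit_set \<Gamma>"
  shows "regular_rep \<Gamma> \<xi> f c \<gamma> = (\<Sum>g\<in>supp f. f g (bdry_act (inv_fun \<gamma>) \<xi>) * c (\<gamma> \<circ> inv_fun g))"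
proof -
  let ?\<eta> = "bdry_act (inv_fun \<gamma>) \<xi>"
  have \<eta>: "?\<eta> \<in> limit_set \<Gamma>" by (rule bdry_act_limit_set[OF inv_closed[OF \<gamma>] \<xi>])
  have bij: "bij_betw (\<lambda>g. \<gamma> \<circ> inv_fun g) \<Gamma> \<Gamma>"
  proof (rule bij_betw_byWitness[where f' = "\<lambda>h. inv_fun h \<circ> \<gamma>"])
    show "\<forall>g\<in>\<Gamma>. inv_fun (\<gamma> \<circ> inv_fun g) \<circ> \<gamma> = g" using comp_inv_cancel(1) \<gamma> by blast
    show "\<forall>h\<in>\<Gamma>. \<gamma> \<circ> inv_fun (inv_fun h \<circ> \<gamma>) = h" using comp_inv_cancel(2) \<gamma> by blast
  qed (use \<gamma> comp_closed inv_closed in auto)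
  have "regular_rep \<Gamma> \<xi> f c \<gamma> = (\<Sum>\<^sub>\<infinity>h\<in>\<Gamma>. f (inv_fun h \<circ> \<gamma>) ?\<eta> * c h)"
    unfolding regular_rep_def by (intro infsum_cong) (simp add: m_inv_eq \<gamma>)
  also have "\<dots> = (\<Sum>\<^sub>\<infinity>g\<in>\<Gamma>. f (inv_fun (\<gamma> \<circ> inv_fun g) \<circ> \<gamma>) ?\<eta> * c (\<gamma> \<circ> inv_fun g))"
    by (rule infsum_reindex_bij_betw[OF bij, symmetric])
  also have "\<dots> = (\<Sum>\<^sub>\<infinity>g\<in>\<Gamma>. f g ?\<eta> * c (\<gamma> \<circ> inv_fun g))"
    by (intro infsum_cong) (simp add: comp_inv_cancel(1) \<gamma>)
  also have "\<dots> = (\<Sum>\<^sub>\<infinity>g\<in>supp f. f g ?\<eta> * c (\<gamma> \<circ> inv_fun g))"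
    using supp_subset by (intro infsum_cong_neutral) (auto simp: zero_outside_supp[OF _ \<eta>])
  finally show ?thesis using alg_crossed_productD(2)[OF f] by simp
qed

lemma inj_on_comp_inv:
  assumes "g \<in> \<Gamma>"
  shows "inj_on (\<lambda>\<gamma>. \<gamma> \<circ> inv_fun g) \<Gamma>"
proof (rule inj_onI)
  fix \<gamma> \<gamma>' assume "\<gamma> \<circ> inv_fun g = \<gamma>' \<circ> inv_fun g"
  then have "\<gamma> \<circ> inv_fun g \<circ> g = \<gamma>' \<circ> inv_fun g \<circ> g" by simp
  then show "\<gamma> = \<gamma>'" by (simp add: comp_assoc comp_inv[OF assms])
qed

text \<open>The bound makes the suprema in \<open>reduced_norm\<close> meaningful, since a real
  supremum tells nothing about an unbounded set. Cauchy-Schwarz over the finite support contributes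
  \<open>M\<close>; each translate of \<open>c\<close> is no longer than \<open>c\<close> by
  injectivity, which contributes the factor \<open>card (supp f)\<close> in
  \<open>K\<close>.\<close>

lemma regular_rep_bounded:
  assumes f: "f \<in> alg_crossed_product \<Gamma>"
  obtains B where "\<And>\<xi> c. \<xi> \<in> limit_set \<Gamma> \<Longrightarrow> c \<in> ell2 \<Gamma> \<Longrightarrow> regular_rep \<Gamma> \<xi> f c \<in> ell2 \<Gamma>"
    and "\<And>\<xi> c. \<xi> \<in> limit_set \<Gamma> \<Longrightarrow> c \<in> ell2 \<Gamma> \<Longrightarrow> ell2_norm \<Gamma> c \<le> 1
           \<Longrightarrow> ell2_norm \<Gamma> (regular_rep \<Gamma> \<xi> f c) \<le> B"
proof -
  have "\<exists>b. \<forall>\<xi>\<in>limit_set \<Gamma>. norm (f g \<xi>) \<le> b" if "g \<in> \<Gamma>" for g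
  proof -
    have "bounded (f g ` limit_set \<Gamma>)"
      by (intro compact_imp_bounded compact_continuous_image compact_limit_set
          alg_crossed_productD(1)[OF f that])
    then show ?thesis by (auto simp: bounded_iff)
  qed
  then obtain b where b: "\<And>g \<xi>. g \<in> \<Gamma> \<Longrightarrow> \<xi> \<in> limit_set \<Gamma> \<Longrightarrow> norm (f g \<xi>) \<le> b g" by metis
  define M where "M = (\<Sum>g\<in>supp f. (b g)\<^sup>2)"
  define K where "K = M * card (supp f)"
  have M0: "0 \<le> M" by (simp add: M_def sum_nonneg)
  have bound: "(\<Sum>\<gamma>\<in>T. (cmod (regular_rep \<Gamma> \<xi> f c \<gamma>))\<^sup>2) \<le> K * (ell2_norm \<Gamma> c)\<^sup>2"
    if \<xi>: "\<xi> \<in> limit_set \<Gamma>" and c: "c \<in> ell2 \<Gamma>" and T: "finite T" "T \<subseteq> \<Gamma>" for \<xi> c T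
  proof -
    have "(cmod (regular_rep \<Gamma> \<xi> f c \<gamma>))\<^sup>2 \<le> M * (\<Sum>g\<in>supp f. (cmod (c (\<gamma> \<circ> inv_fun g)))\<^sup>2)"
      if \<gamma>: "\<gamma> \<in> T" for \<gamma>
    proof -
      have \<eta>: "bdry_act (inv_fun \<gamma>) \<xi> \<in> limit_set \<Gamma>"
        using bdry_act_limit_set[OF inv_closed \<xi>] \<gamma> T(2) by blast
      have "(\<Sum>g\<in>supp f. (cmod (f g (bdry_act (inv_fun \<gamma>) \<xi>)))\<^sup>2) \<le> M"
        unfolding M_def using b[OF _ \<eta>] supp_subset by (intro sum_mono power_mono) auto
      then have "(\<Sum>g\<in>supp f. (cmod (f g (bdry_act (inv_fun \<gamma>) \<xi>)))\<^sup>2)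
            * (\<Sum>g\<in>supp f. (cmod (c (\<gamma> \<circ> inv_fun g)))\<^sup>2)
          \<le> M * (\<Sum>g\<in>supp f. (cmod (c (\<gamma> \<circ> inv_fun g)))\<^sup>2)"
        by (intro mult_right_mono sum_nonneg) auto
      then show ?thesis
        using norm_sum_mult_sq_le[of "\<lambda>g. f g (bdry_act (inv_fun \<gamma>) \<xi>)" "\<lambda>g. c (\<gamma> \<circ> inv_fun g)" "supp f"]
          regular_rep_eq[OF f _ \<xi>, of \<gamma> c] \<gamma> T(2) by auto
    qed
    then have "(\<Sum>\<gamma>\<in>T. (cmod (regular_rep \<Gamma> \<xi> f c \<gamma>))\<^sup>2)
        \<le> (\<Sum>\<gamma>\<in>T. M * (\<Sum>g\<in>supp f. (cmod (c (\<gamma> \<circ> inv_fun g)))\<^sup>2))"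
      by (rule sum_mono)
    also have "\<dots> = M * (\<Sum>g\<in>supp f. \<Sum>\<gamma>\<in>T. (cmod (c (\<gamma> \<circ> inv_fun g)))\<^sup>2)"
      unfolding sum_distrib_left[symmetric] by (subst sum.swap) (rule refl)
    also have "\<dots> \<le> M * (\<Sum>g\<in>supp f. (ell2_norm \<Gamma> c)\<^sup>2)"
    proof (intro mult_left_mono sum_mono M0)
      fix g assume "g \<in> supp f"
      then have g: "g \<in> \<Gamma>" using supp_subset by blast
      have "(\<Sum>\<gamma>\<in>T. (cmod (c (\<gamma> \<circ> inv_fun g)))\<^sup>2) = (\<Sum>\<gamma>\<in>(\<lambda>\<gamma>. \<gamma> \<circ> inv_fun g) ` T. (cmod (c \<gamma>))\<^sup>2)"
        by (subst sum.reindex) (auto intro: inj_on_subset[OF inj_on_comp_inv[OF g] T(2)])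
      also have "\<dots> \<le> (ell2_norm \<Gamma> c)\<^sup>2"
        using T g comp_closed inv_closed by (intro finite_sum_le_ell2_norm_sq c) auto
      finally show "(\<Sum>\<gamma>\<in>T. (cmod (c (\<gamma> \<circ> inv_fun g)))\<^sup>2) \<le> (ell2_norm \<Gamma> c)\<^sup>2" .
    qed
    finally show ?thesis by (simp add: K_def ac_simps)
  qed
  show ?thesis
  proof
    fix \<xi> c assume \<xi>: "\<xi> \<in> limit_set \<Gamma>" and c: "c \<in> ell2 \<Gamma>"
    have "(\<lambda>\<gamma>. (cmod (regular_rep \<Gamma> \<xi> f c \<gamma>))\<^sup>2) summable_on \<Gamma>"
      using bound[OF \<xi> c] by (intro nonneg_bdd_above_summable_on bdd_aboveI2) auto
    then show mem: "regular_rep \<Gamma> \<xi> f c \<in> ell2 \<Gamma>" by (simp add: ell2_def)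
    assume le1: "ell2_norm \<Gamma> c \<le> 1"
    have K0: "0 \<le> K" using M0 by (simp add: K_def)
    have "(ell2_norm \<Gamma> (regular_rep \<Gamma> \<xi> f c))\<^sup>2 \<le> K * (ell2_norm \<Gamma> c)\<^sup>2"
      unfolding ell2_norm_sq[of _ "regular_rep \<Gamma> \<xi> f c"]
      using mem bound[OF \<xi> c] by (intro infsum_le_finite_sums) (auto simp: ell2_def)
    also have "\<dots> \<le> K * 1\<^sup>2"
      using le1 ell2_norm_nonneg[of \<Gamma> c] by (intro mult_left_mono power_mono K0)
    finally show "ell2_norm \<Gamma> (regular_rep \<Gamma> \<xi> f c) \<le> sqrt K"
      by (intro real_le_rsqrt) simp
  qed
qed

lemma regular_rep_le_reduced_norm:
  assumes f: "f \<in> alg_crossed_product \<Gamma>" and \<xi>: "\<xi> \<in> limit_set \<Gamma>"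
    and c: "c \<in> ell2 \<Gamma>" "ell2_norm \<Gamma> c \<le> 1"
  shows "regular_rep \<Gamma> \<xi> f c \<in> ell2 \<Gamma>"
    and "ell2_norm \<Gamma> (regular_rep \<Gamma> \<xi> f c) \<le> reduced_norm \<Gamma> f"
proof -
  let ?U = "{c \<in> ell2 \<Gamma>. ell2_norm \<Gamma> c \<le> 1}"
  obtain B where mem: "\<And>\<xi> c. \<xi> \<in> limit_set \<Gamma> \<Longrightarrow> c \<in> ell2 \<Gamma> \<Longrightarrow> regular_rep \<Gamma> \<xi> f c \<in> ell2 \<Gamma>"
    and B: "\<And>\<xi> c. \<xi> \<in> limit_set \<Gamma> \<Longrightarrow> c \<in> ell2 \<Gamma> \<Longrightarrow> ell2_norm \<Gamma> c \<le> 1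
           \<Longrightarrow> ell2_norm \<Gamma> (regular_rep \<Gamma> \<xi> f c) \<le> B"
    using regular_rep_bounded[OF f] by blast
  show "regular_rep \<Gamma> \<xi> f c \<in> ell2 \<Gamma>" by (rule mem[OF \<xi> c(1)])
  have ne: "?U \<noteq> {}" using zero_in_ell2_ball by blast
  have "ell2_norm \<Gamma> (regular_rep \<Gamma> \<xi> f c) \<le> (SUP c\<in>?U. ell2_norm \<Gamma> (regular_rep \<Gamma> \<xi> f c))"
    using B[OF \<xi>] c by (intro cSUP_upper bdd_aboveI2) auto
  also have "\<dots> \<le> reduced_norm \<Gamma> f"
    unfolding reduced_norm_def
  proof (rule cSUP_upper[OF \<xi>], rule bdd_aboveI2)
    fix \<xi> assume "\<xi> \<in> limit_set \<Gamma>"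
    then show "(SUP c\<in>?U. ell2_norm \<Gamma> (regular_rep \<Gamma> \<xi> f c)) \<le> B"
      using B by (intro cSUP_least ne) auto
  qed
  finally show "ell2_norm \<Gamma> (regular_rep \<Gamma> \<xi> f c) \<le> reduced_norm \<Gamma> f" .
qed

text \<open>A point of the limit set is at hand because the supremum over an empty set would be an
  unspecified real number.\<close>

lemma reduced_norm_nonneg:
  assumes "f \<in> alg_crossed_product \<Gamma>" "\<xi> \<in> limit_set \<Gamma>"
  shows "0 \<le> reduced_norm \<Gamma> f"
  using regular_rep_le_reduced_norm(2)[OF assms, of "\<lambda>_. 0"] zero_in_ell2_ball[of \<Gamma>]
    ell2_norm_nonneg order_trans by blast

text \<open>Apply the representation to the unit vector at the identity; its image is this
  column.\<close>

lemma column_bound_alg: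
  assumes f: "f \<in> alg_crossed_product \<Gamma>" and \<xi>: "\<xi> \<in> limit_set \<Gamma>" and T: "finite T" "T \<subseteq> \<Gamma>"
  shows "(\<Sum>g\<in>T. (cmod (f g (bdry_act (inv_fun g) \<xi>)))\<^sup>2) \<le> (reduced_norm \<Gamma> f)\<^sup>2"
proof -
  define c :: "(real ^ 'n \<Rightarrow> real ^ 'n) \<Rightarrow> complex" where "c \<gamma> = (if \<gamma> = id then 1 else 0)" for \<gamma>
  have hs: "((\<lambda>\<gamma>. (cmod (c \<gamma>))\<^sup>2) has_sum 1) \<Gamma>"
    by (rule has_sum_finite_neutralI[where B = "{id}"]) (auto simp: c_def id_in)
  have c: "c \<in> ell2 \<Gamma>" "ell2_norm \<Gamma> c \<le> 1"
    using has_sum_imp_summable[OF hs] infsumI[OF hs] by (auto simp: ell2_def ell2_norm_def)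
  have "regular_rep \<Gamma> \<xi> f c g = f g (bdry_act (inv_fun g) \<xi>)" if g: "g \<in> \<Gamma>" for g
  proof -
    have "regular_rep \<Gamma> \<xi> f c g = (\<Sum>\<^sub>\<infinity>h\<in>{id :: real ^ 'n \<Rightarrow> real ^ 'n}. f g (bdry_act (inv_fun g) \<xi>))"
      unfolding regular_rep_def
      by (rule infsum_cong_neutral) (auto simp: c_def id_in m_inv_eq g)
    then show ?thesis by simp
  qed
  then have "(\<Sum>g\<in>T. (cmod (f g (bdry_act (inv_fun g) \<xi>)))\<^sup>2) = (\<Sum>g\<in>T. (cmod (regular_rep \<Gamma> \<xi> f c g))\<^sup>2)"
    using T by (intro sum.cong) auto
  also have "\<dots> \<le> (ell2_norm \<Gamma> (regular_rep \<Gamma> \<xi> f c))\<^sup>2"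
    by (rule finite_sum_le_ell2_norm_sq[OF regular_rep_le_reduced_norm(1)[OF f \<xi> c] T])
  also have "\<dots> \<le> (reduced_norm \<Gamma> f)\<^sup>2"
    by (rule power_mono[OF regular_rep_le_reduced_norm(2)[OF f \<xi> c] ell2_norm_nonneg])
  finally show ?thesis .
qed

text \<open>Test with the conjugate of the row, normalized to length 1: the image then has the
  length of the row as its entry at the identity.\<close>

lemma row_bound_alg:
  assumes f: "f \<in> alg_crossed_product \<Gamma>" and \<xi>: "\<xi> \<in> limit_set \<Gamma>" and T: "finite T" "T \<subseteq> \<Gamma>"
  shows "(\<Sum>g\<in>T. (cmod (f g \<xi>))\<^sup>2) \<le> (reduced_norm \<Gamma> f)\<^sup>2"
proof -
  note fin = alg_crossed_productD(2)[OF f]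
  define N where "N = (\<Sum>g\<in>supp f. (cmod (f g \<xi>))\<^sup>2)"
  have "(\<Sum>g\<in>T. (cmod (f g \<xi>))\<^sup>2) \<le> (\<Sum>g\<in>T \<union> supp f. (cmod (f g \<xi>))\<^sup>2)"
    using T fin by (intro sum_mono2) auto
  also have "\<dots> = N"
    unfolding N_def using T fin zero_outside_supp[OF _ \<xi>] by (intro sum.mono_neutral_right) auto
  also have "N \<le> (reduced_norm \<Gamma> f)\<^sup>2"
  proof (cases "N = 0")
    case False
    then have N: "0 < N" by (simp add: N_def sum_nonneg order_less_le)
    \<comment> \<open>The inverse appears because the entry at the identity pairs
      \<open>f g \<xi>\<close> with the value of \<open>c\<close> at
      \<open>inv_fun g\<close>.\<close>
    define c where "c \<gamma> = cnj (f (inv_fun \<gamma>) \<xi>) / complex_of_real (sqrt N)" for \<gamma>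
    have cc: "(cmod (c (inv_fun g)))\<^sup>2 = (cmod (f g \<xi>))\<^sup>2 / N" if "g \<in> \<Gamma>" for g
      using N inv_inv[OF that] by (simp add: c_def norm_divide power_divide)
    have "((\<lambda>g. (cmod (c (inv_fun g)))\<^sup>2) has_sum 1) \<Gamma>"
    proof (rule has_sum_finite_neutralI[where B = "supp f"])
      have "(\<Sum>g\<in>supp f. (cmod (c (inv_fun g)))\<^sup>2) = (\<Sum>g\<in>supp f. (cmod (f g \<xi>))\<^sup>2 / N)"
        using cc supp_subset by (intro sum.cong) auto
      also have "\<dots> = 1" using N by (simp add: N_def flip: sum_divide_distrib)
      finally show "1 = (\<Sum>g\<in>supp f. (cmod (c (inv_fun g)))\<^sup>2)" by simp
    qed (use fin supp_subset cc zero_outside_supp[OF _ \<xi>] in auto)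
    then have hs: "((\<lambda>\<gamma>. (cmod (c \<gamma>))\<^sup>2) has_sum 1) \<Gamma>"
      using has_sum_reindex_bij_betw[OF bij_betw_inv, of "\<lambda>\<gamma>. (cmod (c \<gamma>))\<^sup>2"] by simp
    have c: "c \<in> ell2 \<Gamma>" "ell2_norm \<Gamma> c \<le> 1"
      using has_sum_imp_summable[OF hs] infsumI[OF hs] by (auto simp: ell2_def ell2_norm_def)
    have "regular_rep \<Gamma> \<xi> f c id = (\<Sum>g\<in>supp f. f g \<xi> * c (inv_fun g))"
      unfolding regular_rep_eq[OF f id_in \<xi>] by (simp add: bdry_act_id[OF \<xi>])
    also have "\<dots> = (\<Sum>g\<in>supp f. complex_of_real ((cmod (f g \<xi>))\<^sup>2 / sqrt N))"
    proof (rule sum.cong[OF refl])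
      fix g assume "g \<in> supp f"
      then have "g \<in> \<Gamma>" using supp_subset by blast
      then show "f g \<xi> * c (inv_fun g) = complex_of_real ((cmod (f g \<xi>))\<^sup>2 / sqrt N)"
        using complex_norm_square[of "f g \<xi>"] by (simp add: c_def inv_inv)
    qed
    also have "\<dots> = complex_of_real (N / sqrt N)"
      by (simp add: N_def sum_divide_distrib)
    finally have rep: "regular_rep \<Gamma> \<xi> f c id = complex_of_real (sqrt N)"
      using N by (simp add: real_div_sqrt)
    have "N = (\<Sum>\<gamma>\<in>{id}. (cmod (regular_rep \<Gamma> \<xi> f c \<gamma>))\<^sup>2)" using N by (simp add: rep)
    also have "\<dots> \<le> (ell2_norm \<Gamma> (regular_rep \<Gamma> \<xi> f c))\<^sup>2"
      using id_in by (intro finite_sum_le_ell2_norm_sq regular_rep_le_reduced_norm(1)[OF f \<xi> c]) auto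
    also have "\<dots> \<le> (reduced_norm \<Gamma> f)\<^sup>2"
      by (rule power_mono[OF regular_rep_le_reduced_norm(2)[OF f \<xi> c] ell2_norm_nonneg])
    finally show ?thesis .
  qed simp
  finally show ?thesis .
qed

section \<open>Passage from algebraic elements to the completion\<close>

lemma reduced_crossed_product_continuous:
  assumes f: "f \<in> reduced_crossed_product \<Gamma>" and g: "g \<in> \<Gamma>"
  shows "continuous_on (limit_set \<Gamma>) (f g)"
proof -
  obtain a where a: "\<And>k. a k \<in> alg_crossed_product \<Gamma>"
    "\<And>g. g \<in> \<Gamma> \<Longrightarrow> uniform_limit (limit_set \<Gamma>) (\<lambda>k. a k g) (f g) sequentially"
    using f unfolding reduced_crossed_product_def by blast
  show ?thesis
    by (rule uniform_limit_theorem[OF _ a(2)[OF g]])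
       (auto intro: always_eventually alg_crossed_productD(1)[OF a(1) g])
qed

text \<open>Finite sums of squares pass to pointwise limits of coefficients, so a bound uniform
  along the Cauchy sequence is enough. It comes from comparison with one member \<open>a N\<close>,
  coefficient by coefficient; only norms of algebraic elements enter.\<close>

lemma reduced_crossed_product_bounds:
  assumes f: "f \<in> reduced_crossed_product \<Gamma>"
  obtains C where
    "\<And>\<xi> T. \<xi> \<in> limit_set \<Gamma> \<Longrightarrow> finite T \<Longrightarrow> T \<subseteq> \<Gamma> \<Longrightarrow> (\<Sum>g\<in>T. (cmod (f g \<xi>))\<^sup>2) \<le> C"
    "\<And>\<xi> T. \<xi> \<in> limit_set \<Gamma> \<Longrightarrow> finite T \<Longrightarrow> T \<subseteq> \<Gamma>
       \<Longrightarrow> (\<Sum>g\<in>T. (cmod (f g (bdry_act (inv_fun g) \<xi>)))\<^sup>2) \<le> C"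
proof -
  obtain a where a: "\<And>k. a k \<in> alg_crossed_product \<Gamma>"
    and cauchy: "\<And>\<epsilon>. 0 < \<epsilon> \<Longrightarrow>
      \<exists>N. \<forall>j\<ge>N. \<forall>k\<ge>N. reduced_norm \<Gamma> (\<lambda>g \<xi>. a j g \<xi> - a k g \<xi>) < \<epsilon>"
    and lim: "\<And>g. g \<in> \<Gamma> \<Longrightarrow> uniform_limit (limit_set \<Gamma>) (\<lambda>k. a k g) (f g) sequentially"
    using f unfolding reduced_crossed_product_def by blast
  obtain N where N: "\<And>k. N \<le> k \<Longrightarrow> reduced_norm \<Gamma> (\<lambda>g \<xi>. a k g \<xi> - a N g \<xi>) < 1"
    using cauchy[of 1] by auto
  define C where "C = 2 + 2 * (reduced_norm \<Gamma> (a N))\<^sup>2"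
  \<comment> \<open>Rows and columns at once: \<open>p g\<close> is \<xi> for the row and
    \<open>bdry_act (inv_fun g) \<xi>\<close> for the column.\<close>
  have step: "(\<Sum>g\<in>T. (cmod (f g (p g)))\<^sup>2) \<le> C"
    if T: "finite T" "T \<subseteq> \<Gamma>" and p: "\<And>g. g \<in> T \<Longrightarrow> p g \<in> limit_set \<Gamma>" and \<xi>: "\<xi> \<in> limit_set \<Gamma>"
      and bound: "\<And>q. q \<in> alg_crossed_product \<Gamma>
        \<Longrightarrow> (\<Sum>g\<in>T. (cmod (q g (p g)))\<^sup>2) \<le> (reduced_norm \<Gamma> q)\<^sup>2" for T p \<xi>
  proof (rule tendsto_upperbound)
    show "(\<lambda>k. \<Sum>g\<in>T. (cmod (a k g (p g)))\<^sup>2) \<longlonglongrightarrow> (\<Sum>g\<in>T. (cmod (f g (p g)))\<^sup>2)"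
      using tendsto_uniform_limitI[OF lim p] T by (intro tendsto_intros) auto
    have "(\<Sum>g\<in>T. (cmod (a k g (p g)))\<^sup>2) \<le> C" if k: "N \<le> k" for k
    proof -
      have d: "(\<lambda>g \<xi>. a k g \<xi> - a N g \<xi>) \<in> alg_crossed_product \<Gamma>"
        by (rule alg_crossed_product_diff[OF a a])
      have "(cmod (a k g (p g)))\<^sup>2
          \<le> 2 * (cmod (a k g (p g) - a N g (p g)))\<^sup>2 + 2 * (cmod (a N g (p g)))\<^sup>2" for g
      proof -
        have "cmod (a k g (p g)) \<le> cmod (a k g (p g) - a N g (p g)) + cmod (a N g (p g))"
          using norm_triangle_ineq[of "a k g (p g) - a N g (p g)" "a N g (p g)"] by simp
        then have "(cmod (a k g (p g)))\<^sup>2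
            \<le> (cmod (a k g (p g) - a N g (p g)) + cmod (a N g (p g)))\<^sup>2"
          by (intro power_mono) auto
        also have "\<dots> \<le> 2 * (cmod (a k g (p g) - a N g (p g)))\<^sup>2 + 2 * (cmod (a N g (p g)))\<^sup>2"
          using sum_squares_bound[of "cmod (a k g (p g) - a N g (p g))" "cmod (a N g (p g))"]
          by (simp add: power2_sum)
        finally show ?thesis .
      qed
      then have "(\<Sum>g\<in>T. (cmod (a k g (p g)))\<^sup>2)
          \<le> 2 * (\<Sum>g\<in>T. (cmod (a k g (p g) - a N g (p g)))\<^sup>2) + 2 * (\<Sum>g\<in>T. (cmod (a N g (p g)))\<^sup>2)"
        by (simp add: sum_distrib_left flip: sum.distrib) (rule sum_mono)
      also have "\<dots> \<le> 2 * 1\<^sup>2 + 2 * (reduced_norm \<Gamma> (a N))\<^sup>2"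
      proof (intro add_mono mult_left_mono)
        have "(\<Sum>g\<in>T. (cmod (a k g (p g) - a N g (p g)))\<^sup>2)
            \<le> (reduced_norm \<Gamma> (\<lambda>g \<xi>. a k g \<xi> - a N g \<xi>))\<^sup>2"
          using bound[OF d] by simp
        also have "\<dots> \<le> 1\<^sup>2"
          using N[OF k] reduced_norm_nonneg[OF d \<xi>] by (intro power_mono) auto
        finally show "(\<Sum>g\<in>T. (cmod (a k g (p g) - a N g (p g)))\<^sup>2) \<le> 1\<^sup>2" .
      qed (use bound[OF a] in auto)
      finally show ?thesis by (simp add: C_def)
    qed
    then show "\<forall>\<^sub>F k in sequentially. (\<Sum>g\<in>T. (cmod (a k g (p g)))\<^sup>2) \<le> C"
      using eventually_ge_at_top[of N] by (rule eventually_mono[rotated])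
  qed simp
  show ?thesis
  proof
    fix \<xi> T assume \<xi>: "\<xi> \<in> limit_set \<Gamma>" and T: "finite T" "T \<subseteq> \<Gamma>"
    show "(\<Sum>g\<in>T. (cmod (f g \<xi>))\<^sup>2) \<le> C"
      by (rule step[OF T _ \<xi>]) (use \<xi> row_bound_alg[OF _ \<xi> T] in auto)
    show "(\<Sum>g\<in>T. (cmod (f g (bdry_act (inv_fun g) \<xi>)))\<^sup>2) \<le> C"
      by (rule step[OF T _ \<xi>])
         (use bdry_act_limit_set[OF inv_closed \<xi>] T column_bound_alg[OF _ \<xi> T] in auto)
  qed
qed

lemma cp_mult_one:
  "cp_mult \<Gamma> p q id \<xi> = (\<Sum>\<^sub>\<infinity>g\<in>\<Gamma>. p g \<xi> * q (inv_fun g) (bdry_act g \<xi>))"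
proof -
  let ?P = "{(g, g') \<in> \<Gamma> \<times> \<Gamma>. g \<otimes>\<^bsub>Isom_plus\<^esub> g' = id}"
  have "g' = inv_fun g" if "g \<in> \<Gamma>" "g' \<in> \<Gamma>" "g' \<circ> g = id" for g g'
    using that comp_inv[OF that(1)] by (metis comp_assoc comp_id id_comp)
  then have "bij_betw (\<lambda>g. (g, inv_fun g)) \<Gamma> ?P"
    by (intro bij_betw_byWitness[where f' = fst]) (auto simp: inv_closed comp_inv)
  from infsum_reindex_bij_betw[OF this, of "\<lambda>(g, g'). p g \<xi> * q g' (bdry_act g \<xi>)"]
  show ?thesis by (simp add: cp_mult_def)
qed

end

section \<open>The KMS condition\<close>

context discrete_hyp_group
begin

lemma busemann_diff_swap:
  assumes "y \<in> hyp_space" "y' \<in> hyp_space" "\<xi> \<in> limit_set \<Gamma>"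
  shows "busemann_diff y y' \<xi> = - busemann_diff y' y \<xi>"
proof -
  have "\<xi> \<in> sphere_at_infinity" using assms(3) limit_set_subset_sphere by blast
  then show ?thesis using assms by (simp add: busemann_diff_eq)
qed

text \<open>Turns the phase of the flow at the index \<open>inv_fun g\<close> and the point \<xi> g
  into the phase of -D(x, x g^-1, \<xi>), which explains the minus sign in the exponentials
  below.\<close>

lemma busemann_diff_shift:
  assumes g: "g \<in> \<Gamma>" and y: "y \<in> hyp_space" and \<xi>: "\<xi> \<in> limit_set \<Gamma>"
  shows "busemann_diff y (g y) (bdry_act g \<xi>) = - busemann_diff y (inv_fun g y) \<xi>"
proof -
  have y': "inv_fun g y \<in> hyp_space" by (rule hyp_space_image[OF inv_closed[OF g] y])
  have "busemann_diff y (g y) (bdry_act g \<xi>) = busemann_diff (inv_fun g y) y \<xi>"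
    using busemann_diff_equivariant[OF g y' y \<xi>]
    by (simp add: hyp_isometry_inv_apply[OF hyp_isometry[OF g]])
  then show ?thesis using busemann_diff_swap[OF y' y \<xi>] by simp
qed

text \<open>The \<open>g\<close>-th summand of the identity coefficient of f f'. Evaluated at \<xi>
  g^-1 it is the summand of f' f with index g^-1, so a single family serves both orders of the
  product.\<close>

definition crossed_term :: "'n coeffs \<Rightarrow> 'n coeffs \<Rightarrow> 'n coeffs" where
  "crossed_term f f' g \<xi> = f g \<xi> * f' (inv_fun g) (bdry_act g \<xi>)"

lemma continuous_on_crossed_term:
  assumes f: "f \<in> reduced_crossed_product \<Gamma>" and f': "f' \<in> reduced_crossed_product \<Gamma>"
    and g: "g \<in> \<Gamma>"
  shows "continuous_on (limit_set \<Gamma>) (crossed_term f f' g)"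
  unfolding crossed_term_def
proof (rule continuous_on_mult[OF reduced_crossed_product_continuous[OF f g]])
  show "continuous_on (limit_set \<Gamma>) (\<lambda>\<xi>. f' (inv_fun g) (bdry_act g \<xi>))"
    by (rule continuous_on_compose2[OF
          reduced_crossed_product_continuous[OF f' inv_closed[OF g]] continuous_on_bdry_act[OF g]])
       (use bdry_act_limit_set[OF g] in blast)
qed

text \<open>The inequality 2ab \<le> a^2 + b^2 pairs the row of \<open>f\<close> with the column of
  \<open>f'\<close> in the first bound, and the column of \<open>f\<close> with the row of
  \<open>f'\<close> in the second; inversion of the index matches them.\<close>

lemma crossed_term_bound:
  assumes f: "f \<in> reduced_crossed_product \<Gamma>" and f': "f' \<in> reduced_crossed_product \<Gamma>"
  obtains C where
    "\<And>\<xi> T. \<xi> \<in> limit_set \<Gamma> \<Longrightarrow> finite T \<Longrightarrow> T \<subseteq> \<Gamma> \<Longrightarrow> (\<Sum>g\<in>T. cmod (crossed_term f f' g \<xi>)) \<le> C"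
    "\<And>\<xi> T. \<xi> \<in> limit_set \<Gamma> \<Longrightarrow> finite T \<Longrightarrow> T \<subseteq> \<Gamma>
       \<Longrightarrow> (\<Sum>g\<in>T. cmod (crossed_term f f' g (bdry_act (inv_fun g) \<xi>))) \<le> C"
proof -
  obtain C where row: "\<And>\<xi> T. \<xi> \<in> limit_set \<Gamma> \<Longrightarrow> finite T \<Longrightarrow> T \<subseteq> \<Gamma> \<Longrightarrow> (\<Sum>g\<in>T. (cmod (f g \<xi>))\<^sup>2) \<le> C"
    and col: "\<And>\<xi> T. \<xi> \<in> limit_set \<Gamma> \<Longrightarrow> finite T \<Longrightarrow> T \<subseteq> \<Gamma>
       \<Longrightarrow> (\<Sum>g\<in>T. (cmod (f g (bdry_act (inv_fun g) \<xi>)))\<^sup>2) \<le> C"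
    using reduced_crossed_product_bounds[OF f] by blast
  obtain C' where row': "\<And>\<xi> T. \<xi> \<in> limit_set \<Gamma> \<Longrightarrow> finite T \<Longrightarrow> T \<subseteq> \<Gamma> \<Longrightarrow> (\<Sum>g\<in>T. (cmod (f' g \<xi>))\<^sup>2) \<le> C'"
    and col': "\<And>\<xi> T. \<xi> \<in> limit_set \<Gamma> \<Longrightarrow> finite T \<Longrightarrow> T \<subseteq> \<Gamma>
       \<Longrightarrow> (\<Sum>g\<in>T. (cmod (f' g (bdry_act (inv_fun g) \<xi>)))\<^sup>2) \<le> C'"
    using reduced_crossed_product_bounds[OF f'] by blast
  have amgm: "(\<Sum>g\<in>T. cmod (a g * b g)) \<le> ((\<Sum>g\<in>T. (cmod (a g))\<^sup>2) + (\<Sum>g\<in>T. (cmod (b g))\<^sup>2)) / 2"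
    for T and a b :: "(real ^ 'n \<Rightarrow> real ^ 'n) \<Rightarrow> complex"
  proof -
    have "cmod (a g * b g) \<le> ((cmod (a g))\<^sup>2 + (cmod (b g))\<^sup>2) / 2" for g
      using sum_squares_bound[of "cmod (a g)" "cmod (b g)"] by (simp add: norm_mult)
    then have "(\<Sum>g\<in>T. cmod (a g * b g)) \<le> (\<Sum>g\<in>T. ((cmod (a g))\<^sup>2 + (cmod (b g))\<^sup>2) / 2)"
      by (rule sum_mono)
    then show ?thesis by (simp add: sum.distrib flip: sum_divide_distrib)
  qed
  have reindex: "(\<Sum>g\<in>T. q (inv_fun g)) = (\<Sum>g\<in>inv_fun ` T. q g)" if "T \<subseteq> \<Gamma>"
    for T and q :: "(real ^ 'n \<Rightarrow> real ^ 'n) \<Rightarrow> real"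
    by (subst sum.reindex) (auto intro: inj_on_subset[OF bij_betw_imp_inj_on[OF bij_betw_inv] that])
  show ?thesis
  proof
    fix \<xi> T assume \<xi>: "\<xi> \<in> limit_set \<Gamma>" and T: "finite T" "T \<subseteq> \<Gamma>"
    then have iT: "finite (inv_fun ` T)" "inv_fun ` T \<subseteq> \<Gamma>" using inv_closed by auto
    have "(\<Sum>g\<in>T. (cmod (f' (inv_fun g) (bdry_act g \<xi>)))\<^sup>2)
        = (\<Sum>g\<in>T. (cmod (f' (inv_fun g) (bdry_act (inv_fun (inv_fun g)) \<xi>)))\<^sup>2)"
      using T(2) by (intro sum.cong) (auto simp: inv_inv)
    also have "\<dots> \<le> C'"
      using reindex[OF T(2), of "\<lambda>g. (cmod (f' g (bdry_act (inv_fun g) \<xi>)))\<^sup>2"] col'[OF \<xi> iT] by simp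
    finally show "(\<Sum>g\<in>T. cmod (crossed_term f f' g \<xi>)) \<le> (C + C') / 2"
      unfolding crossed_term_def
      by (intro order_trans[OF amgm] divide_right_mono add_mono row[OF \<xi> T]) auto
    have le: "(\<Sum>g\<in>T. (cmod (f' (inv_fun g) \<xi>))\<^sup>2) \<le> C'"
      using reindex[OF T(2), of "\<lambda>g. (cmod (f' g \<xi>))\<^sup>2"] row'[OF \<xi> iT] by simp
    have eq: "(\<Sum>g\<in>T. cmod (crossed_term f f' g (bdry_act (inv_fun g) \<xi>)))
        = (\<Sum>g\<in>T. cmod (f g (bdry_act (inv_fun g) \<xi>) * f' (inv_fun g) \<xi>))"
      unfolding crossed_term_def using T(2) bdry_act_inv(1)[OF _ \<xi>]
      by (intro sum.cong) auto
    show "(\<Sum>g\<in>T. cmod (crossed_term f f' g (bdry_act (inv_fun g) \<xi>))) \<le> (C + C') / 2"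
      unfolding eq
      by (intro order_trans[OF amgm] divide_right_mono add_mono col[OF \<xi> T] le) auto
  qed
qed

lemma cp_mult_flow_right:
  assumes x: "x \<in> hyp_space" and \<xi>: "\<xi> \<in> limit_set \<Gamma>"
  shows "cp_mult \<Gamma> f (cp_flow x t f') id \<xi>
    = (\<Sum>\<^sub>\<infinity>g\<in>\<Gamma>. crossed_term f f' g \<xi>
         * exp (- (\<i> * complex_of_real t * complex_of_real (busemann_diff x (inv_fun g x) \<xi>))))"
  unfolding cp_mult_one
proof (rule infsum_cong)
  fix g assume g: "g \<in> \<Gamma>"
  have "cp_flow x t f' (inv_fun g) (bdry_act g \<xi>)
      = exp (\<i> * complex_of_real (t * busemann_diff x (g x) (bdry_act g \<xi>))) * f' (inv_fun g) (bdry_act g \<xi>)"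
    unfolding cp_flow_def m_inv_eq[OF inv_closed[OF g]] inv_inv[OF g] ..
  then show "f g \<xi> * cp_flow x t f' (inv_fun g) (bdry_act g \<xi>) = crossed_term f f' g \<xi>
         * exp (- (\<i> * complex_of_real t * complex_of_real (busemann_diff x (inv_fun g x) \<xi>)))"
    by (simp add: busemann_diff_shift[OF g x \<xi>] crossed_term_def mult.assoc)
qed

lemma cp_mult_flow_left:
  assumes x: "x \<in> hyp_space" and \<xi>: "\<xi> \<in> limit_set \<Gamma>"
  shows "cp_mult \<Gamma> (cp_flow x t f') f id \<xi>
    = (\<Sum>\<^sub>\<infinity>g\<in>\<Gamma>. crossed_term f f' g (bdry_act (inv_fun g) \<xi>)
         * exp (- (\<i> * complex_of_real t
             * complex_of_real (busemann_diff x (inv_fun g x) (bdry_act (inv_fun g) \<xi>)))))"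
proof -
  have "cp_mult \<Gamma> (cp_flow x t f') f id \<xi>
      = (\<Sum>\<^sub>\<infinity>g\<in>\<Gamma>. cp_flow x t f' (inv_fun g) \<xi> * f (inv_fun (inv_fun g)) (bdry_act (inv_fun g) \<xi>))"
    unfolding cp_mult_one by (rule infsum_reindex_bij_betw[OF bij_betw_inv, symmetric])
  also have "\<dots> = (\<Sum>\<^sub>\<infinity>g\<in>\<Gamma>. crossed_term f f' g (bdry_act (inv_fun g) \<xi>)
         * exp (- (\<i> * complex_of_real t
             * complex_of_real (busemann_diff x (inv_fun g x) (bdry_act (inv_fun g) \<xi>)))))"
  proof (rule infsum_cong)
    fix g assume g: "g \<in> \<Gamma>"
    have "busemann_diff x (inv_fun g x) (bdry_act (inv_fun g) \<xi>) = - busemann_diff x (g x) \<xi>"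
      using busemann_diff_shift[OF inv_closed[OF g] x \<xi>] by (simp add: inv_inv[OF g])
    then show "cp_flow x t f' (inv_fun g) \<xi> * f (inv_fun (inv_fun g)) (bdry_act (inv_fun g) \<xi>)
        = crossed_term f f' g (bdry_act (inv_fun g) \<xi>) * exp (- (\<i> * complex_of_real t
             * complex_of_real (busemann_diff x (inv_fun g x) (bdry_act (inv_fun g) \<xi>))))"
      unfolding cp_flow_def m_inv_eq[OF inv_closed[OF g]] inv_inv[OF g]
      by (simp add: crossed_term_def bdry_act_inv(1)[OF g \<xi>] mult.assoc)
  qed
  finally show ?thesis .
qed

end

text \<open>Passes from bounds on unordered finite sums over the group to series along an
  enumeration.\<close>

lemma summable_if_finite_sums_le:
  fixes m :: "'a \<Rightarrow> real" and e :: "nat \<Rightarrow> 'a"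
  assumes e: "bij_betw e UNIV A" and m: "\<And>g. g \<in> A \<Longrightarrow> 0 \<le> m g"
    and K: "\<And>T. finite T \<Longrightarrow> T \<subseteq> A \<Longrightarrow> sum m T \<le> K"
  shows "summable (\<lambda>n. m (e n))"
proof (rule bounded_imp_summable)
  show "0 \<le> m (e n)" for n using bij_betwE[OF e] m by blast
  show "(\<Sum>k\<le>n. m (e k)) \<le> K" for n
  proof -
    have "(\<Sum>k\<le>n. m (e k)) = sum m (e ` {..n})"
      by (subst sum.reindex) (auto intro: inj_on_subset[OF bij_betw_imp_inj_on[OF e]])
    also have "\<dots> \<le> K" using bij_betwE[OF e] by (intro K) auto
    finally show ?thesis .
  qed
qed

section \<open>Termwise integration and the holomorphic continuation\<close>

context patterson_sullivan_measures
begin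

text \<open>\<open>D\<close> and \<phi> are bounded on the compact limit set and the measure is
  finite, so the exponential series may be integrated term by term; the resulting power series
  converges for every \<open>z\<close>.\<close>

lemma entire_exp_integral:
  fixes \<phi> :: "real ^ 'n \<Rightarrow> complex" and D :: "real ^ 'n \<Rightarrow> real"
  assumes y: "y \<in> hyp_space" and \<phi>: "continuous_on (limit_set \<Gamma>) \<phi>" and D: "continuous_on (limit_set \<Gamma>) D"
  shows "(\<lambda>z. \<integral>\<xi>. \<phi> \<xi> * exp (- (\<i> * z * complex_of_real (D \<xi>))) \<partial>\<mu> y) holomorphic_on UNIV"
proof (rule holomorphic_on_balls_imp_entire'[where c = 0], rule power_series_holomorphic)
  fix r :: real and z :: complex
  let ?d = "\<lambda>\<xi>. - (\<i> * complex_of_real (D \<xi>))"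
  define t where "t n \<xi> = \<phi> \<xi> * (?d \<xi> * z) ^ n / fact n" for n :: nat and \<xi>
  have "bounded (\<phi> ` limit_set \<Gamma>)" "bounded (D ` limit_set \<Gamma>)"
    by (intro compact_imp_bounded compact_continuous_image compact_limit_set \<phi> D)+
  then obtain A R where A: "\<And>\<xi>. \<xi> \<in> limit_set \<Gamma> \<Longrightarrow> cmod (\<phi> \<xi>) \<le> A"
    and R: "0 < R" "\<And>\<xi>. \<xi> \<in> limit_set \<Gamma> \<Longrightarrow> \<bar>D \<xi>\<bar> \<le> R"
    unfolding bounded_pos by auto
  have cont: "continuous_on (limit_set \<Gamma>) (t n)" for n
    unfolding t_def by (intro continuous_intros \<phi> D) auto
  note int = integrable_if_continuous_on[OF y cont]
  have exps: "(\<lambda>n. t n \<xi>) sums (\<phi> \<xi> * exp (- (\<i> * z * complex_of_real (D \<xi>))))" for \<xi>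
  proof -
    have "(\<lambda>n. \<phi> \<xi> * ((?d \<xi> * z) ^ n /\<^sub>R fact n)) sums (\<phi> \<xi> * exp (?d \<xi> * z))"
      by (intro sums_mult exp_converges)
    then show ?thesis by (simp add: t_def scaleR_conv_of_real field_simps)
  qed
  have le: "cmod (t n \<xi>) \<le> A * ((R * cmod z) ^ n / fact n)" if \<xi>: "\<xi> \<in> limit_set \<Gamma>" for n \<xi>
  proof -
    have "cmod (t n \<xi>) = cmod (\<phi> \<xi>) * ((\<bar>D \<xi>\<bar> * cmod z) ^ n / fact n)"
      by (simp add: t_def norm_mult norm_divide norm_power)
    also have "\<dots> \<le> A * ((R * cmod z) ^ n / fact n)"
      using A[OF \<xi>] R \<xi> by (intro mult_mono divide_right_mono power_mono mult_right_mono) (auto intro: order_trans[OF norm_ge_zero])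
    finally show ?thesis .
  qed
  have smA: "summable (\<lambda>n. A * ((R * cmod z) ^ n / fact n))"
    using summable_exp[of "R * cmod z"] by (intro summable_mult) (simp add: field_simps)
  interpret finite_measure "\<mu> y" by (rule finite_measure[OF y])
  have "(\<lambda>n. \<integral>\<xi>. t n \<xi> \<partial>\<mu> y) sums (\<integral>\<xi>. (\<Sum>n. t n \<xi>) \<partial>\<mu> y)"
  proof (rule sums_integral[OF int])
    show "AE \<xi> in \<mu> y. summable (\<lambda>n. norm (t n \<xi>))"
      using le by (intro AE_I2 summable_comparison_test'[OF smA]) (simp add: space_eq[OF y])
    show "summable (\<lambda>n. \<integral>\<xi>. norm (t n \<xi>) \<partial>\<mu> y)"
    proof (rule summable_comparison_test')
      show "summable (\<lambda>n. A * ((R * cmod z) ^ n / fact n) * measure (\<mu> y) (space (\<mu> y)))"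
        by (intro summable_mult2 smA)
      fix n
      have "(\<integral>\<xi>. norm (t n \<xi>) \<partial>\<mu> y) \<le> (\<integral>\<xi>. A * ((R * cmod z) ^ n / fact n) \<partial>\<mu> y)"
        using le by (intro integral_mono integrable_norm int integrable_const) (simp add: space_eq[OF y])
      then show "norm (\<integral>\<xi>. norm (t n \<xi>) \<partial>\<mu> y) \<le> A * ((R * cmod z) ^ n / fact n) * measure (\<mu> y) (space (\<mu> y))"
        by (simp add: ac_simps)
    qed
  qed
  also have "(\<lambda>n. \<integral>\<xi>. t n \<xi> \<partial>\<mu> y) = (\<lambda>n. (\<integral>\<xi>. \<phi> \<xi> * ?d \<xi> ^ n / fact n \<partial>\<mu> y) * (z - 0) ^ n)"
  proof
    fix n
    have "t n \<xi> = \<phi> \<xi> * ?d \<xi> ^ n / fact n * z ^ n" for \<xi>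
      unfolding t_def power_mult_distrib by simp
    then show "(\<integral>\<xi>. t n \<xi> \<partial>\<mu> y) = (\<integral>\<xi>. \<phi> \<xi> * ?d \<xi> ^ n / fact n \<partial>\<mu> y) * (z - 0) ^ n"
      by (simp only: integral_mult_left_zero diff_zero)
  qed
  also have "(\<lambda>\<xi>. \<Sum>n. t n \<xi>) = (\<lambda>\<xi>. \<phi> \<xi> * exp (- (\<i> * z * complex_of_real (D \<xi>))))"
    using exps by (simp add: sums_iff)
  finally show "(\<lambda>n. (\<integral>\<xi>. \<phi> \<xi> * ?d \<xi> ^ n / fact n \<partial>\<mu> y) * (z - 0) ^ n) sums
      (\<integral>\<xi>. \<phi> \<xi> * exp (- (\<i> * z * complex_of_real (D \<xi>))) \<partial>\<mu> y)" .
qed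

text \<open>The uniform bound \<open>C\<close> yields absolute convergence at each point and, the
  measure being finite, summability of the integrated norms: the two conditions for exchanging sum
  and integral.\<close>

lemma sums_integral_infsum:
  fixes u :: "(real ^ 'n \<Rightarrow> real ^ 'n) \<Rightarrow> real ^ 'n \<Rightarrow> complex" and e :: "nat \<Rightarrow> (real ^ 'n \<Rightarrow> real ^ 'n)"
  assumes y: "y \<in> hyp_space" and e: "bij_betw e UNIV \<Gamma>"
    and u: "\<And>g. g \<in> \<Gamma> \<Longrightarrow> continuous_on (limit_set \<Gamma>) (u g)"
    and C: "\<And>\<xi> T. \<xi> \<in> limit_set \<Gamma> \<Longrightarrow> finite T \<Longrightarrow> T \<subseteq> \<Gamma> \<Longrightarrow> (\<Sum>g\<in>T. cmod (u g \<xi>)) \<le> C"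
  shows "(\<lambda>n. \<integral>\<xi>. u (e n) \<xi> \<partial>\<mu> y) sums (\<integral>\<xi>. (\<Sum>\<^sub>\<infinity>g\<in>\<Gamma>. u g \<xi>) \<partial>\<mu> y)"
proof -
  interpret finite_measure "\<mu> y" by (rule finite_measure[OF y])
  have e\<Gamma>: "e n \<in> \<Gamma>" for n using bij_betwE[OF e] by blast
  note int = integrable_if_continuous_on[OF y u]
  have sm: "summable (\<lambda>n. cmod (u (e n) \<xi>))" if \<xi>: "\<xi> \<in> limit_set \<Gamma>" for \<xi>
    using summable_if_finite_sums_le[where m = "\<lambda>g. cmod (u g \<xi>)", OF e _ C[OF \<xi>]] by simp
  have "(\<lambda>n. \<integral>\<xi>. u (e n) \<xi> \<partial>\<mu> y) sums (\<integral>\<xi>. (\<Sum>n. u (e n) \<xi>) \<partial>\<mu> y)"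
  proof (rule sums_integral[OF int[OF e\<Gamma>]])
    show "AE \<xi> in \<mu> y. summable (\<lambda>n. norm (u (e n) \<xi>))"
      using sm by (intro AE_I2) (simp add: space_eq[OF y])
    show "summable (\<lambda>n. \<integral>\<xi>. norm (u (e n) \<xi>) \<partial>\<mu> y)"
    proof (rule summable_if_finite_sums_le[where m = "\<lambda>g. \<integral>\<xi>. norm (u g \<xi>) \<partial>\<mu> y", OF e])
      fix T assume T: "finite T" "T \<subseteq> \<Gamma>"
      have "(\<Sum>g\<in>T. \<integral>\<xi>. norm (u g \<xi>) \<partial>\<mu> y) = (\<integral>\<xi>. (\<Sum>g\<in>T. norm (u g \<xi>)) \<partial>\<mu> y)"
        using T by (intro Bochner_Integration.integral_sum[symmetric] integrable_norm int) auto
      also have "\<dots> \<le> (\<integral>\<xi>. C \<partial>\<mu> y)"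
        using C[OF _ T] T
        by (intro integral_mono Bochner_Integration.integrable_sum integrable_norm int integrable_const)
           (auto simp: space_eq[OF y])
      finally show "(\<Sum>g\<in>T. \<integral>\<xi>. norm (u g \<xi>) \<partial>\<mu> y) \<le> (\<integral>\<xi>. C \<partial>\<mu> y)" .
    qed simp
  qed
  also have "(\<integral>\<xi>. (\<Sum>n. u (e n) \<xi>) \<partial>\<mu> y) = (\<integral>\<xi>. (\<Sum>\<^sub>\<infinity>g\<in>\<Gamma>. u g \<xi>) \<partial>\<mu> y)"
  proof (intro Bochner_Integration.integral_cong refl)
    fix \<xi> assume "\<xi> \<in> space (\<mu> y)"
    then have "\<xi> \<in> limit_set \<Gamma>" by (simp add: space_eq[OF y])
    note sm = sm[OF this]
    have "((\<lambda>n. u (e n) \<xi>) has_sum (\<Sum>n. u (e n) \<xi>)) UNIV"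
      by (rule norm_summable_imp_has_sum[OF sm summable_sums[OF summable_norm_cancel[OF sm]]])
    then show "(\<Sum>n. u (e n) \<xi>) = (\<Sum>\<^sub>\<infinity>g\<in>\<Gamma>. u g \<xi>)"
      using infsum_reindex_bij_betw[OF e, of "\<lambda>g. u g \<xi>"] by (simp add: infsumI)
  qed
  finally show ?thesis .
qed

lemma kms_condition:
  assumes x: "x \<in> hyp_space" and \<delta>: "0 \<le> \<delta>"
    and f: "f \<in> reduced_crossed_product \<Gamma>" and f': "f' \<in> reduced_crossed_product \<Gamma>"
  shows "\<exists>F :: complex \<Rightarrow> complex.
      (\<forall>t::real. F (complex_of_real t) = ps_functional (\<mu> x) (cp_mult \<Gamma> f (cp_flow x t f')))
    \<and> continuous_on {z. 0 \<le> Im z \<and> Im z \<le> \<delta>} F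
    \<and> bounded (F ` {z. 0 \<le> Im z \<and> Im z \<le> \<delta>})
    \<and> F analytic_on {z. 0 < Im z \<and> Im z < \<delta>}
    \<and> (\<forall>t::real. F (complex_of_real t + \<i> * complex_of_real \<delta>)
         = ps_functional (\<mu> x) (cp_mult \<Gamma> (cp_flow x t f') f))"
proof -
  interpret finite_measure "\<mu> x" by (rule finite_measure[OF x])
  let ?S = "{z. 0 \<le> Im z \<and> Im z \<le> \<delta>}"
  define e where "e = from_nat_into \<Gamma>"
  have e: "bij_betw e UNIV \<Gamma>"
    unfolding e_def by (rule bij_betw_from_nat_into[OF countable infinite])
  have e\<Gamma>: "e n \<in> \<Gamma>" for n using bij_betwE[OF e] by blast
  define D where "D g \<xi> = busemann_diff x (inv_fun g x) \<xi>" for g \<xi>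
  define b where "b = crossed_term f f'"
  define E where "E z g \<xi> = exp (- (\<i> * z * complex_of_real (D g \<xi>)))" for z g \<xi>
  define I where "I g z = (\<integral>\<xi>. b g \<xi> * E z g \<xi> \<partial>\<mu> x)" for g z
  obtain C where
    C1: "\<And>\<xi> T. \<xi> \<in> limit_set \<Gamma> \<Longrightarrow> finite T \<Longrightarrow> T \<subseteq> \<Gamma> \<Longrightarrow> (\<Sum>g\<in>T. cmod (b g \<xi>)) \<le> C"
    and C2: "\<And>\<xi> T. \<xi> \<in> limit_set \<Gamma> \<Longrightarrow> finite T \<Longrightarrow> T \<subseteq> \<Gamma>
       \<Longrightarrow> (\<Sum>g\<in>T. cmod (b g (bdry_act (inv_fun g) \<xi>))) \<le> C"
    unfolding b_def using crossed_term_bound[OF f f'] by blast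
  have cD: "continuous_on (limit_set \<Gamma>) (D g)" if "g \<in> \<Gamma>" for g
    unfolding D_def by (rule continuous_on_busemann_diff[OF x hyp_space_image[OF inv_closed[OF that] x]])
  have cb: "continuous_on (limit_set \<Gamma>) (b g)" if "g \<in> \<Gamma>" for g
    unfolding b_def by (rule continuous_on_crossed_term[OF f f' that])
  have cE: "continuous_on (limit_set \<Gamma>) (E z g)" if "g \<in> \<Gamma>" for g z
    unfolding E_def by (intro continuous_intros cD that)
  have inv_bij: "continuous_on (limit_set \<Gamma>) (\<lambda>\<xi>. q (bdry_act (inv_fun g) \<xi>))"
    if "g \<in> \<Gamma>" "continuous_on (limit_set \<Gamma>) q" for g and q :: "real ^ 'n \<Rightarrow> 'c::topological_space"
    by (rule continuous_on_compose2[OF that(2) continuous_on_bdry_act[OF inv_closed[OF that(1)]]])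
       (use bdry_act_limit_set[OF inv_closed[OF that(1)]] in blast)
  define m where "m g = (\<integral>\<xi>. cmod (b g \<xi>) \<partial>\<mu> x) + (\<integral>\<xi>. cmod (b g (bdry_act (inv_fun g) \<xi>)) \<partial>\<mu> x)" for g
  have int1: "integrable (\<mu> x) (\<lambda>\<xi>. cmod (b g \<xi>))" if "g \<in> \<Gamma>" for g
    by (intro integrable_norm integrable_if_continuous_on x cb that)
  have int2: "integrable (\<mu> x) (\<lambda>\<xi>. cmod (b g (bdry_act (inv_fun g) \<xi>)))" if "g \<in> \<Gamma>" for g
    by (intro integrable_norm integrable_if_continuous_on x inv_bij cb that)
  have int3: "integrable (\<mu> x) (\<lambda>\<xi>. exp (\<delta> * D g \<xi>) * cmod (b g \<xi>))" if "g \<in> \<Gamma>" for g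
    by (intro integrable_if_continuous_on x continuous_intros cb cD that)
  have m_eq: "m g = (\<integral>\<xi>. cmod (b g \<xi>) + exp (\<delta> * D g \<xi>) * cmod (b g \<xi>) \<partial>\<mu> x)" if g: "g \<in> \<Gamma>" for g
  proof -
    \<comment> \<open>The transformation rule is applied to the modulus of \<open>b g\<close> at
      \<xi> g^-1, so that the substitution \<xi> g restores \<open>b g \<xi>\<close>.\<close>
    have "(\<integral>\<xi>. cmod (b g (bdry_act (inv_fun g) \<xi>)) \<partial>\<mu> x)
        = (\<integral>\<xi>. exp (\<delta> * D g \<xi>) * cmod (b g (bdry_act (inv_fun g) (bdry_act g \<xi>))) \<partial>\<mu> x)"
      unfolding D_def
      by (rule conformal_transformation_real[OF g x]) (intro continuous_intros inv_bij cb g)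
    also have "\<dots> = (\<integral>\<xi>. exp (\<delta> * D g \<xi>) * cmod (b g \<xi>) \<partial>\<mu> x)"
      by (intro Bochner_Integration.integral_cong refl) (simp add: space_eq[OF x] bdry_act_inv(2)[OF g])
    finally show ?thesis
      by (simp add: m_def Bochner_Integration.integral_add[OF int1[OF g] int3[OF g]])
  qed
  have sum_int: "(\<Sum>g\<in>T. \<integral>\<xi>. q g \<xi> \<partial>\<mu> x) \<le> (\<integral>\<xi>. C \<partial>\<mu> x)"
    if T: "finite T" "T \<subseteq> \<Gamma>" and q: "\<And>g. g \<in> \<Gamma> \<Longrightarrow> integrable (\<mu> x) (q g)"
      and le: "\<And>\<xi>. \<xi> \<in> limit_set \<Gamma> \<Longrightarrow> (\<Sum>g\<in>T. q g \<xi>) \<le> C" for T and q :: "_ \<Rightarrow> _ \<Rightarrow> real"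
  proof -
    have "(\<Sum>g\<in>T. \<integral>\<xi>. q g \<xi> \<partial>\<mu> x) = (\<integral>\<xi>. (\<Sum>g\<in>T. q g \<xi>) \<partial>\<mu> x)"
      using T q by (intro Bochner_Integration.integral_sum[symmetric]) auto
    also have "\<dots> \<le> (\<integral>\<xi>. C \<partial>\<mu> x)"
      using T q le
      by (intro integral_mono Bochner_Integration.integrable_sum integrable_const) (auto simp: space_eq[OF x])
    finally show ?thesis .
  qed
  have m_nonneg: "0 \<le> m g" for g by (simp add: m_def)
  have sm: "summable (\<lambda>n. m (e n))"
  proof (rule summable_if_finite_sums_le[OF e])
    fix T assume T: "finite T" "T \<subseteq> \<Gamma>"
    show "sum m T \<le> (\<integral>\<xi>. C \<partial>\<mu> x) + (\<integral>\<xi>. C \<partial>\<mu> x)"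
      unfolding m_def sum.distrib by (intro add_mono sum_int[OF T] int1 int2 C1 C2 T)
  qed (rule m_nonneg)
  have I_le: "cmod (I g z) \<le> m g" if g: "g \<in> \<Gamma>" and z: "z \<in> ?S" for g z
  proof -
    have "cmod (I g z) \<le> (\<integral>\<xi>. cmod (b g \<xi> * E z g \<xi>) \<partial>\<mu> x)"
      unfolding I_def by (rule integral_norm_bound)
    also have "\<dots> \<le> m g"
      unfolding m_eq[OF g]
    proof (rule integral_mono)
      show "integrable (\<mu> x) (\<lambda>\<xi>. cmod (b g \<xi> * E z g \<xi>))"
        by (intro integrable_norm integrable_if_continuous_on x continuous_on_mult cb cE g)
      show "integrable (\<mu> x) (\<lambda>\<xi>. cmod (b g \<xi>) + exp (\<delta> * D g \<xi>) * cmod (b g \<xi>))"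
        by (rule Bochner_Integration.integrable_add[OF int1[OF g] int3[OF g]])
      fix \<xi>
      \<comment> \<open>On the strip this lies between 0 and \<open>\<delta> * D g \<xi>\<close>,
        whichever sign \<open>D g \<xi>\<close> has; the exponential is thus at most the sum of its
        values on the two boundary lines.\<close>
      have "Im z * D g \<xi> \<le> max 0 (\<delta> * D g \<xi>)"
      proof (cases "0 \<le> D g \<xi>")
        case True
        then have "Im z * D g \<xi> \<le> \<delta> * D g \<xi>" using z by (intro mult_right_mono) auto
        then show ?thesis by simp
      next
        case False
        then have "Im z * D g \<xi> \<le> 0" using z by (simp add: mult_nonneg_nonpos)
        then show ?thesis by simp
      qed
      then have "exp (Im z * D g \<xi>) \<le> 1 + exp (\<delta> * D g \<xi>)"
        by (cases "0 \<le> \<delta> * D g \<xi>") (auto simp: max_def add_increasing add_increasing2 split: if_splits)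
      moreover have "cmod (E z g \<xi>) = exp (Im z * D g \<xi>)"
        by (simp add: E_def)
      ultimately have "cmod (b g \<xi>) * cmod (E z g \<xi>) \<le> cmod (b g \<xi>) * (1 + exp (\<delta> * D g \<xi>))"
        by (intro mult_left_mono) auto
      then show "cmod (b g \<xi> * E z g \<xi>) \<le> cmod (b g \<xi>) + exp (\<delta> * D g \<xi>) * cmod (b g \<xi>)"
        by (simp add: norm_mult algebra_simps)
    qed
    finally show ?thesis .
  qed
  define F where "F z = (\<Sum>n. I (e n) z)" for z
  have ulim: "uniform_limit ?S (\<lambda>n z. \<Sum>k<n. I (e k) z) F sequentially"
    unfolding F_def by (rule Weierstrass_m_test[OF _ sm]) (use I_le e\<Gamma> in blast)
  have entire: "I g holomorphic_on UNIV" if "g \<in> \<Gamma>" for g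
    unfolding I_def E_def by (rule entire_exp_integral[OF x cb[OF that] cD[OF that]])
  then have hol: "(\<lambda>z. \<Sum>k<n. I (e k) z) holomorphic_on A" for n A
    using e\<Gamma> holomorphic_on_subset by (intro holomorphic_on_sum) blast
  have cont: "continuous_on ?S F"
    by (rule uniform_limit_theorem[OF _ ulim])
       (auto intro!: always_eventually holomorphic_on_imp_continuous_on hol)
  have "cmod (F z) \<le> (\<Sum>n. m (e n))" if "z \<in> ?S" for z
    unfolding F_def using I_le[OF e\<Gamma> that]
    by (intro norm_suminf_le sm) auto
  then have bdd: "bounded (F ` ?S)" unfolding bounded_iff by blast
  let ?U = "{z. 0 < Im z \<and> Im z < \<delta>}"
  have openU: "open ?U"
    by (intro open_Collect_conj open_halfspace_Im_gt open_halfspace_Im_lt)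
  have "F holomorphic_on ?U"
  proof (rule holomorphic_uniform_sequence[OF openU hol])
    fix z assume "z \<in> ?U"
    then obtain r where r: "0 < r" "cball z r \<subseteq> ?U" using openU open_contains_cball by blast
    moreover have "uniform_limit (cball z r) (\<lambda>n z. \<Sum>k<n. I (e k) z) F sequentially"
      by (rule uniform_limit_on_subset[OF ulim]) (use r(2) in force)
    ultimately show "\<exists>d>0. cball z d \<subseteq> ?U \<and> uniform_limit (cball z d) (\<lambda>n z. \<Sum>k<n. I (e k) z) F sequentially"
      by blast
  qed
  then have ana: "F analytic_on ?U" by (simp add: analytic_on_open openU)
  have norm_E: "cmod (E (complex_of_real t) g \<xi>) = 1" for t g \<xi>
    by (simp add: E_def)
  have real_line: "F (complex_of_real t) = ps_functional (\<mu> x) (cp_mult \<Gamma> f (cp_flow x t f'))" for t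
  proof -
    have "(\<lambda>n. I (e n) (complex_of_real t))
        sums (\<integral>\<xi>. (\<Sum>\<^sub>\<infinity>g\<in>\<Gamma>. b g \<xi> * E (complex_of_real t) g \<xi>) \<partial>\<mu> x)"
      unfolding I_def
    proof (rule sums_integral_infsum[OF x e])
      show "continuous_on (limit_set \<Gamma>) (\<lambda>\<xi>. b g \<xi> * E (complex_of_real t) g \<xi>)" if "g \<in> \<Gamma>" for g
        by (intro continuous_on_mult cb cE that)
      show "(\<Sum>g\<in>T. cmod (b g \<xi> * E (complex_of_real t) g \<xi>)) \<le> C"
        if "\<xi> \<in> limit_set \<Gamma>" "finite T" "T \<subseteq> \<Gamma>" for \<xi> T
        using C1[OF that] by (simp add: norm_mult norm_E)
    qed
    then have "F (complex_of_real t) = (\<integral>\<xi>. (\<Sum>\<^sub>\<infinity>g\<in>\<Gamma>. b g \<xi> * E (complex_of_real t) g \<xi>) \<partial>\<mu> x)"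
      by (simp add: F_def sums_iff)
    also have "\<dots> = (\<integral>\<xi>. cp_mult \<Gamma> f (cp_flow x t f') id \<xi> \<partial>\<mu> x)"
      by (intro Bochner_Integration.integral_cong refl)
         (simp add: space_eq[OF x] cp_mult_flow_right[OF x] b_def E_def D_def)
    finally show ?thesis by (simp add: ps_functional_def)
  qed
  have top_line: "F (complex_of_real t + \<i> * complex_of_real \<delta>)
      = ps_functional (\<mu> x) (cp_mult \<Gamma> (cp_flow x t f') f)" for t
  proof -
    let ?u = "\<lambda>g \<xi>. b g (bdry_act (inv_fun g) \<xi>) * E (complex_of_real t) g (bdry_act (inv_fun g) \<xi>)"
    have cu: "continuous_on (limit_set \<Gamma>) (?u g)" if g: "g \<in> \<Gamma>" for g
      by (intro continuous_on_mult inv_bij[OF g cb[OF g]] inv_bij[OF g cE[OF g]])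
    have Iu: "I g (complex_of_real t + \<i> * complex_of_real \<delta>) = (\<integral>\<xi>. ?u g \<xi> \<partial>\<mu> x)" if g: "g \<in> \<Gamma>" for g
    proof -
      have "(\<integral>\<xi>. ?u g \<xi> \<partial>\<mu> x)
          = (\<integral>\<xi>. complex_of_real (exp (\<delta> * D g \<xi>)) * ?u g (bdry_act g \<xi>) \<partial>\<mu> x)"
        unfolding D_def by (rule conformal_transformation[OF g x cu[OF g]])
      also have "\<dots> = I g (complex_of_real t + \<i> * complex_of_real \<delta>)"
        unfolding I_def
      proof (intro Bochner_Integration.integral_cong refl)
        fix \<xi> assume "\<xi> \<in> space (\<mu> x)"
        then have \<xi>: "\<xi> \<in> limit_set \<Gamma>" by (simp add: space_eq[OF x])
        \<comment> \<open>Adding i\<delta> to the time multiplies the phase by exp(\<delta> D),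
          exactly the factor produced by the transformation rule.\<close>
        have "complex_of_real (exp (\<delta> * D g \<xi>)) * E (complex_of_real t) g \<xi>
            = E (complex_of_real t + \<i> * complex_of_real \<delta>) g \<xi>"
          by (simp add: E_def exp_of_real[symmetric] algebra_simps flip: exp_add)
        then show "complex_of_real (exp (\<delta> * D g \<xi>)) * ?u g (bdry_act g \<xi>)
            = b g \<xi> * E (complex_of_real t + \<i> * complex_of_real \<delta>) g \<xi>"
          by (simp add: bdry_act_inv(2)[OF g \<xi>] mult.left_commute)
      qed
      finally show ?thesis by simp
    qed
    have "(\<lambda>n. I (e n) (complex_of_real t + \<i> * complex_of_real \<delta>))
        sums (\<integral>\<xi>. (\<Sum>\<^sub>\<infinity>g\<in>\<Gamma>. ?u g \<xi>) \<partial>\<mu> x)"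
      unfolding Iu[OF e\<Gamma>]
    proof (rule sums_integral_infsum[OF x e cu])
      show "(\<Sum>g\<in>T. cmod (?u g \<xi>)) \<le> C"
        if "\<xi> \<in> limit_set \<Gamma>" "finite T" "T \<subseteq> \<Gamma>" for \<xi> T
        using C2[OF that] by (simp add: norm_mult norm_E)
    qed
    then have "F (complex_of_real t + \<i> * complex_of_real \<delta>) = (\<integral>\<xi>. (\<Sum>\<^sub>\<infinity>g\<in>\<Gamma>. ?u g \<xi>) \<partial>\<mu> x)"
      by (simp add: F_def sums_iff)
    also have "\<dots> = (\<integral>\<xi>. cp_mult \<Gamma> (cp_flow x t f') f id \<xi> \<partial>\<mu> x)"
      by (intro Bochner_Integration.integral_cong refl)
         (simp add: space_eq[OF x] cp_mult_flow_left[OF x] b_def E_def D_def)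
    finally show ?thesis by (simp add: ps_functional_def)
  qed
  show ?thesis
    using real_line cont bdd ana top_line by blast
qed

end

theorem proposition4p8:
  fixes \<Gamma> :: "(real ^ 'n \<Rightarrow> real ^ 'n) set"
    and x0 x :: "real ^ 'n"
    and \<mu> :: "real ^ 'n \<Rightarrow> (real ^ 'n) measure"
    and f f' :: "'n coeffs"
    and \<delta> :: real
    and \<alpha> :: "real \<Rightarrow> 'n coeffs \<Rightarrow> 'n coeffs"
    and \<tau> :: "'n coeffs \<Rightarrow> complex"
  assumes "discrete_isom_group \<Gamma>"
    and "torsion_free \<Gamma>"
    and "\<not> virtually_abelian \<Gamma>"
    and "x0 \<in> hyp_space"
    and "patterson_sullivan \<Gamma> x0 \<mu>"
    and "x \<in> hyp_space"
    and "f \<in> reduced_crossed_product \<Gamma>"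
    and "f' \<in> reduced_crossed_product \<Gamma>"
  defines "\<delta> \<equiv> critical_exponent \<Gamma> x0"
    and "\<alpha> \<equiv> cp_flow x"
    and "\<tau> \<equiv> ps_functional (\<mu> x)"
  shows "\<exists>F :: complex \<Rightarrow> complex.
      (\<forall>t::real. F (complex_of_real t) = \<tau> (cp_mult \<Gamma> f (\<alpha> t f')))
    \<and> continuous_on {z. 0 \<le> Im z \<and> Im z \<le> \<delta>} F
    \<and> bounded (F ` {z. 0 \<le> Im z \<and> Im z \<le> \<delta>})
    \<and> F analytic_on {z. 0 < Im z \<and> Im z < \<delta>}
    \<and> (\<forall>t::real. F (complex_of_real t + \<i> * complex_of_real \<delta>) = \<tau> (cp_mult \<Gamma> (\<alpha> t f') f))"
proof -
  note defs = \<delta>_def \<alpha>_def \<tau>_def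
  interpret discrete_hyp_group \<Gamma> by unfold_locales fact
  have fm: "finite_measure (\<mu> x)" and sets: "sets (\<mu> x) = sets (restrict_space borel (limit_set \<Gamma>))"
    using assms(5,6) by (simp_all add: patterson_sullivan_def)
  show ?thesis
  \<comment> \<open>With zero mass, as for an empty limit set, the functional vanishes identically
    and the zero function is a continuation whatever the sign of the exponent. Otherwise the limit
    set is nonempty, which makes \<Gamma> infinite and the exponent nonnegative.\<close>
  proof (cases "measure (\<mu> x) (space (\<mu> x)) = 0")
    case True
    then have "space (\<mu> x) \<in> null_sets (\<mu> x)"
      using finite_measure.emeasure_eq_measure[OF fm] by (auto simp: null_sets_def)
    then have "ps_functional (\<mu> x) u = 0" for u
      unfolding ps_functional_def by (intro integral_eq_zero_AE AE_I') auto
    then show ?thesis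
      unfolding defs by (intro exI[of _ "\<lambda>_. 0"]) (auto simp: image_constant_conv)
  next
    case False
    have "space (\<mu> x) = limit_set \<Gamma>"
      using sets_eq_imp_space_eq[OF sets] by (simp add: space_restrict_space)
    then have "infinite \<Gamma>" using False limit_set_empty_if_finite by auto
    then interpret patterson_sullivan_measures \<Gamma> x0 \<mu> "critical_exponent \<Gamma> x0"
      using assms(4,5) by unfold_locales auto
    show ?thesis
      unfolding defs
      by (rule kms_condition[OF assms(6) exponent_nonneg[OF assms(6) False] assms(7,8)])
  qed
qed

end
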